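(* Let $(G,\mathcal{P})$ be a relatively hyperbolic group pair and let $\mathcal{Q}$ be a collection of full relatively quasi-convex subgroups of $(G,\mathcal{P})$. For $1\le i\le n$ let $p_i\in G$, $Q_i\in\mathcal{Q}$ and $S_i\subseteq Q_i$ be such that \[1\notin p_1(Q_1\smallsetminus S_1)\cdots p_n(Q_n\smallsetminus S_n).\] Then for all sufficiently long $\mathcal{Q}$--fillings $G\to G/K$ of $(G,\mathcal{P})$, the kernel $K$ contains no element of the form $p_1t_1\cdots p_nt_n$ with $t_i\in Q_i\smallsetminus\big((K\cap Q_i)S_i\big)$ for each $i$.
   Context: Given a group pair $(G,\mathcal{P})$ and normal subgroups $N_P\trianglelefteq P$ for $P\in\mathcal{P}$, the (Dehn) filling is $G\to G/K$ where $K$ is the normal closure of $\bigcup_P N_P$. With $P^g=gPg^{-1}$, the filling is an $H$--filling if for all $g\in G$ and $P\in\mathcal{P}$, $|H\cap P^g|=\infty$ implies $N_P^g\subseteq H$; it is a $\mathcal{Q}$--filling if it is an $H$--filling for every $H\in\mathcal{Q}$. A property holds for all sufficiently long $\mathcal{Q}$--fillings if there is a finite set $S\subseteq\bigcup\mathcal{P}\smallsetminus\{1\}$ such that the property holds for every $\mathcal{Q}$--filling with $(\bigcup_P N_P)\cap S=\emptyset$. Relative quasi-convexity is in the sense of Agol–Groves–Manning (equivalently Hruska). A relatively quasi-convex subgroup $H$ is full if whenever $P$ is a parabolic subgroup (a conjugate of an element of $\mathcal{P}$) with $H\cap P$ infinite, $H\cap P$ has finite index in $P$. *)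

theory Defs
  imports "HOL-Algebra.Algebra"
begin

definition conjugate :: "('g,'b) monoid_scheme \<Rightarrow> 'g \<Rightarrow> 'g set \<Rightarrow> 'g set" where
  "conjugate G g A = {g \<otimes>\<^bsub>G\<^esub> a \<otimes>\<^bsub>G\<^esub> inv\<^bsub>G\<^esub> g | a. a \<in> A}"

definition word_length :: "('g,'b) monoid_scheme \<Rightarrow> 'g set \<Rightarrow> 'g \<Rightarrow> nat" where
  "word_length G A g =
     (LEAST n. \<exists>ws. length ws = n \<and> set ws \<subseteq> A \<and>
        foldr (\<lambda>a b. a \<otimes>\<^bsub>G\<^esub> b) ws \<one>\<^bsub>G\<^esub> = g)"

definition compatible_gen_set :: "('g,'b) monoid_scheme \<Rightarrow> 'g set set \<Rightarrow> 'g set \<Rightarrow> bool" where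
  "compatible_gen_set G \<P> S \<longleftrightarrow>
     finite S \<and> S \<subseteq> carrier G \<and> (\<forall>s\<in>S. inv\<^bsub>G\<^esub> s \<in> S) \<and>
     generate G S = carrier G \<and> (\<forall>P\<in>\<P>. generate G (S \<inter> P) = P)"

text \<open>Vertices: Base x is the Cayley graph vertex x; Horo P x k (k \<ge> 1) is the vertex
  (x,k) of the combinatorial horoball over the coset xP.\<close>
datatype 'g cusp_vertex = Base 'g | Horo "'g set" 'g nat

definition cusp_verts :: "('g,'b) monoid_scheme \<Rightarrow> 'g set set \<Rightarrow> 'g cusp_vertex set" where
  "cusp_verts G \<P> =
     {Base x | x. x \<in> carrier G} \<union>
     {Horo P x k | P x k. P \<in> \<P> \<and> x \<in> carrier G \<and> 1 \<le> k}"

definition cusp_edge0 :: "('g,'b) monoid_scheme \<Rightarrow> 'g set set \<Rightarrow> 'g set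
    \<Rightarrow> 'g cusp_vertex \<Rightarrow> 'g cusp_vertex \<Rightarrow> bool" where
  "cusp_edge0 G \<P> S u v \<longleftrightarrow>
     (\<exists>x s. x \<in> carrier G \<and> s \<in> S \<and> u = Base x \<and> v = Base (x \<otimes>\<^bsub>G\<^esub> s)) \<or>
     (\<exists>P x. P \<in> \<P> \<and> x \<in> carrier G \<and> u = Base x \<and> v = Horo P x 1) \<or>
     (\<exists>P x k. P \<in> \<P> \<and> x \<in> carrier G \<and> 1 \<le> k \<and> u = Horo P x k \<and> v = Horo P x (Suc k)) \<or>
     (\<exists>P x y k. P \<in> \<P> \<and> x \<in> carrier G \<and> y \<in> carrier G \<and> 1 \<le> k \<and>
        inv\<^bsub>G\<^esub> x \<otimes>\<^bsub>G\<^esub> y \<in> P \<and>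
        0 < word_length G (S \<inter> P) (inv\<^bsub>G\<^esub> x \<otimes>\<^bsub>G\<^esub> y) \<and>
        word_length G (S \<inter> P) (inv\<^bsub>G\<^esub> x \<otimes>\<^bsub>G\<^esub> y) \<le> 2 ^ k \<and>
        u = Horo P x k \<and> v = Horo P y k)"

definition cusp_adj :: "('g,'b) monoid_scheme \<Rightarrow> 'g set set \<Rightarrow> 'g set
    \<Rightarrow> 'g cusp_vertex \<Rightarrow> 'g cusp_vertex \<Rightarrow> bool" where
  "cusp_adj G \<P> S u v \<longleftrightarrow> cusp_edge0 G \<P> S u v \<or> cusp_edge0 G \<P> S v u"

definition is_walk :: "('v \<Rightarrow> 'v \<Rightarrow> bool) \<Rightarrow> 'v list \<Rightarrow> bool" where
  "is_walk adj ws \<longleftrightarrow> ws \<noteq> [] \<and> (\<forall>i. Suc i < length ws \<longrightarrow> adj (ws ! i) (ws ! Suc i))"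

definition graph_dist :: "('v \<Rightarrow> 'v \<Rightarrow> bool) \<Rightarrow> 'v \<Rightarrow> 'v \<Rightarrow> nat" where
  "graph_dist adj u v =
     (LEAST n. \<exists>ws. is_walk adj ws \<and> hd ws = u \<and> last ws = v \<and> length ws = Suc n)"

definition is_geodesic :: "('v \<Rightarrow> 'v \<Rightarrow> bool) \<Rightarrow> 'v list \<Rightarrow> bool" where
  "is_geodesic adj ws \<longleftrightarrow>
     is_walk adj ws \<and> length ws = Suc (graph_dist adj (hd ws) (last ws))"

definition gromov_product :: "('v \<Rightarrow> 'v \<Rightarrow> bool) \<Rightarrow> 'v \<Rightarrow> 'v \<Rightarrow> 'v \<Rightarrow> real" where
  "gromov_product adj w x y =
     (real (graph_dist adj w x) + real (graph_dist adj w y) - real (graph_dist adj x y)) / 2"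

definition hyperbolic_graph :: "'v set \<Rightarrow> ('v \<Rightarrow> 'v \<Rightarrow> bool) \<Rightarrow> bool" where
  "hyperbolic_graph V adj \<longleftrightarrow>
     (\<exists>\<delta>::real. \<forall>w\<in>V. \<forall>x\<in>V. \<forall>y\<in>V. \<forall>z\<in>V.
        gromov_product adj w x z \<ge> min (gromov_product adj w x y) (gromov_product adj w y z) - \<delta>)"

definition rel_hyperbolic :: "('g,'b) monoid_scheme \<Rightarrow> 'g set set \<Rightarrow> bool" where
  "rel_hyperbolic G \<P> \<longleftrightarrow>
     group G \<and> finite \<P> \<and> (\<forall>P\<in>\<P>. subgroup P G) \<and>
     (\<exists>S. compatible_gen_set G \<P> S \<and> hyperbolic_graph (cusp_verts G \<P>) (cusp_adj G \<P> S))"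

text \<open>Agol--Groves--Manning: geodesics of the cusped space with endpoints in H have their
  Cayley-graph points uniformly close to H.\<close>
definition rel_quasiconvex :: "('g,'b) monoid_scheme \<Rightarrow> 'g set set \<Rightarrow> 'g set \<Rightarrow> bool" where
  "rel_quasiconvex G \<P> H \<longleftrightarrow>
     subgroup H G \<and>
     (\<exists>S. compatible_gen_set G \<P> S \<and>
        (\<exists>\<mu>::nat. \<forall>ws. is_geodesic (cusp_adj G \<P> S) ws \<and>
            hd ws \<in> Base ` H \<and> last ws \<in> Base ` H \<longrightarrow>
            (\<forall>b\<in>carrier G. Base b \<in> set ws \<longrightarrow>
               (\<exists>h\<in>H. graph_dist (cusp_adj G \<P> S) (Base b) (Base h) \<le> \<mu>))))"

definition finite_index_in :: "('g,'b) monoid_scheme \<Rightarrow> 'g set \<Rightarrow> 'g set \<Rightarrow> bool" where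
  "finite_index_in G A B \<longleftrightarrow> finite {A #>\<^bsub>G\<^esub> x | x. x \<in> B}"

definition full_rel_quasiconvex :: "('g,'b) monoid_scheme \<Rightarrow> 'g set set \<Rightarrow> 'g set \<Rightarrow> bool" where
  "full_rel_quasiconvex G \<P> H \<longleftrightarrow>
     rel_quasiconvex G \<P> H \<and>
     (\<forall>g\<in>carrier G. \<forall>P\<in>\<P>. infinite (H \<inter> conjugate G g P) \<longrightarrow>
        finite_index_in G (H \<inter> conjugate G g P) (conjugate G g P))"

definition is_filling :: "('g,'b) monoid_scheme \<Rightarrow> 'g set set \<Rightarrow> ('g set \<Rightarrow> 'g set) \<Rightarrow> bool" where
  "is_filling G \<P> N \<longleftrightarrow> (\<forall>P\<in>\<P>. normal (N P) (G\<lparr>carrier := P\<rparr>))"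

definition filling_kernel :: "('g,'b) monoid_scheme \<Rightarrow> 'g set set \<Rightarrow> ('g set \<Rightarrow> 'g set) \<Rightarrow> 'g set" where
  "filling_kernel G \<P> N = generate G (\<Union>g\<in>carrier G. conjugate G g (\<Union>P\<in>\<P>. N P))"

definition H_filling :: "('g,'b) monoid_scheme \<Rightarrow> 'g set set \<Rightarrow> ('g set \<Rightarrow> 'g set) \<Rightarrow> 'g set \<Rightarrow> bool" where
  "H_filling G \<P> N H \<longleftrightarrow>
     (\<forall>g\<in>carrier G. \<forall>P\<in>\<P>. infinite (H \<inter> conjugate G g P) \<longrightarrow> conjugate G g (N P) \<subseteq> H)"

definition alt_prod :: "('g,'b) monoid_scheme \<Rightarrow> (nat \<Rightarrow> 'g) \<Rightarrow> (nat \<Rightarrow> 'g) \<Rightarrow> nat \<Rightarrow> 'g" where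
  "alt_prod G p t n = foldr (\<lambda>i acc. p i \<otimes>\<^bsub>G\<^esub> t i \<otimes>\<^bsub>G\<^esub> acc) [0..<n] \<one>\<^bsub>G\<^esub>"

end

theory Submission
  imports Defs
begin

text \<open>Let \<open>X\<close> be the cusped space, \<open>K\<close> the kernel of a long filling, and for a coset \<open>gP\<close> view the
  horoball over \<open>gP\<close> as a point that is fixed by \<open>N\<^sub>P\<^sup>g\<close>. Since short elements are excluded from the
  filling kernels, each nontrivial element of \<open>N\<^sub>P\<^sup>g\<close> rotates \<open>X\<close> by a large angle about that point.
  Write \<open>k \<in> K\<close> as a product of conjugates of elements of the \<open>N\<^sub>P\<close>, with the number of
  factors minimal and then with the sum of the distances from \<open>1\<close> to the cosets minimal. If \<open>k \<noteq> 1\<close>, a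
  geodesic from \<open>1\<close> to \<open>k\<close> runs deep into the horoball that belongs to a farthest factor, and removing this
  factor multiplies \<open>k\<close> by an element of the corresponding \<open>N\<^sub>P\<^sup>g\<close>.

  Let \<open>k = p\<^sub>1 t\<^sub>1 \<dots> p\<^sub>n t\<^sub>n \<in> K\<close>. Polygons are thin, so a geodesic side of some \<open>t\<^sub>i\<close> also runs deep into
  this horoball. By quasiconvexity \<open>Q\<^sub>i\<close> meets the corresponding parabolic subgroup in an infinite set,
  so the \<open>\<Q>\<close>-filling condition allows \<open>t\<^sub>i\<close> to be replaced by another element of \<open>(K \<inter> Q\<^sub>i) t\<^sub>i\<close> for
  which the product needs fewer factors. Repeating this, one arrives at the excluded product \<open>1\<close>.\<close>

section \<open>Graph metrics\<close>

text \<open>Horoballs have no apex, so \<open>Horo P g k\<close> serves as one, with a depth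
  \<open>k\<close> chosen only after the word is known; every estimate is kept relative to
  \<open>k\<close> and uniform in it. The partial products of a tight word need not form a local
  quasigeodesic, since their distances to the horoballs between them are unbounded and vary from
  letter to letter. Instead of a local-to-global principle, an induction over subintervals controls
  the highest horoballs first; between them all heights are smaller by \<open>8 * \<delta>\<close>.
  A second obstacle is that quasiconvexity and hyperbolicity may be witnessed by different
  generating sets. Geodesics of one cusped space are merely quasigeodesics in the other, which calls
  for a Morse lemma and for a comparison of horizontal edges at every depth. Finally, the induction
  on word length closes because the condition on each \<open>t i\<close> is stated modulo the
  intersection of the kernel with \<open>Q i\<close>: it survives left multiplication by the
  elements used for shortening, and it keeps \<open>t i\<close> outside the excluded set because
  that intersection contains \<open>\<one>\<close>.\<close>

lemma walk_iff_fun: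
  "(\<exists>ws. is_walk adj ws \<and> hd ws = u \<and> last ws = v \<and> length ws = Suc n) \<longleftrightarrow>
   (\<exists>f. f 0 = u \<and> f n = v \<and> (\<forall>i<n. adj (f i) (f (Suc i))))" (is "?L \<longleftrightarrow> ?R")
proof
  assume ?L
  then obtain ws where ws: "is_walk adj ws" "hd ws = u" "last ws = v" "length ws = Suc n" by blast
  have "ws \<noteq> []" using ws(4) by auto
  then have "ws ! 0 = u" "ws ! n = v"
    using ws(2,3,4) by (simp_all add: hd_conv_nth last_conv_nth)
  then show ?R using ws by (intro exI[of _ "\<lambda>i. ws ! i"]) (auto simp: is_walk_def)
next
  assume ?R
  then obtain f where f: "f 0 = u" "f n = v" "\<forall>i<n. adj (f i) (f (Suc i))" by blast
  have ne: "map f [0..<Suc n] \<noteq> []" by simp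
  have "is_walk adj (map f [0..<Suc n])"
    unfolding is_walk_def using f(3) by (auto simp del: upt_Suc)
  moreover have "hd (map f [0..<Suc n]) = u" using f(1) ne by (simp add: hd_conv_nth del: upt_Suc)
  moreover have "last (map f [0..<Suc n]) = v" using f(2) by simp
  ultimately show ?L by (intro exI[of _ "map f [0..<Suc n]"]) simp
qed

lemma graph_dist_fun:
  "graph_dist adj u v = (LEAST n. \<exists>f. f 0 = u \<and> f n = v \<and> (\<forall>i<n. adj (f i) (f (Suc i))))"
  unfolding graph_dist_def walk_iff_fun ..

lemma graph_dist_le:
  assumes "f 0 = u" "f n = v" "\<And>i. i < n \<Longrightarrow> adj (f i) (f (Suc i))"
  shows "graph_dist adj u v \<le> n"
  unfolding graph_dist_fun by (rule Least_le) (use assms in blast)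

lemma graph_dist_self [simp]: "graph_dist adj u u = 0"
  using graph_dist_le[of "\<lambda>_. u" u 0 u adj] by simp

locale connected_graph =
  fixes V :: "'v set" and adj :: "'v \<Rightarrow> 'v \<Rightarrow> bool"
  assumes adj_sym: "adj u v \<Longrightarrow> adj v u"
    and adj_V: "adj u v \<Longrightarrow> v \<in> V"
    and connected: "u \<in> V \<Longrightarrow> v \<in> V \<Longrightarrow>
      \<exists>n f. f 0 = u \<and> f n = v \<and> (\<forall>i<n. adj (f i) (f (Suc i)))"
begin

abbreviation dist where "dist \<equiv> graph_dist adj"

lemma dist_walk:
  assumes "u \<in> V" "v \<in> V"
  obtains f where "f 0 = u" "f (dist u v) = v" "\<And>i. i < dist u v \<Longrightarrow> adj (f i) (f (Suc i))"
proof -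
  have "\<exists>n. \<exists>f. f 0 = u \<and> f n = v \<and> (\<forall>i<n. adj (f i) (f (Suc i)))"
    using connected[OF assms] by blast
  from LeastI_ex[OF this, folded graph_dist_fun] show ?thesis using that by blast
qed

lemma dist_triangle:
  assumes "u \<in> V" "v \<in> V" "w \<in> V"
  shows "dist u w \<le> dist u v + dist v w"
proof -
  obtain f where f: "f 0 = u" "f (dist u v) = v" "\<And>i. i < dist u v \<Longrightarrow> adj (f i) (f (Suc i))"
    using dist_walk assms by metis
  obtain g where g: "g 0 = v" "g (dist v w) = w" "\<And>i. i < dist v w \<Longrightarrow> adj (g i) (g (Suc i))"
    using dist_walk assms by metis
  define h where "h = (\<lambda>i. if i \<le> dist u v then f i else g (i - dist u v))"
  have "h (dist u v + dist v w) = w"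
    using f g by (cases "dist v w") (auto simp: h_def)
  moreover have "adj (h i) (h (Suc i))" if "i < dist u v + dist v w" for i
  proof -
    consider "i < dist u v" | "i = dist u v" | "i > dist u v" by linarith
    then show ?thesis
    proof cases
      case 3
      then have "Suc i - dist u v = Suc (i - dist u v)" by simp
      with 3 that show ?thesis using g(3)[of "i - dist u v"] by (simp add: h_def)
    qed (use f g that in \<open>auto simp: h_def\<close>)
  qed
  ultimately show ?thesis
    by (intro graph_dist_le[of h]) (auto simp: h_def f)
qed

lemma dist_sym_le: "u \<in> V \<Longrightarrow> v \<in> V \<Longrightarrow> dist v u \<le> dist u v"
proof -
  assume "u \<in> V" "v \<in> V"
  then obtain f where f: "f 0 = u" "f (dist u v) = v" "\<And>i. i < dist u v \<Longrightarrow> adj (f i) (f (Suc i))"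
    using dist_walk by metis
  show ?thesis
  proof (rule graph_dist_le[of "\<lambda>i. f (dist u v - i)"])
    fix i assume "i < dist u v"
    then have "adj (f (dist u v - Suc i)) (f (Suc (dist u v - Suc i)))" by (intro f(3)) simp
    then show "adj (f (dist u v - i)) (f (dist u v - Suc i))"
      using adj_sym \<open>i < dist u v\<close> by (simp add: Suc_diff_Suc)
  qed (use f in auto)
qed

lemma dist_commute: "u \<in> V \<Longrightarrow> v \<in> V \<Longrightarrow> dist u v = dist v u"
  using dist_sym_le le_antisym by blast

lemma dist_adj: "adj u v \<Longrightarrow> dist u v \<le> 1"
  by (rule graph_dist_le[of "\<lambda>i. if i = 0 then u else v"]) auto

lemma dist_eq_0: "u \<in> V \<Longrightarrow> v \<in> V \<Longrightarrow> dist u v = 0 \<Longrightarrow> u = v"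
  by (metis dist_walk)

lemma dist_chain:
  assumes "\<And>i. i \<le> n \<Longrightarrow> f i \<in> V" "\<And>i. i < n \<Longrightarrow> dist (f i) (f (Suc i)) \<le> C"
  shows "dist (f 0) (f n) \<le> C * n"
  using assms
proof (induction n)
  case (Suc n)
  have "dist (f 0) (f (Suc n)) \<le> dist (f 0) (f n) + dist (f n) (f (Suc n))"
    using Suc.prems by (intro dist_triangle) auto
  also have "\<dots> \<le> C * n + C" using Suc by (intro add_mono) auto
  finally show ?case by simp
qed simp

lemma walk_in_V:
  assumes "f 0 \<in> V" "\<And>i. i < n \<Longrightarrow> adj (f i) (f (Suc i))" "i \<le> n"
  shows "f i \<in> V"
  using assms by (cases i) (auto intro: adj_V simp: Suc_le_eq)

lemma geodesic_exists:
  assumes "u \<in> V" "v \<in> V"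
  obtains f where "f 0 = u" "f (dist u v) = v" "\<And>i. i < dist u v \<Longrightarrow> adj (f i) (f (Suc i))"
    "\<And>i. i \<le> dist u v \<Longrightarrow> f i \<in> V"
    "\<And>i j. i \<le> j \<Longrightarrow> j \<le> dist u v \<Longrightarrow> dist (f i) (f j) = j - i"
proof -
  obtain f where f: "f 0 = u" "f (dist u v) = v" "\<And>i. i < dist u v \<Longrightarrow> adj (f i) (f (Suc i))"
    using dist_walk assms by metis
  have fV: "f i \<in> V" if "i \<le> dist u v" for i
    by (rule walk_in_V[of f "dist u v"]) (use f assms that in auto)
  have le: "dist (f i) (f j) \<le> j - i" if "i \<le> j" "j \<le> dist u v" for i j
    by (rule graph_dist_le[of "\<lambda>l. f (i + l)"]) (use that f in auto)
  have "dist (f i) (f j) = j - i" if "i \<le> j" "j \<le> dist u v" for i j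
  proof -
    have "dist u v \<le> dist u (f i) + (dist (f i) (f j) + dist (f j) v)"
      using dist_triangle[of u "f i" v] dist_triangle[of "f i" "f j" v] fV assms that by fastforce
    moreover have "dist u (f i) \<le> i" using le[of 0 i] f(1) that by simp
    moreover have "dist (f j) v \<le> dist u v - j" using le[of j "dist u v"] f(2) that by simp
    ultimately show ?thesis using le[OF that] that by linarith
  qed
  then show ?thesis using that f fV by blast
qed

text \<open>It suffices to bound the image of one edge. This is applied to translations and to the
  identity map between the cusped spaces of two generating sets.\<close>

lemma lipschitz_map:
  assumes "connected_graph V' adj'" "\<And>u. u \<in> V \<Longrightarrow> \<phi> u \<in> V'"
    and "\<And>u v. adj u v \<Longrightarrow> graph_dist adj' (\<phi> u) (\<phi> v) \<le> C" and "u \<in> V" "v \<in> V"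
  shows "graph_dist adj' (\<phi> u) (\<phi> v) \<le> C * dist u v"
proof -
  interpret g: connected_graph V' adj' by fact
  obtain f where f: "f 0 = u" "f (dist u v) = v" "\<And>i. i < dist u v \<Longrightarrow> adj (f i) (f (Suc i))"
    using dist_walk assms by metis
  have "f i \<in> V" if "i \<le> dist u v" for i
    by (rule walk_in_V[of f "dist u v"]) (use f assms that in auto)
  then show ?thesis
    using g.dist_chain[of "dist u v" "\<lambda>i. \<phi> (f i)" C] f assms by auto
qed

lemma lipschitz_fun:
  fixes \<phi> :: "'v \<Rightarrow> int"
  assumes "\<And>u v. adj u v \<Longrightarrow> \<phi> v \<le> \<phi> u + 1" and "u \<in> V" "v \<in> V"
  shows "\<phi> v \<le> \<phi> u + int (dist u v)"
proof -
  obtain f where f: "f 0 = u" "f (dist u v) = v" "\<And>i. i < dist u v \<Longrightarrow> adj (f i) (f (Suc i))"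
    using dist_walk assms by metis
  have "\<phi> (f i) \<le> \<phi> u + int i" if "i \<le> dist u v" for i
    using that
  proof (induction i)
    case (Suc i)
    then show ?case using assms(1)[OF f(3)[of i]] by simp
  qed (use f in simp)
  from this[of "dist u v"] show ?thesis using f by simp
qed

end

section \<open>Tight chains of points in hyperbolic spaces\<close>

text \<open>The bound \<open>\<delta> \<ge> 1\<close> is harmless, because a larger constant only
  weakens the four-point inequality; it lets the unit errors of integer distances be absorbed into
  multiples of \<open>\<delta>\<close>.\<close>

locale four_point =
  fixes V :: "'v set" and d :: "'v \<Rightarrow> 'v \<Rightarrow> real" and \<delta> :: real
  assumes d_self: "x \<in> V \<Longrightarrow> d x x = 0"
    and d_commute: "x \<in> V \<Longrightarrow> y \<in> V \<Longrightarrow> d x y = d y x"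
    and d_triangle: "x \<in> V \<Longrightarrow> y \<in> V \<Longrightarrow> z \<in> V \<Longrightarrow> d x z \<le> d x y + d y z"
    and four_point: "w \<in> V \<Longrightarrow> x \<in> V \<Longrightarrow> y \<in> V \<Longrightarrow> z \<in> V \<Longrightarrow>
      (d w x + d w z - d x z) / 2 \<ge>
        min ((d w x + d w y - d x y) / 2) ((d w y + d w z - d y z) / 2) - \<delta>"
    and delta_ge_1: "\<delta> \<ge> 1"
begin

definition gp :: "'v \<Rightarrow> 'v \<Rightarrow> 'v \<Rightarrow> real" where
  "gp w x y = (d w x + d w y - d x y) / 2"

lemma gp_commute: "x \<in> V \<Longrightarrow> y \<in> V \<Longrightarrow> gp w x y = gp w y x"
  by (simp add: gp_def d_commute)

lemma gp_hyp: "w \<in> V \<Longrightarrow> x \<in> V \<Longrightarrow> y \<in> V \<Longrightarrow> z \<in> V \<Longrightarrow>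
    gp w x z \<ge> min (gp w x y) (gp w y z) - \<delta>"
  unfolding gp_def by (rule four_point)

lemma gp_hyp3: 
  assumes "w \<in> V" "x \<in> V" "y \<in> V" "y' \<in> V" "z \<in> V"
  shows "gp w x z \<ge> min (gp w x y) (min (gp w y y') (gp w y' z)) - 2 * \<delta>"
  using gp_hyp[of w x y z] gp_hyp[of w y y' z] assms delta_ge_1 by (simp add: min_def split: if_splits)

lemma gp_self: "x \<in> V \<Longrightarrow> gp w x x = d w x"
  by (simp add: gp_def d_self)

lemma gp_exchange: "a \<in> V \<Longrightarrow> z \<in> V \<Longrightarrow> x \<in> V \<Longrightarrow> gp a x z = d a z - gp z x a"
  by (simp add: gp_def d_commute field_simps)

end

text \<open>The points \<open>z i\<close> stand for far-out points of horoballs; \<open>K\<close> is the level at which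
  these horoballs are cut off, so that Gromov products based at \<open>z i\<close> are to be compared with \<open>K\<close>.\<close>

locale tight_chain = four_point +
  fixes x z :: "nat \<Rightarrow> 'a" and m :: nat and K R \<rho> :: real and L :: "nat \<Rightarrow> real"
  assumes x_V: "i \<le> m \<Longrightarrow> x i \<in> V" and z_V: "i < m \<Longrightarrow> z i \<in> V"
    and near: "i < m \<Longrightarrow> d (z i) (x i) \<le> K + L i + 1"
    and near_Suc: "i < m \<Longrightarrow> d (z i) (x (Suc i)) \<le> K + L i + 1"
    and far: "i < m \<Longrightarrow> j \<le> m \<Longrightarrow> K + L i \<le> d (z i) (x j)"
    and sep: "i < m \<Longrightarrow> j < m \<Longrightarrow> i \<noteq> j \<Longrightarrow> 2 * K + \<rho> \<le> d (z i) (z j)"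
    and turn: "i < m \<Longrightarrow> gp (z i) (x i) (x (Suc i)) \<le> K - R"
    and L_ge: "i < m \<Longrightarrow> 12 * \<delta> \<le> L i"
    and rho_ge: "1 + 8 * \<delta> \<le> \<rho>" and R_ge: "8 * \<delta> \<le> R"
begin

text \<open>Seen from \<open>z i\<close>, the point \<open>p\<close> lies in the direction of
  \<open>x i\<close> and \<open>q\<close> in that of \<open>x (Suc i)\<close>, so the pair inherits
  the turn at \<open>z i\<close>: in the three-step inequality the two outer products are too large
  to be the minimum, because \<open>R \<ge> 8 * \<delta>\<close>.\<close>

lemma pass_through:
  assumes "i < m" "p \<in> V" "q \<in> V" "gp (z i) p (x i) \<ge> K - 4 * \<delta>" "gp (z i) (x (Suc i)) q \<ge> K - 4 * \<delta>"
  shows "gp (z i) p q \<le> K - R + 2 * \<delta>"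
proof -
  have V: "z i \<in> V" "x i \<in> V" "x (Suc i) \<in> V" using assms x_V z_V by auto
  have "gp (z i) (x i) (x (Suc i)) \<ge>
      min (gp (z i) (x i) p) (min (gp (z i) p q) (gp (z i) q (x (Suc i)))) - 2 * \<delta>"
    using V assms by (intro gp_hyp3) auto
  moreover have "gp (z i) (x i) p = gp (z i) p (x i)" "gp (z i) q (x (Suc i)) = gp (z i) (x (Suc i)) q"
    using V assms by (auto intro: gp_commute)
  ultimately show ?thesis
    using turn[OF assms(1)] assms R_ge delta_ge_1 by (simp add: min_def split: if_splits)
qed

text \<open>Each point \<open>z i\<close> of maximal height up to \<open>8 * \<delta>\<close> lies near a geodesic from
  \<open>x l\<close> to \<open>x r\<close>, so a point \<open>a\<close> near this geodesic is near a segment between two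
  consecutive such points. The loss of \<open>4 * \<delta>\<close> in passing to that segment is made up for by
  the drop of \<open>8 * \<delta>\<close> in the height of the remaining points.\<close>

lemma gp_lower_bound:
  assumes "l \<le> r" "r \<le> m" "a \<in> V"
    and "\<And>i. l \<le> i \<Longrightarrow> i < r \<Longrightarrow> 2 * K + \<rho> \<le> d a (z i)"
    and "\<And>j. l \<le> j \<Longrightarrow> j \<le> r \<Longrightarrow> K + \<mu> \<le> d a (x j)"
    and "\<And>i. l \<le> i \<Longrightarrow> i < r \<Longrightarrow> L i \<le> \<nu>"
    and "\<nu> - 8 * \<delta> \<le> \<mu>" "4 * \<delta> \<le> \<nu>"
  shows "K + (\<mu> - \<nu>) / 2 \<le> gp a (x l) (x r)"
  using assms
proof (induction "r - l" arbitrary: l r a \<mu> \<nu> rule: less_induct)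
  case less
  note IH = less.hyps and pr = less.prems
  show ?case
  proof (cases "l = r")
    case True
    then have "gp a (x l) (x r) = d a (x l)" using pr x_V by (simp add: gp_self)
    moreover have "K + \<mu> \<le> d a (x l)" using pr by simp
    \<comment> \<open>The two side conditions give
      \<open>\<mu> \<ge> \<nu> - 8 * \<delta> \<ge> - \<nu>\<close>; this is the role of
      \<open>4 * \<delta> \<le> \<nu>\<close>.\<close>
    moreover have "(\<mu> - \<nu>) / 2 \<le> \<mu>" using pr delta_ge_1 by (simp add: field_simps)
    ultimately show ?thesis by linarith
  next
    case False
    define M where "M = Max (L ` {l..<r})"
    have ne: "L ` {l..<r} \<noteq> {}" using False pr(1) by simp
    have "M \<in> L ` {l..<r}" unfolding M_def using ne by (intro Max_in) auto
    then obtain i0 where i0: "l \<le> i0" "i0 < r" "L i0 = M" by auto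
    have L_M: "L i \<le> M" if "l \<le> i" "i < r" for i
      unfolding M_def using that by (intro Max_ge) auto
    have M_nu: "M \<le> \<nu>" using pr(6)[OF i0(1,2)] i0(3) by simp
    have M_ge: "12 * \<delta> \<le> M" using L_ge[of i0] i0 pr by simp
    \<comment> \<open>The bound is proved with \<open>\<nu>\<close> replaced by the true maximum
      \<open>M \<le> \<nu>\<close>, which makes it stronger.\<close>
    define \<Gamma> where "\<Gamma> = (\<mu> - M) / 2"
    define top where "top = (\<lambda>i. l \<le> i \<and> i < r \<and> M - 8 * \<delta> < L i)"
    have top_i0: "top i0" using i0 delta_ge_1 by (simp add: top_def)
    let ?o = "x l" and ?y = "x r"
    have oyV: "?o \<in> V" "?y \<in> V" "a \<in> V" using pr x_V by auto
    \<comment> \<open>The induction hypothesis is applied with \<open>z i\<close> itself as base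
      point, hence with \<open>L i\<close> and \<open>M\<close> for \<open>\<mu>\<close> and
      \<open>\<nu>\<close>; its condition on their difference is what \<open>top\<close>
      provides.\<close>
    have left: "gp (z i) ?o (x i) \<ge> K - 4 * \<delta>" if "top i" for i
    proof -
      have "K + (L i - M) / 2 \<le> gp (z i) (x l) (x i)"
      proof (rule IH)
        show "2 * K + \<rho> \<le> d (z i) (z j)" if "l \<le> j" "j < i" for j
          using sep[of i j] that \<open>top i\<close> pr by (simp add: top_def)
        show "K + L i \<le> d (z i) (x j)" if "j \<le> i" for j
          using far[of i j] that \<open>top i\<close> pr by (simp add: top_def)
      qed (use that pr z_V L_M M_ge delta_ge_1 in \<open>auto simp: top_def\<close>)
      then show ?thesis using that by (simp add: top_def field_simps)
    qed
    have right: "gp (z i) (x (Suc i)) ?y \<ge> K - 4 * \<delta>" if "top i" for i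
    proof -
      have "K + (L i - M) / 2 \<le> gp (z i) (x (Suc i)) (x r)"
      proof (rule IH)
        show "2 * K + \<rho> \<le> d (z i) (z j)" if "Suc i \<le> j" "j < r" for j
          using sep[of i j] that \<open>top i\<close> pr by (simp add: top_def)
        show "K + L i \<le> d (z i) (x j)" if "j \<le> r" for j
          using far[of i j] that \<open>top i\<close> pr by (simp add: top_def)
      qed (use that pr z_V L_M M_ge delta_ge_1 in \<open>auto simp: top_def\<close>)
      then show ?thesis using that by (simp add: top_def field_simps)
    qed
    \<comment> \<open>The surplus of \<open>4 * \<delta>\<close> is half of
      \<open>\<rho> - 1\<close>.\<close>
    have near_a: "K + \<Gamma> + 4 * \<delta> \<le> gp a (x j) (z i)"
      if "top i" "j = i \<or> j = Suc i" for i j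
    proof -
      have "d (z i) (x j) \<le> K + L i + 1" using near[of i] near_Suc[of i] that pr by (auto simp: top_def)
      moreover have "d (x j) (z i) = d (z i) (x j)"
        using x_V[of j] z_V[of i] that pr by (auto simp: top_def intro: d_commute)
      moreover have "2 * K + \<rho> \<le> d a (z i)" "K + \<mu> \<le> d a (x j)" "L i \<le> M"
        using pr that L_M by (auto simp: top_def)
      ultimately show ?thesis unfolding gp_def \<Gamma>_def using rho_ge by (simp add: field_simps)
    qed
    have "K + \<Gamma> \<le> gp a ?o ?y"
    proof (rule ccontr)
      assume neg: "\<not> K + \<Gamma> \<le> gp a ?o ?y"
      \<comment> \<open>A top point lies near every geodesic from \<open>?o\<close> to
        \<open>?y\<close>. Seen from \<open>a\<close>, it is therefore either on the side of
        \<open>?o\<close> (first alternative) or on the side of \<open>?y\<close> (second), and the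
        assumption \<open>neg\<close> leaves a gap of \<open>\<delta>\<close> between the
        two.\<close>
      have dich: "gp a (z i) ?y < K + \<Gamma> + \<delta> \<or> K + \<Gamma> + 2 * \<delta> \<le> gp a (z i) ?y" if top: "top i" for i
      proof -
        have im: "i < m" "Suc i \<le> m" "i \<le> m" using top pr by (auto simp: top_def)
        have V: "z i \<in> V" "x i \<in> V" "x (Suc i) \<in> V" using im x_V z_V by auto
        have "gp (z i) ?o ?y \<le> K - R + 2 * \<delta>"
          using left[OF top] right[OF top] im oyV by (intro pass_through) auto
        moreover have "gp (z i) ?o ?y \<ge> min (gp (z i) ?o a) (gp (z i) a ?y) - \<delta>"
          using V oyV by (intro gp_hyp) auto
        ultimately consider "gp (z i) ?o a \<le> K - R + 3 * \<delta>" | "gp (z i) a ?y \<le> K - R + 3 * \<delta>"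
          by linarith
        then show ?thesis
        proof cases
          \<comment> \<open>Here \<open>z i\<close> lies between \<open>?o\<close> and
            \<open>a\<close>. Replacing \<open>x i\<close> by \<open>?o\<close> then lowers the
            product with \<open>z i\<close> at \<open>a\<close> by at most \<open>\<delta>\<close>,
            so \<open>?o\<close> and \<open>z i\<close> are close as seen from
            \<open>a\<close>.\<close>
          case 1
          have "gp (z i) (x i) a \<ge> min (gp (z i) (x i) ?o) (gp (z i) ?o a) - \<delta>"
            using V oyV by (intro gp_hyp) auto
          moreover have "gp (z i) (x i) ?o \<ge> K - 4 * \<delta>"
            using left[OF top] V oyV by (simp add: gp_commute)
          moreover have "gp a (x i) (z i) = d a (z i) - gp (z i) (x i) a" "gp a ?o (z i) = d a (z i) - gp (z i) ?o a"
            using V oyV by (auto intro: gp_exchange)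
          moreover note near_a[OF top, of i] 1 R_ge delta_ge_1
          ultimately have "K + \<Gamma> + 2 * \<delta> \<le> gp a ?o (z i)" by linarith
          moreover have "gp a ?o ?y \<ge> min (gp a ?o (z i)) (gp a (z i) ?y) - \<delta>"
            using V oyV by (intro gp_hyp) auto
          ultimately show ?thesis using neg delta_ge_1 by linarith
        next
          case 2
          have "gp (z i) a (x (Suc i)) \<ge> min (gp (z i) a ?y) (gp (z i) ?y (x (Suc i))) - \<delta>"
            using V oyV by (intro gp_hyp) auto
          moreover have "gp (z i) ?y (x (Suc i)) \<ge> K - 4 * \<delta>"
            using right[OF top] V oyV by (simp add: gp_commute)
          moreover have "gp a (x (Suc i)) (z i) = d a (z i) - gp (z i) a (x (Suc i))"
            "gp a (z i) ?y = d a (z i) - gp (z i) a ?y"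
            using V oyV by (auto simp: gp_def d_commute field_simps)
          moreover note near_a[OF top, of "Suc i"] 2 R_ge delta_ge_1
          ultimately have "K + \<Gamma> + 2 * \<delta> \<le> gp a (z i) ?y" by linarith
          then show ?thesis by simp
        qed
      qed
      define T where "T = {i. top i \<and> gp a (z i) ?y < K + \<Gamma> + \<delta>}"
      have finT: "finite T" by (rule finite_subset[of _ "{..<r}"]) (auto simp: T_def top_def)
      \<comment> \<open>\<open>p\<close> is the last top point on the side of \<open>?o\<close>, or
        \<open>?o\<close> itself if there is none; every top point from index \<open>s\<close> on is
        on the side of \<open>?y\<close>.\<close>
      obtain p s where ps: "p \<in> V" "l \<le> s" "s \<le> r" "gp a p ?y < K + \<Gamma> + \<delta>"
        "K + \<Gamma> + 4 * \<delta> \<le> gp a p (x s)" "\<And>i. top i \<Longrightarrow> s \<le> i \<Longrightarrow> K + \<Gamma> + 2 * \<delta> \<le> gp a (z i) ?y"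
      proof (cases "T = {}")
        case True
        have "K + \<mu> \<le> gp a ?o ?o" using pr oyV by (simp add: gp_self)
        moreover have "\<Gamma> + 4 * \<delta> \<le> \<mu>" unfolding \<Gamma>_def using M_ge M_nu pr by (simp add: field_simps)
        ultimately show ?thesis
          using that[of ?o l] True neg pr oyV delta_ge_1 dich unfolding T_def by fastforce
      next
        case False
        let ?i = "Max T"
        have iT: "?i \<in> T" using finT False by simp
        then have ti: "top ?i" by (simp add: T_def)
        have V: "z ?i \<in> V" "x (Suc ?i) \<in> V" using ti pr x_V z_V by (auto simp: top_def)
        show ?thesis
        proof (rule that[of "z ?i" "Suc ?i"])
          show "K + \<Gamma> + 4 * \<delta> \<le> gp a (z ?i) (x (Suc ?i))"
            using near_a[OF ti, of "Suc ?i"] V by (simp add: gp_commute)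
          show "K + \<Gamma> + 2 * \<delta> \<le> gp a (z i) ?y" if "top i" "Suc ?i \<le> i" for i
            using dich[OF that(1)] Max_ge[OF finT, of i] that by (auto simp: T_def)
        qed (use iT ti V in \<open>auto simp: T_def top_def\<close>)
      qed
      \<comment> \<open>\<open>q\<close> is the first top point from index \<open>s\<close> on, or
        \<open>?y\<close> if there is none. So \<open>a\<close> separates \<open>p\<close> from
        \<open>q\<close>, while no index between \<open>s\<close> and \<open>t\<close> is
        top.\<close>
      obtain q t where qt: "q \<in> V" "s \<le> t" "t \<le> r" "gp a p q < K + \<Gamma> + 2 * \<delta>"
        "K + \<Gamma> + 4 * \<delta> \<le> gp a (x t) q" "\<And>i. s \<le> i \<Longrightarrow> i < t \<Longrightarrow> \<not> top i"
      proof (cases "\<exists>i. top i \<and> s \<le> i")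
        case True
        define i where "i = (LEAST i. top i \<and> s \<le> i)"
        have i: "top i" "s \<le> i" using LeastI_ex[OF True] by (auto simp: i_def)
        have V: "z i \<in> V" using i pr z_V by (auto simp: top_def)
        have "gp a p ?y \<ge> min (gp a p (z i)) (gp a (z i) ?y) - \<delta>"
          using V oyV ps by (intro gp_hyp) auto
        with ps(4) ps(6)[OF i] have "gp a p (z i) < K + \<Gamma> + 2 * \<delta>" by linarith
        then show ?thesis
          using i V near_a[OF i(1), of i] not_less_Least[of _ "\<lambda>i. top i \<and> s \<le> i"]
          by (intro that[of "z i" i]) (auto simp: top_def i_def)
      next
        case False
        have "K + \<mu> \<le> gp a ?y ?y" using pr oyV by (simp add: gp_self)
        moreover have "\<Gamma> + 4 * \<delta> \<le> \<mu>" unfolding \<Gamma>_def using M_ge M_nu pr by (simp add: field_simps)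
        ultimately show ?thesis
          using that[of ?y r] False ps oyV delta_ge_1 by fastforce
      qed
      have V: "x s \<in> V" "x t \<in> V" using ps qt pr x_V by auto
      have "gp a p q \<ge> min (gp a p (x s)) (min (gp a (x s) (x t)) (gp a (x t) q)) - 2 * \<delta>"
        using V oyV ps qt by (intro gp_hyp3) auto
      then have "gp a (x s) (x t) < K + \<Gamma> + 4 * \<delta>" using ps qt delta_ge_1 by linarith
      \<comment> \<open>Now \<open>M - 8 * \<delta>\<close> takes the place of \<open>\<nu>\<close>,
        which raises the bound by exactly the \<open>4 * \<delta>\<close> lost so far. Heights are
        required to be at least \<open>12 * \<delta>\<close> so that this value is still at least
        \<open>4 * \<delta>\<close>.\<close>
      moreover have "K + (\<mu> - (M - 8 * \<delta>)) / 2 \<le> gp a (x s) (x t)"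
      proof (rule IH)
        show "t - s < r - l"
        proof (rule ccontr)
          assume "\<not> t - s < r - l"
          then have "s = l" "t = r" using ps(2,3) qt(2,3) False pr(1) by linarith+
          then show False using qt(6)[of i0] top_i0 i0 by simp
        qed
        show "L i \<le> M - 8 * \<delta>" if "s \<le> i" "i < t" for i
          using qt(6)[OF that] that ps qt by (force simp: top_def)
      qed (use ps qt pr M_ge M_nu delta_ge_1 in auto)
      ultimately show False by (simp add: \<Gamma>_def field_simps)
    qed
    then show ?thesis using M_nu by (simp add: \<Gamma>_def field_simps)
  qed
qed

text \<open>At the highest point the previous lemma applies to both halves of the chain with
  \<open>\<mu>\<close> and \<open>\<nu>\<close> equal to \<open>L i\<close>, so no error remains and
  the turn at \<open>z i\<close> is seen from the two ends.\<close>

lemma highest_point_near_geodesic: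
  assumes "i < m" "\<And>j. j < m \<Longrightarrow> L j \<le> L i"
  shows "gp (z i) (x 0) (x m) \<le> K - R + 2 * \<delta>"
proof -
  have *: "K + (L i - L i) / 2 \<le> gp (z i) (x 0) (x i)"
    by (rule gp_lower_bound) (use assms z_V sep far L_ge[of i] delta_ge_1 in auto)
  have "K + (L i - L i) / 2 \<le> gp (z i) (x (Suc i)) (x m)"
    by (rule gp_lower_bound) (use assms z_V sep far L_ge[of i] delta_ge_1 in auto)
  with * show ?thesis
    using assms x_V delta_ge_1 by (intro pass_through) auto
qed

end

section \<open>Geodesics and quasigeodesics in hyperbolic graphs\<close>

lemma linear_le_power2: "\<exists>k0. \<forall>k\<ge>k0. A + B * k \<le> (2::nat) ^ k"
proof -
  have sq: "k * k \<le> 2 ^ k" if "k \<ge> 4" for k :: nat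
    using that
  proof (induction k rule: dec_induct)
    case (step k)
    have "2 * k + 1 \<le> k * k"
      using step.hyps mult_le_mono1[of 4 k k] by linarith
    then show ?case using step by simp
  qed simp
  have "A + B * k \<le> 2 ^ k" if "k \<ge> max 4 (A + B)" for k
  proof -
    have "A \<le> A * k" using that by (cases k) auto
    then have "A + B * k \<le> (A + B) * k" by (simp add: algebra_simps)
    also have "\<dots> \<le> k * k" using that by (intro mult_le_mono1) simp
    finally show ?thesis using sq[of k] that by simp
  qed
  then show ?thesis by blast
qed

section \<open>One half of the Morse lemma\<close>

locale hyperbolic = connected_graph + four_point V "\<lambda>u v. real (graph_dist adj u v)" \<delta> for \<delta>
begin

lemma gp_ge_diff:
  assumes "p \<in> V" "x \<in> V" "y \<in> V"
  shows "gp p x y \<ge> real (dist p x) - real (dist x y)"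
  using dist_triangle[of p y x] dist_commute[of x y] assms unfolding gp_def by simp

text \<open>Bisection of the chain loses one \<open>\<delta>\<close> per halving, so the total loss
  is only logarithmic in the number of steps.\<close>

lemma gp_chain:
  assumes "p \<in> V" "1 \<le> n" "n \<le> 2 ^ k" "\<And>i. i \<le> n \<Longrightarrow> q i \<in> V"
    and "\<And>i. i < n \<Longrightarrow> c \<le> gp p (q i) (q (Suc i))"
  shows "c - k * \<delta> \<le> gp p (q 0) (q n)"
  using assms(2-)
proof (induction k arbitrary: n q)
  case 0
  then have "n = 1" by simp
  then show ?case using 0(4)[of 0] by simp
next
  case (Suc k)
  show ?case
  proof (cases "n \<le> 2 ^ k")
    case True
    then have "c - k * \<delta> \<le> gp p (q 0) (q n)" using Suc by simp
    then show ?thesis using delta_ge_1 by (simp add: algebra_simps)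
  next
    case False
    let ?h = "2 ^ k :: nat"
    have "c - k * \<delta> \<le> gp p (q 0) (q ?h)"
      using False by (intro Suc.IH Suc.prems) auto
    moreover have "c - k * \<delta> \<le> gp p (q (?h + 0)) (q (?h + (n - ?h)))"
      by (rule Suc.IH[of "n - ?h" "\<lambda>i. q (?h + i)"]) (use False Suc.prems in auto)
    moreover have "gp p (q 0) (q n) \<ge> min (gp p (q 0) (q ?h)) (gp p (q ?h) (q n)) - \<delta>"
      using False Suc.prems(3) assms(1) by (intro gp_hyp) auto
    ultimately show ?thesis using False by (simp add: algebra_simps)
  qed
qed

text \<open>The detour in the next proof around a ball of radius \<open>D\<close> has at most
  \<open>C * (6 * D) + 2\<close> steps, but \<open>k\<close> halvings already cover
  \<open>2 ^ k\<close> of them at a loss of \<open>k * \<delta>\<close>. For large \<open>D\<close>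
  the loss is less than the radius.\<close>

lemma quasigeodesic_scale:
  "\<exists>D0::nat. \<forall>D>D0. \<exists>k. C * (6 * D) + 2 \<le> 2 ^ k \<and> real C + real k * \<delta> < real D"
proof -
  define \<Delta> where "\<Delta> = nat \<lceil>\<delta>\<rceil>"
  have \<Delta>: "\<delta> \<le> real \<Delta>" "1 \<le> \<Delta>" unfolding \<Delta>_def using delta_ge_1 by linarith+
  obtain k0 where k0: "\<And>k. k \<ge> k0 \<Longrightarrow> (6 * C * (C + 1 + \<Delta>) + 2) + (6 * C * \<Delta>) * k \<le> 2 ^ k"
    using linear_le_power2 by blast
  have "\<exists>k. C * (6 * D) + 2 \<le> 2 ^ k \<and> real C + real k * \<delta> < real D" if D: "D > C + 1 + \<Delta> * k0" for D
  proof -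
    \<comment> \<open>This is the largest \<open>k\<close> that keeps
      \<open>C + \<Delta> * k\<close> below \<open>D\<close>; it grows linearly in \<open>D\<close>,
      so \<open>2 ^ k\<close> overtakes the linear bound.\<close>
    define k where "k = (D - C - 1) div \<Delta>"
    have "k \<ge> k0" unfolding k_def using D \<Delta> by (simp add: less_eq_div_iff_mult_less_eq mult.commute)
    have "\<Delta> * k \<le> D - C - 1" unfolding k_def by simp
    then have "C + \<Delta> * k < D" using D by linarith
    then have "real C + real \<Delta> * real k < real D" by (metis of_nat_add of_nat_less_iff of_nat_mult)
    moreover have "\<delta> * real k \<le> real \<Delta> * real k" using \<Delta> by (intro mult_right_mono) auto
    moreover have "D - C - 1 < \<Delta> * k + \<Delta>"
      unfolding k_def using \<Delta> by (metis dividend_less_div_times add.commute mult.commute not_less_eq_eq One_nat_def zero_less_iff_neq_zero not_one_le_zero)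
    then have "C * (6 * D) \<le> C * (6 * (C + 1 + \<Delta> + \<Delta> * k))"
      by (intro mult_le_mono2) linarith
    then have "C * (6 * D) + 2 \<le> 2 ^ k" using k0[OF \<open>k \<ge> k0\<close>] by (simp add: algebra_simps)
    ultimately show ?thesis by (intro exI[of _ k]) (auto simp: mult.commute)
  qed
  then show ?thesis by blast
qed

definition geodesic :: "nat \<Rightarrow> (nat \<Rightarrow> 'a) \<Rightarrow> bool" where
  "geodesic n f \<longleftrightarrow> (\<forall>i\<le>n. f i \<in> V) \<and> (\<forall>i j. i \<le> j \<and> j \<le> n \<longrightarrow> dist (f i) (f j) = j - i)"

text \<open>This is the form in which a geodesic of one cusped space appears in another one with the
  same vertices and a bi-Lipschitz equivalent metric.\<close>

definition quasigeodesic :: "nat \<Rightarrow> nat \<Rightarrow> (nat \<Rightarrow> 'a) \<Rightarrow> bool" where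
  "quasigeodesic C n c \<longleftrightarrow> (\<forall>i\<le>n. c i \<in> V) \<and> (\<forall>i<n. dist (c i) (c (Suc i)) \<le> C) \<and>
     (\<forall>i j. i \<le> j \<and> j \<le> n \<longrightarrow> j - i \<le> C * dist (c i) (c j))"

text \<open>At the point of the geodesic farthest from \<open>c\<close>, a detour along
  \<open>c\<close> avoids a ball whose radius is that distance \<open>D\<close>. Its length is
  linear in \<open>D\<close>, so for large \<open>D\<close> bisection makes the Gromov product of
  its ends positive, although the point lies between these ends on a geodesic.\<close>

lemma geodesic_near_quasigeodesic:
  "\<exists>D0. \<forall>N c f l. quasigeodesic C N c \<and> geodesic (dist (c 0) (c N)) f \<and>
     f 0 = c 0 \<and> f (dist (c 0) (c N)) = c N \<and> l \<le> dist (c 0) (c N) \<longrightarrow>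
     (\<exists>i\<le>N. dist (f l) (c i) \<le> D0)"
proof -
  obtain D0 where D0: "\<And>D. D > D0 \<Longrightarrow> \<exists>k. C * (6 * D) + 2 \<le> 2 ^ k \<and> real C + real k * \<delta> < real D"
    using quasigeodesic_scale by blast
  have "\<exists>i\<le>N. dist (f l) (c i) \<le> D0"
    if c: "quasigeodesic C N c" and f: "geodesic (dist (c 0) (c N)) f" and f0: "f 0 = c 0"
      and fE: "f (dist (c 0) (c N)) = c N" and l: "l \<le> dist (c 0) (c N)" for N c f l
  proof -
    have cV: "\<And>i. i \<le> N \<Longrightarrow> c i \<in> V" and step: "\<And>i. i < N \<Longrightarrow> dist (c i) (c (Suc i)) \<le> C"
      and quasi: "\<And>i j. i \<le> j \<Longrightarrow> j \<le> N \<Longrightarrow> j - i \<le> C * dist (c i) (c j)"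
      using c by (auto simp: quasigeodesic_def)
    have fV: "\<And>i. i \<le> dist (c 0) (c N) \<Longrightarrow> f i \<in> V"
      and geo: "\<And>i j. i \<le> j \<Longrightarrow> j \<le> dist (c 0) (c N) \<Longrightarrow> dist (f i) (f j) = j - i"
      using f by (auto simp: geodesic_def)
    define E where "E = dist (c 0) (c N)"
    define g where "g = (\<lambda>l. Min ((\<lambda>i. dist (f l) (c i)) ` {..N}))"
    have g_le: "g l \<le> dist (f l) (c i)" if "i \<le> N" for l i
      unfolding g_def using that by (intro Min_le) auto
    have g_ex: "\<exists>i\<le>N. dist (f l) (c i) = g l" for l
    proof -
      have "g l \<in> (\<lambda>i. dist (f l) (c i)) ` {..N}" unfolding g_def by (intro Min_in) auto
      then show ?thesis by force
    qed
    define D where "D = Max (g ` {..E})"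
    have g_D: "g l \<le> D" if "l \<le> E" for l unfolding D_def using that by (intro Max_ge) auto
    have "D \<in> g ` {..E}" unfolding D_def by (intro Max_in) auto
    then obtain e where e: "e \<le> E" "g e = D" by auto
    let ?p = "f e"
    have pV: "?p \<in> V" using fV e by (simp add: E_def)
    have "D \<le> D0"
    proof (rule ccontr)
      assume "\<not> D \<le> D0"
      then obtain k where k: "C * (6 * D) + 2 \<le> 2 ^ k" "real C + real k * \<delta> < real D"
        using D0[of D] by (auto simp: not_le)
      have p_far: "real D \<le> real (dist ?p (c i))" if "i \<le> N" for i using g_le[OF that, of e] e by simp
      \<comment> \<open>The geodesic is left at distance \<open>2 * D\<close> from
        \<open>?p\<close>, so that a jump of length at most \<open>D\<close> to \<open>c\<close>
        stays outside the ball of radius \<open>D\<close>. If the geodesic ends earlier, its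
        endpoint already lies on \<open>c\<close>.\<close>
      obtain l1 i1 where 1: "l1 \<le> e" "e - l1 \<le> 2 * D" "i1 \<le> N" "dist (f l1) (c i1) \<le> D"
        "real D \<le> gp ?p (f l1) (c i1)"
      proof (cases "2 * D \<le> e")
        case True
        obtain i where i: "i \<le> N" "dist (f (e - 2 * D)) (c i) = g (e - 2 * D)" using g_ex by blast
        have "dist (f (e - 2 * D)) (c i) \<le> D" using g_D[of "e - 2 * D"] i e by simp
        moreover have "dist ?p (f (e - 2 * D)) = 2 * D"
          using geo[of "e - 2 * D" e] True e fV by (simp add: dist_commute E_def)
        moreover have "gp ?p (f (e - 2 * D)) (c i) \<ge> real (dist ?p (f (e - 2 * D))) - real (dist (f (e - 2 * D)) (c i))"
          using pV i cV fV e by (intro gp_ge_diff) (auto simp: E_def)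
        ultimately show ?thesis using that[of "e - 2 * D" i] i True by simp
      next
        case False
        then show ?thesis using that[of 0 0] f0 p_far[of 0] cV by (simp add: gp_self)
      qed
      obtain l2 i2 where 2: "e \<le> l2" "l2 \<le> E" "l2 - e \<le> 2 * D" "i2 \<le> N" "dist (c i2) (f l2) \<le> D"
        "real D \<le> gp ?p (c i2) (f l2)"
      proof (cases "e + 2 * D \<le> E")
        case True
        obtain i where i: "i \<le> N" "dist (f (e + 2 * D)) (c i) = g (e + 2 * D)" using g_ex by blast
        have *: "dist (f (e + 2 * D)) (c i) \<le> D" using g_D[of "e + 2 * D"] i True by simp
        moreover have "dist ?p (f (e + 2 * D)) = 2 * D"
          using geo[of e "e + 2 * D"] True e by (simp add: E_def)
        moreover have "gp ?p (f (e + 2 * D)) (c i) \<ge> real (dist ?p (f (e + 2 * D))) - real (dist (f (e + 2 * D)) (c i))"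
          using pV i cV fV True by (intro gp_ge_diff) (auto simp: E_def)
        moreover have "f (e + 2 * D) \<in> V" "c i \<in> V" using i cV fV True by (auto simp: E_def)
        then have "gp ?p (f (e + 2 * D)) (c i) = gp ?p (c i) (f (e + 2 * D))"
          "dist (f (e + 2 * D)) (c i) = dist (c i) (f (e + 2 * D))"
          by (rule gp_commute dist_commute)+
        ultimately show ?thesis using that[of "e + 2 * D" i] i True by simp
      next
        case False
        then show ?thesis using that[of E N] fE p_far[of N] cV e by (simp add: gp_self E_def)
      qed
      have V: "f l1 \<in> V" "f l2 \<in> V" "c i1 \<in> V" "c i2 \<in> V" using 1 2 e fV cV by (auto simp: E_def)
      have geos: "dist (f l1) (f l2) = l2 - l1" "dist ?p (f l2) = l2 - e" "dist (f l1) ?p = e - l1"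
        using geo 1 2 e by (auto simp: E_def)
      have gp0: "gp ?p (f l1) (f l2) = 0"
        unfolding gp_def using geos 1 2 V pV by (simp add: dist_commute[of ?p "f l1"])
      have "dist (c i1) (c i2) \<le> dist (c i1) (f l1) + dist (f l1) (f l2) + dist (f l2) (c i2)"
        using dist_triangle[of "c i1" "f l1" "c i2"] dist_triangle[of "f l1" "f l2" "c i2"] V by linarith
      then have dc: "dist (c i1) (c i2) \<le> 6 * D"
        using 1 2 geos V by (simp add: dist_commute[of "c i1"] dist_commute[of "f l2"])
      define h where "h = (if i1 \<le> i2 then i2 - i1 else i1 - i2)"
      have "h \<le> C * dist (c i1) (c i2)"
        using quasi[of i1 i2] quasi[of i2 i1] 1 2 V
        by (auto simp: h_def dist_commute[of "c i2"])
      also have "\<dots> \<le> C * (6 * D)" using dc by (rule mult_le_mono2)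
      finally have h: "h \<le> C * (6 * D)" .
      \<comment> \<open>The indices \<open>i1\<close> and \<open>i2\<close> may occur in either
        order along \<open>c\<close>, so \<open>r\<close> counts up or down.\<close>
      define r where "r = (\<lambda>j. if i1 \<le> i2 then i1 + j else i1 - j)"
      have rN: "r j \<le> N" if "j \<le> h" for j using that 1 2 by (auto simp: r_def h_def)
      have rh: "r 0 = i1" "r h = i2" by (auto simp: r_def h_def)
      have rstep: "dist (c (r j)) (c (r (Suc j))) \<le> C" if "j < h" for j
      proof (cases "i1 \<le> i2")
        case True
        then show ?thesis using step that 1 2 by (auto simp: r_def h_def)
      next
        case False
        then have "dist (c (r (Suc j))) (c (Suc (r (Suc j)))) \<le> C"
          using step that 1 2 by (auto simp: r_def h_def)
        moreover have "Suc (r (Suc j)) = r j" using that False by (auto simp: r_def h_def)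
        ultimately show ?thesis using rN[of j] rN[of "Suc j"] that cV by (simp add: dist_commute)
      qed
      \<comment> \<open>The detour consists of a jump to \<open>c\<close>, the stretch of
        \<open>c\<close> from \<open>i1\<close> to \<open>i2\<close>, and a jump back.\<close>
      define q where "q = (\<lambda>j. if j = 0 then f l1 else if j \<le> Suc h then c (r (j - 1)) else f l2)"
      have "real D - real C - k * \<delta> \<le> gp ?p (q 0) (q (Suc (Suc h)))"
      proof (rule gp_chain[OF pV, of "Suc (Suc h)" k q "real D - real C"])
        show "q j \<in> V" for j using V cV rN[of "j - 1"] by (auto simp: q_def)
        show "real D - real C \<le> gp ?p (q j) (q (Suc j))" if "j < Suc (Suc h)" for j
        proof -
          consider "j = 0" | "j = Suc h" | j' where "j = Suc j'" "j' < h"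
            using \<open>j < Suc (Suc h)\<close> by (cases j) (auto simp: less_Suc_eq)
          then show ?thesis
          proof cases
            case 3
            have "gp ?p (c (r j')) (c (r (Suc j'))) \<ge>
                real (dist ?p (c (r j'))) - real (dist (c (r j')) (c (r (Suc j'))))"
              using rN[of j'] rN[of "Suc j'"] 3 cV pV by (intro gp_ge_diff) auto
            then show ?thesis using 3 rstep[of j'] p_far[of "r j'"] rN[of j'] by (simp add: q_def)
          qed (use 1 2 rh in \<open>auto simp: q_def\<close>)
        qed
      qed (use h k in auto)
      then show False using gp0 k by (simp add: q_def)
    qed
    moreover obtain i where "i \<le> N" "dist (f l) (c i) = g l" using g_ex by blast
    ultimately show ?thesis
      using g_D[of l] l by (intro exI[of _ i]) (auto simp: E_def)
  qed
  then show ?thesis by blast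
qed

end

section \<open>The cusped space\<close>

lemma cusp_adj_sym: "cusp_adj G \<P> S u v \<Longrightarrow> cusp_adj G \<P> S v u"
  by (auto simp: cusp_adj_def)

context group
begin

abbreviation lprod :: "'a list \<Rightarrow> 'a" where
  "lprod ws \<equiv> foldr (\<lambda>a b. a \<otimes> b) ws \<one>"

lemma lprod_closed: "set ws \<subseteq> carrier G \<Longrightarrow> lprod ws \<in> carrier G"
  by (induction ws) auto

lemma lprod_append:
  "set ws \<subseteq> carrier G \<Longrightarrow> set vs \<subseteq> carrier G \<Longrightarrow> lprod (ws @ vs) = lprod ws \<otimes> lprod vs"
  by (induction ws) (auto simp: m_assoc lprod_closed)

lemma generate_lprod:
  assumes "A \<subseteq> carrier G" "\<And>a. a \<in> A \<Longrightarrow> inv a \<in> A" "x \<in> generate G A"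
  shows "\<exists>ws. set ws \<subseteq> A \<and> lprod ws = x"
  using assms(3)
proof (induction rule: generate.induct)
  case one
  then show ?case by (intro exI[of _ "[]"]) simp
next
  case (incl h)
  then show ?case using assms(1) by (intro exI[of _ "[h]"]) auto
next
  case (inv h)
  then show ?case using assms(1,2) by (intro exI[of _ "[inv h]"]) auto
next
  case (eng h1 h2)
  then obtain ws vs where "set ws \<subseteq> A" "lprod ws = h1" "set vs \<subseteq> A" "lprod vs = h2" by blast
  then show ?case using assms(1) by (intro exI[of _ "ws @ vs"]) (auto simp: lprod_append simp del: foldr_append)
qed

lemma word_length_le: "set ws \<subseteq> A \<Longrightarrow> word_length G A (lprod ws) \<le> length ws"
  unfolding word_length_def by (rule Least_le) blast

end

locale cusped_space = group G for G (structure) +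
  fixes Ps :: "'a set set" and S :: "'a set"
  assumes finite_Ps: "finite Ps" and subgroup_Ps: "P \<in> Ps \<Longrightarrow> subgroup P G"
    and gen_set: "compatible_gen_set G Ps S"
begin

abbreviation "verts \<equiv> cusp_verts G Ps"
abbreviation "adj \<equiv> cusp_adj G Ps S"
abbreviation "edge0 \<equiv> cusp_edge0 G Ps S"

lemma S_facts: "finite S" "S \<subseteq> carrier G" "s \<in> S \<Longrightarrow> inv s \<in> S"
  "generate G S = carrier G" "P \<in> Ps \<Longrightarrow> generate G (S \<inter> P) = P"
  using gen_set by (auto simp: compatible_gen_set_def)

lemma Ps_carrier: "P \<in> Ps \<Longrightarrow> h \<in> P \<Longrightarrow> h \<in> carrier G"
  using subgroup_Ps subgroup.mem_carrier by metis

lemma Ps_m: "P \<in> Ps \<Longrightarrow> h \<in> P \<Longrightarrow> h' \<in> P \<Longrightarrow> h \<otimes> h' \<in> P"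
  using subgroup_Ps subgroup.m_closed by metis

lemma Ps_inv: "P \<in> Ps \<Longrightarrow> h \<in> P \<Longrightarrow> inv h \<in> P"
  using subgroup_Ps subgroup.m_inv_closed by metis

lemma Ps_one: "P \<in> Ps \<Longrightarrow> \<one> \<in> P"
  using subgroup_Ps subgroup.one_closed by metis

lemma word_exists: "P \<in> Ps \<Longrightarrow> h \<in> P \<Longrightarrow> \<exists>ws. set ws \<subseteq> S \<inter> P \<and> lprod ws = h"
  using generate_lprod[of "S \<inter> P" h] S_facts Ps_inv by blast

lemma word_length_attained:
  assumes "P \<in> Ps" "h \<in> P"
  obtains ws where "set ws \<subseteq> S \<inter> P" "lprod ws = h" "length ws = word_length G (S \<inter> P) h"
proof -
  have "\<exists>n. \<exists>ws. length ws = n \<and> set ws \<subseteq> S \<inter> P \<and> lprod ws = h"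
    using word_exists[OF assms] by blast
  from LeastI_ex[OF this] show ?thesis using that unfolding word_length_def by blast
qed

lemma finite_word_ball: "P \<in> Ps \<Longrightarrow> finite {h \<in> P. word_length G (S \<inter> P) h \<le> n}"
proof -
  assume P: "P \<in> Ps"
  have "{h \<in> P. word_length G (S \<inter> P) h \<le> n} \<subseteq> lprod ` {ws. set ws \<subseteq> S \<inter> P \<and> length ws \<le> n}"
    using word_length_attained[OF P] by (smt (verit) image_eqI mem_Collect_eq subsetI)
  moreover have "finite {ws. set ws \<subseteq> S \<inter> P \<and> length ws \<le> n}"
    using S_facts by (intro finite_lists_length_le) auto
  ultimately show ?thesis using finite_surj by blast
qed

lemma Base_verts [simp]: "Base x \<in> verts \<longleftrightarrow> x \<in> carrier G"
  by (auto simp: cusp_verts_def)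

lemma Horo_verts [simp]: "Horo P x k \<in> verts \<longleftrightarrow> P \<in> Ps \<and> x \<in> carrier G \<and> 1 \<le> k"
  by (auto simp: cusp_verts_def)

lemma edge0_verts: "edge0 u v \<Longrightarrow> u \<in> verts \<and> v \<in> verts"
  using S_facts by (auto simp: cusp_edge0_def)

lemma adj_verts: "adj u v \<Longrightarrow> v \<in> verts"
  using edge0_verts by (auto simp: cusp_adj_def)

lemma adj_Base: "x \<in> carrier G \<Longrightarrow> s \<in> S \<Longrightarrow> adj (Base x) (Base (x \<otimes> s))"
  by (auto simp: cusp_adj_def cusp_edge0_def)

lemma adj_Base_Horo: "x \<in> carrier G \<Longrightarrow> P \<in> Ps \<Longrightarrow> adj (Base x) (Horo P x 1)"
  by (auto simp: cusp_adj_def cusp_edge0_def)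

lemma adj_Horo_Suc: "x \<in> carrier G \<Longrightarrow> P \<in> Ps \<Longrightarrow> 1 \<le> k \<Longrightarrow> adj (Horo P x k) (Horo P x (Suc k))"
  unfolding cusp_adj_def cusp_edge0_def by blast

lemma adj_rtranclp_Base:
  assumes "x \<in> carrier G" "set ws \<subseteq> S"
  shows "adj\<^sup>*\<^sup>* (Base x) (Base (x \<otimes> lprod ws))"
  using assms
proof (induction ws arbitrary: x)
  case (Cons s ws)
  have s: "s \<in> carrier G" "set ws \<subseteq> carrier G" using Cons.prems S_facts by auto
  have "adj (Base x) (Base (x \<otimes> s))" using Cons.prems by (intro adj_Base) auto
  moreover have "adj\<^sup>*\<^sup>* (Base (x \<otimes> s)) (Base (x \<otimes> s \<otimes> lprod ws))"
    using Cons.prems s by (intro Cons.IH) auto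
  ultimately show ?case using s Cons.prems(1)
    by (simp add: m_assoc lprod_closed converse_rtranclp_into_rtranclp)
qed simp

lemma adj_rtranclp_from_one:
  assumes "v \<in> verts" shows "adj\<^sup>*\<^sup>* (Base \<one>) v"
proof -
  have base: "adj\<^sup>*\<^sup>* (Base \<one>) (Base x)" if "x \<in> carrier G" for x
  proof -
    obtain ws where "set ws \<subseteq> S" "lprod ws = x"
      using generate_lprod[of S x] S_facts \<open>x \<in> carrier G\<close> by auto
    then show ?thesis using adj_rtranclp_Base[of \<one> ws] that by simp
  qed
  have horo: "adj\<^sup>*\<^sup>* (Base \<one>) (Horo P x (Suc k))" if "x \<in> carrier G" "P \<in> Ps" for x P k
    using that
  proof (induction k)
    case 0
    then show ?case using base[of x] adj_Base_Horo[of x P] by (simp add: rtranclp.rtrancl_into_rtrancl)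
  next
    case (Suc k)
    then show ?case using adj_Horo_Suc[of x P "Suc k"] by (simp add: rtranclp.rtrancl_into_rtrancl)
  qed
  show ?thesis
    using assms base horo by (auto simp: cusp_verts_def) (metis Suc_le_D One_nat_def)
qed

sublocale connected_graph verts adj
proof
  show "\<exists>n f. f 0 = u \<and> f n = v \<and> (\<forall>i<n. adj (f i) (f (Suc i)))"
    if "u \<in> verts" "v \<in> verts" for u v
  proof -
    have "symp adj" by (simp add: sympI cusp_adj_sym)
    then have "adj\<^sup>*\<^sup>* u (Base \<one>)"
      using adj_rtranclp_from_one[OF that(1)] by (metis symp_rtranclp sympD)
    then have "adj\<^sup>*\<^sup>* u v" using adj_rtranclp_from_one[OF that(2)] by simp
    then show ?thesis by (simp add: rtranclp_power relpowp_fun_conv)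
  qed
qed (auto intro: cusp_adj_sym adj_verts)

section \<open>Left translations as isometries of the cusped space\<close>

primrec translate :: "'a \<Rightarrow> 'a cusp_vertex \<Rightarrow> 'a cusp_vertex" where
  "translate g (Base x) = Base (g \<otimes> x)"
| "translate g (Horo P x k) = Horo P (g \<otimes> x) k"

lemma translate_verts: "g \<in> carrier G \<Longrightarrow> v \<in> verts \<Longrightarrow> translate g v \<in> verts"
  by (cases v) auto

lemma translate_inv: "g \<in> carrier G \<Longrightarrow> v \<in> verts \<Longrightarrow> translate (inv g) (translate g v) = v"
  by (cases v) (auto simp: m_assoc[symmetric])

lemma inv_mult_cancel: "g \<in> carrier G \<Longrightarrow> x \<in> carrier G \<Longrightarrow> y \<in> carrier G \<Longrightarrow>
    inv (g \<otimes> x) \<otimes> (g \<otimes> y) = inv x \<otimes> y"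
  by (metis inv_closed inv_mult_group inv_solve_left m_assoc m_closed)

lemma translate_edge0: "g \<in> carrier G \<Longrightarrow> edge0 u v \<Longrightarrow> edge0 (translate g u) (translate g v)"
proof -
  assume g: "g \<in> carrier G" and e: "edge0 u v"
  show ?thesis
    using e unfolding cusp_edge0_def
  proof (elim disjE exE conjE, goal_cases)
    case (1 x s)
    then have "g \<otimes> (x \<otimes> s) = (g \<otimes> x) \<otimes> s" using g S_facts by (auto simp: m_assoc)
    then have "g \<otimes> x \<in> carrier G \<and> s \<in> S \<and> translate g u = Base (g \<otimes> x) \<and> translate g v = Base ((g \<otimes> x) \<otimes> s)"
      using 1 g by simp
    then show ?case by blast
  next
    case (4 P x y k)
    then have "g \<otimes> x \<in> carrier G" "g \<otimes> y \<in> carrier G" "inv (g \<otimes> x) \<otimes> (g \<otimes> y) = inv x \<otimes> y"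
      using g by (auto intro: inv_mult_cancel)
    then show ?case using 4 by (metis translate.simps(2))
  qed (use g in auto)
qed

lemma translate_adj: "g \<in> carrier G \<Longrightarrow> adj u v \<Longrightarrow> adj (translate g u) (translate g v)"
  using translate_edge0 by (auto simp: cusp_adj_def)

lemma dist_translate:
  assumes "g \<in> carrier G" "u \<in> verts" "v \<in> verts"
  shows "dist (translate g u) (translate g v) = dist u v"
proof -
  have le: "dist (translate h a) (translate h b) \<le> dist a b"
    if "h \<in> carrier G" "a \<in> verts" "b \<in> verts" for h a b
    using lipschitz_map[OF connected_graph_axioms, of "translate h" 1 a b]
      translate_verts translate_adj dist_adj that by auto
  show ?thesis
    using le[of g u v] le[of "inv g" "translate g u" "translate g v"] assms
    by (simp add: translate_inv translate_verts)
qed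

lemma dist_Base_translate:
  assumes "g \<in> carrier G" "x \<in> carrier G" "y \<in> carrier G"
  shows "dist (Base (g \<otimes> x)) (Base (g \<otimes> y)) = dist (Base x) (Base y)"
  using dist_translate[of g "Base x" "Base y"] assms by simp

section \<open>Distances to peripheral cosets\<close>

definition coset_dist :: "'a set \<Rightarrow> 'a \<Rightarrow> 'a cusp_vertex \<Rightarrow> nat" where
  "coset_dist P g v = (LEAST n. \<exists>h\<in>P. n = dist v (Base (g \<otimes> h)))"

lemma coset_dist_le: "h \<in> P \<Longrightarrow> coset_dist P g v \<le> dist v (Base (g \<otimes> h))"
  unfolding coset_dist_def by (rule Least_le) blast

lemma coset_dist_attained:
  assumes "P \<in> Ps"
  obtains h where "h \<in> P" "coset_dist P g v = dist v (Base (g \<otimes> h))"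
proof -
  have "\<exists>n. \<exists>h\<in>P. n = dist v (Base (g \<otimes> h))" using Ps_one[OF assms] by blast
  from LeastI_ex[OF this] show ?thesis using that unfolding coset_dist_def by blast
qed

lemma coset_dist_lipschitz:
  assumes "P \<in> Ps" "g \<in> carrier G" "u \<in> verts" "v \<in> verts"
  shows "coset_dist P g u \<le> dist u v + coset_dist P g v"
proof -
  obtain h where h: "h \<in> P" "coset_dist P g v = dist v (Base (g \<otimes> h))"
    using coset_dist_attained[OF assms(1)] .
  have "coset_dist P g u \<le> dist u (Base (g \<otimes> h))" using h by (intro coset_dist_le)
  also have "\<dots> \<le> dist u v + dist v (Base (g \<otimes> h))"
    using assms h Ps_carrier by (intro dist_triangle) auto
  finally show ?thesis using h by simp
qed

lemma coset_dist_translate: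
  assumes "P \<in> Ps" "g \<in> carrier G" "a \<in> carrier G" "v \<in> verts"
  shows "coset_dist P (a \<otimes> g) (translate a v) = coset_dist P g v"
proof -
  have "dist (translate a v) (Base (a \<otimes> g \<otimes> h)) = dist v (Base (g \<otimes> h))" if "h \<in> P" for h
    using dist_translate[of a v "Base (g \<otimes> h)"] assms that Ps_carrier by (simp add: m_assoc)
  then show ?thesis unfolding coset_dist_def by (intro arg_cong[where f = Least]) auto
qed

lemma coset_dist_same_coset:
  assumes "P \<in> Ps" "g \<in> carrier G" "h \<in> P"
  shows "coset_dist P (g \<otimes> h) v = coset_dist P g v"
proof -
  have "(\<exists>h'\<in>P. n = dist v (Base (g \<otimes> h \<otimes> h'))) \<longleftrightarrow> (\<exists>h'\<in>P. n = dist v (Base (g \<otimes> h')))" for n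
  proof
    assume "\<exists>h'\<in>P. n = dist v (Base (g \<otimes> h \<otimes> h'))"
    then show "\<exists>h'\<in>P. n = dist v (Base (g \<otimes> h'))"
      using assms Ps_m Ps_carrier by (metis m_assoc)
  next
    assume "\<exists>h'\<in>P. n = dist v (Base (g \<otimes> h'))"
    then obtain h' where h': "h' \<in> P" "n = dist v (Base (g \<otimes> h'))" by blast
    have "g \<otimes> h \<otimes> (inv h \<otimes> h') = g \<otimes> h'"
      using assms h' Ps_carrier by (metis inv_closed l_inv l_one m_assoc m_closed inv_inv r_inv)
    then show "\<exists>h'\<in>P. n = dist v (Base (g \<otimes> h \<otimes> h'))"
      using h' assms Ps_m Ps_inv by metis
  qed
  then show ?thesis unfolding coset_dist_def by simp
qed

section \<open>Horoballs, Busemann functions and deep vertices\<close>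

definition in_horoball :: "'a set \<Rightarrow> 'a \<Rightarrow> 'a cusp_vertex \<Rightarrow> bool" where
  "in_horoball P g v \<longleftrightarrow> (\<exists>x k. v = Horo P x k \<and> inv g \<otimes> x \<in> P)"

primrec depth :: "'a cusp_vertex \<Rightarrow> nat" where
  "depth (Base x) = 0"
| "depth (Horo P x k) = k"

text \<open>An integer-valued Busemann function of the horoball over \<open>gP\<close>.\<close>

definition horofun :: "'a set \<Rightarrow> 'a \<Rightarrow> 'a cusp_vertex \<Rightarrow> int" where
  "horofun P g v = (if in_horoball P g v then - int (depth v) else int (coset_dist P g v))"

lemma in_horoball_simps [simp]:
  "\<not> in_horoball P g (Base x)"
  "in_horoball P g (Horo P' x k) \<longleftrightarrow> P' = P \<and> inv g \<otimes> x \<in> P"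
  by (auto simp: in_horoball_def)

lemma coset_trans:
  assumes "P \<in> Ps" "g \<in> carrier G" "x \<in> carrier G" "y \<in> carrier G" "inv x \<otimes> y \<in> P"
  shows "inv g \<otimes> x \<in> P \<longleftrightarrow> inv g \<otimes> y \<in> P"
proof
  assume "inv g \<otimes> x \<in> P"
  then have "(inv g \<otimes> x) \<otimes> (inv x \<otimes> y) \<in> P" using assms Ps_m by blast
  moreover have "(inv g \<otimes> x) \<otimes> (inv x \<otimes> y) = inv g \<otimes> y"
    using assms by (simp add: m_assoc) (metis inv_closed m_assoc r_inv l_one)
  ultimately show "inv g \<otimes> y \<in> P" by simp
next
  assume "inv g \<otimes> y \<in> P"
  then have "(inv g \<otimes> y) \<otimes> inv (inv x \<otimes> y) \<in> P" using assms Ps_m Ps_inv by blast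
  moreover have "(inv g \<otimes> y) \<otimes> inv (inv x \<otimes> y) = inv g \<otimes> x"
    using assms by (simp add: inv_mult_group m_assoc) (metis inv_closed m_assoc r_inv l_one)
  ultimately show "inv g \<otimes> x \<in> P" by simp
qed

lemma coset_dist_eq_0:
  assumes "P \<in> Ps" "g \<in> carrier G" "x \<in> carrier G" "inv g \<otimes> x \<in> P"
  shows "coset_dist P g (Base x) = 0"
proof -
  have "g \<otimes> (inv g \<otimes> x) = x" using assms by (simp add: m_assoc[symmetric])
  then show ?thesis using coset_dist_le[OF assms(4), of g "Base x"] by simp
qed

text \<open>An edge that crosses the boundary of the horoball joins a base vertex of the coset to a
  vertex of depth one, where the values are \<open>0\<close> and \<open>-1\<close>. Along other
  edges either the depth or the coset distance changes by at most one.\<close>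

lemma horofun_edge0:
  assumes "P \<in> Ps" "g \<in> carrier G" "edge0 u v"
  shows "\<bar>horofun P g u - horofun P g v\<bar> \<le> 1"
proof -
  have V: "u \<in> verts" "v \<in> verts" using edge0_verts assms by auto
  have "dist u v \<le> 1" "dist v u \<le> 1" using assms(3) dist_adj[of u v] dist_adj[of v u] by (auto simp: cusp_adj_def)
  then have "\<bar>int (coset_dist P g u) - int (coset_dist P g v)\<bar> \<le> 1"
    using coset_dist_lipschitz[of P g u v] coset_dist_lipschitz[of P g v u] assms V by linarith
  moreover have "(in_horoball P g u \<longleftrightarrow> in_horoball P g v) \<and> \<bar>int (depth u) - int (depth v)\<bar> \<le> 1
     \<or> horofun P g u = 0 \<and> horofun P g v = -1"
    using assms(3) unfolding cusp_edge0_def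
  proof (elim disjE exE conjE, goal_cases)
    case (2 P' x)
    then show ?case using coset_dist_eq_0[of P g x] assms by (auto simp: horofun_def)
  next
    case (4 P' x y k)
    then show ?case using coset_trans[of P g x y] assms by auto
  qed auto
  ultimately show ?thesis by (auto simp: horofun_def)
qed

lemma horofun_adj: "P \<in> Ps \<Longrightarrow> g \<in> carrier G \<Longrightarrow> adj u v \<Longrightarrow> horofun P g v \<le> horofun P g u + 1"
  using horofun_edge0[of P g u v] horofun_edge0[of P g v u] by (auto simp: cusp_adj_def)

lemma horofun_lipschitz:
  assumes "P \<in> Ps" "g \<in> carrier G" "u \<in> verts" "v \<in> verts"
  shows "horofun P g v \<le> horofun P g u + int (dist u v)"
  using lipschitz_fun[of "horofun P g"] horofun_adj assms by blast

lemma horofun_deep: "P \<in> Ps \<Longrightarrow> g \<in> carrier G \<Longrightarrow> horofun P g (Horo P g k) = - int k"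
  by (simp add: horofun_def Ps_one)

lemma dist_deep_ge:
  assumes "P \<in> Ps" "g \<in> carrier G" "u \<in> verts" "1 \<le> k"
  shows "horofun P g u + int k \<le> int (dist (Horo P g k) u)"
  using horofun_lipschitz[of P g "Horo P g k" u] assms by (simp add: horofun_deep)

lemma dist_deep_Base_ge:
  assumes "P \<in> Ps" "g \<in> carrier G" "x \<in> carrier G" "1 \<le> k"
  shows "coset_dist P g (Base x) + k \<le> dist (Horo P g k) (Base x)"
  using dist_deep_ge[of P g "Base x" k] assms by (simp add: horofun_def)

lemma dist_Base_deep_le:
  assumes "P \<in> Ps" "x \<in> carrier G"
  shows "dist (Base x) (Horo P x k) \<le> k \<or> k = 0"
proof (induction k)
  case (Suc k)
  show ?case
  proof (cases "k = 0")
    case True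
    then show ?thesis using dist_adj[OF adj_Base_Horo[of x P]] assms by simp
  next
    case False
    then have "dist (Base x) (Horo P x (Suc k)) \<le> dist (Base x) (Horo P x k) + dist (Horo P x k) (Horo P x (Suc k))"
      using assms by (intro dist_triangle) auto
    then show ?thesis using Suc dist_adj[OF adj_Horo_Suc[of x P k]] assms False by simp
  qed
qed simp

lemma dist_Horo_le_1:
  assumes "P \<in> Ps" "x \<in> carrier G" "h \<in> P" "word_length G (S \<inter> P) h \<le> 2 ^ k" "1 \<le> k"
  shows "dist (Horo P x k) (Horo P (x \<otimes> h) k) \<le> 1"
proof (cases "h = \<one>")
  case True
  then show ?thesis using assms by simp
next
  case False
  have "word_length G (S \<inter> P) h \<noteq> 0"
    using word_length_attained[OF assms(1,3)] False by (metis foldr.simps(1) id_apply length_0_conv)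
  moreover have h: "h \<in> carrier G" using assms Ps_carrier by auto
  moreover have "inv x \<otimes> (x \<otimes> h) = h" using h assms by (simp add: m_assoc[symmetric])
  ultimately have "adj (Horo P x k) (Horo P (x \<otimes> h) k)"
    unfolding cusp_adj_def cusp_edge0_def using assms by auto
  then show ?thesis by (rule dist_adj)
qed

text \<open>As soon as \<open>2 ^ k\<close> exceeds the word length of \<open>h\<close>, a single
  horizontal edge at depth \<open>k\<close> connects the column over \<open>g\<close> with that over
  the nearest coset point; it accounts for the summand \<open>1\<close>. Together with the lower
  bound, \<open>Horo P g k\<close> measures the coset distance up to \<open>1\<close>, whichever
  representative \<open>g\<close> is taken.\<close>

lemma dist_deep_Base_le:
  assumes "P \<in> Ps" "g \<in> carrier G" "x \<in> carrier G"
  shows "\<exists>k0\<ge>1. \<forall>k\<ge>k0. dist (Horo P g k) (Base x) \<le> coset_dist P g (Base x) + k + 1"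
proof -
  obtain h where h: "h \<in> P" "coset_dist P g (Base x) = dist (Base x) (Base (g \<otimes> h))"
    using coset_dist_attained[OF assms(1)] .
  let ?n = "word_length G (S \<inter> P) h"
  have "dist (Horo P g k) (Base x) \<le> coset_dist P g (Base x) + k + 1" if "k \<ge> Suc ?n" for k
  proof -
    have hG: "h \<in> carrier G" using h assms Ps_carrier by auto
    have "?n < 2 ^ ?n" by (rule less_exp)
    also have "\<dots> \<le> 2 ^ k" using that by (intro power_increasing) auto
    finally have "dist (Horo P g k) (Horo P (g \<otimes> h) k) \<le> 1"
      using assms h that by (intro dist_Horo_le_1) auto
    moreover have "dist (Base (g \<otimes> h)) (Horo P (g \<otimes> h) k) \<le> k"
      using dist_Base_deep_le[of P "g \<otimes> h" k] assms hG that by simp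
    moreover have "dist (Horo P g k) (Base x) \<le> dist (Horo P g k) (Horo P (g \<otimes> h) k) +
        (dist (Horo P (g \<otimes> h) k) (Base (g \<otimes> h)) + dist (Base (g \<otimes> h)) (Base x))"
      using dist_triangle[of "Horo P g k" "Horo P (g \<otimes> h) k" "Base x"]
        dist_triangle[of "Horo P (g \<otimes> h) k" "Base (g \<otimes> h)" "Base x"] assms hG that by simp
    ultimately show ?thesis
      using h dist_commute[of "Base (g \<otimes> h)"] assms hG that by simp
  qed
  then show ?thesis by (intro exI[of _ "Suc ?n"]) auto
qed

text \<open>Getting out of the first horoball costs \<open>k\<close>, and the second vertex has
  distance at least \<open>k\<close> from all base vertices, hence from the first coset.\<close>

lemma dist_deep_deep_ge:
  assumes "P \<in> Ps" "P' \<in> Ps" "g \<in> carrier G" "g' \<in> carrier G" "1 \<le> k"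
    and "P \<noteq> P' \<or> inv g \<otimes> g' \<notin> P"
  shows "2 * k \<le> dist (Horo P g k) (Horo P' g' k)"
proof -
  have "horofun P g (Horo P' g' k) = int (coset_dist P g (Horo P' g' k))"
    using assms by (auto simp: horofun_def)
  then have "int (coset_dist P g (Horo P' g' k)) + int k \<le> int (dist (Horo P g k) (Horo P' g' k))"
    using dist_deep_ge[of P g "Horo P' g' k" k] assms by simp
  moreover obtain h where h: "h \<in> P" "coset_dist P g (Horo P' g' k) = dist (Horo P' g' k) (Base (g \<otimes> h))"
    using coset_dist_attained[OF assms(1)] .
  moreover have "k \<le> dist (Horo P' g' k) (Base (g \<otimes> h))"
    using dist_deep_Base_ge[of P' g' "g \<otimes> h" k] h assms Ps_carrier by simp
  ultimately show ?thesis by linarith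
qed

section \<open>Local finiteness\<close>

lemma finite_neighbours: "finite {v. adj u v}"
proof (cases u)
  case (Base x)
  have "{v. adj u v} \<subseteq> Base ` ((\<lambda>s. x \<otimes> s) ` S) \<union> (\<lambda>P. Horo P x 1) ` Ps"
  proof
    fix v assume "v \<in> {v. adj u v}"
    then consider "edge0 u v" | "edge0 v u" by (auto simp: cusp_adj_def)
    then show "v \<in> Base ` ((\<lambda>s. x \<otimes> s) ` S) \<union> (\<lambda>P. Horo P x 1) ` Ps"
    proof cases
      case 2
      then obtain y s where "y \<in> carrier G" "s \<in> S" "x = y \<otimes> s" "v = Base y"
        using Base by (auto simp: cusp_edge0_def)
      moreover from this have "y = x \<otimes> inv s" "inv s \<in> S"
        using S_facts by (auto simp: m_assoc)
      ultimately show ?thesis by blast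
    qed (use Base in \<open>auto simp: cusp_edge0_def\<close>)
  qed
  then show ?thesis using finite_subset S_facts(1) finite_Ps by blast
next
  case (Horo P x k)
  let ?B = "{h \<in> P. word_length G (S \<inter> P) h \<le> 2 ^ k}"
  show ?thesis
  proof (cases "P \<in> Ps")
    case True
    have "{v. adj u v} \<subseteq> {Base x, Horo P x (k - 1), Horo P x (Suc k)} \<union>
       (\<lambda>h. Horo P (x \<otimes> h) k) ` ?B \<union> (\<lambda>h. Horo P (x \<otimes> inv h) k) ` ?B"
    proof
      fix v assume "v \<in> {v. adj u v}"
      then consider "edge0 u v" | "edge0 v u" by (auto simp: cusp_adj_def)
      then show "v \<in> {Base x, Horo P x (k - 1), Horo P x (Suc k)} \<union>
         (\<lambda>h. Horo P (x \<otimes> h) k) ` ?B \<union> (\<lambda>h. Horo P (x \<otimes> inv h) k) ` ?B"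
      proof cases
        case 1
        then consider "v = Horo P x (Suc k)" | y where "y \<in> carrier G" "x \<in> carrier G" "inv x \<otimes> y \<in> ?B" "v = Horo P y k"
          using Horo by (auto simp: cusp_edge0_def)
        then show ?thesis
        proof cases
          case (2 y)
          then have "y = x \<otimes> (inv x \<otimes> y)" by (simp add: m_assoc[symmetric])
          then have "v = Horo P (x \<otimes> (inv x \<otimes> y)) k" using 2 by simp
          then show ?thesis using 2 by blast
        qed simp
      next
        case 2
        then consider "v = Base x" | "v = Horo P x (k - 1)" | y where "y \<in> carrier G" "x \<in> carrier G" "inv y \<otimes> x \<in> ?B" "v = Horo P y k"
          using Horo by (auto simp: cusp_edge0_def)
        then show ?thesis
        proof cases
          case (3 y)
          then have "y = x \<otimes> inv (inv y \<otimes> x)" by (simp add: inv_mult_group m_assoc[symmetric])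
          then have "v = Horo P (x \<otimes> inv (inv y \<otimes> x)) k" using 3 by simp
          then show ?thesis using 3 by blast
        qed simp_all
      qed
    qed
    then show ?thesis
      using finite_word_ball[OF True, of "2 ^ k"] by (auto intro: finite_subset)
  next
    case False
    then have "{v. adj u v} = {}" using Horo by (auto simp: cusp_adj_def cusp_edge0_def)
    then show ?thesis by simp
  qed
qed

lemma finite_ball: "u \<in> verts \<Longrightarrow> finite {v \<in> verts. dist u v \<le> r}"
proof (induction r)
  case 0
  have "{v \<in> verts. dist u v \<le> 0} \<subseteq> {u}" using dist_eq_0 0 by auto
  then show ?case using finite_subset by blast
next
  case (Suc r)
  have "{v \<in> verts. dist u v \<le> Suc r} \<subseteq>
      {v \<in> verts. dist u v \<le> r} \<union> (\<Union>w\<in>{v \<in> verts. dist u v \<le> r}. {v. adj w v})"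
  proof
    fix v assume v: "v \<in> {v \<in> verts. dist u v \<le> Suc r}"
    obtain f where f: "f 0 = u" "f (dist u v) = v" "\<And>i. i < dist u v \<Longrightarrow> adj (f i) (f (Suc i))"
      "\<And>i. i \<le> dist u v \<Longrightarrow> f i \<in> verts" "\<And>i j. i \<le> j \<Longrightarrow> j \<le> dist u v \<Longrightarrow> dist (f i) (f j) = j - i"
      using geodesic_exists[of u v] v Suc.prems by blast
    show "v \<in> {v \<in> verts. dist u v \<le> r} \<union> (\<Union>w\<in>{v \<in> verts. dist u v \<le> r}. {v. adj w v})"
    proof (cases "dist u v \<le> r")
      case False
      then have d: "dist u v = Suc r" using v by simp
      then have "dist u (f r) = r" using f(5)[of 0 r] f(1) by simp
      then show ?thesis using f(3)[of r] f(2) f(4)[of r] d by auto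
    qed (use v in auto)
  qed
  then show ?case using Suc finite_neighbours by (auto intro: finite_subset)
qed

text \<open>This makes the set of excluded short peripheral elements finite, and also the set of
  group elements that link a geodesic to a quasiconvex subgroup.\<close>

lemma finite_Base_ball: "finite {x \<in> carrier G. dist (Base \<one>) (Base x) \<le> r}"
proof -
  have "Base ` {x \<in> carrier G. dist (Base \<one>) (Base x) \<le> r} \<subseteq> {v \<in> verts. dist (Base \<one>) v \<le> r}"
    by auto
  then have "finite (Base ` {x \<in> carrier G. dist (Base \<one>) (Base x) \<le> r})"
    using finite_ball[of "Base \<one>" r] finite_subset by auto
  then show ?thesis by (rule finite_imageD) (simp add: inj_on_def)
qed

end

section \<open>Words of peripheral elements\<close>

context group
begin

lemma conjugate_iff:
  assumes "g \<in> carrier G" "A \<subseteq> carrier G"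
  shows "x \<in> conjugate G g A \<longleftrightarrow> x \<in> carrier G \<and> inv g \<otimes> x \<otimes> g \<in> A"
proof
  assume "x \<in> conjugate G g A"
  then obtain a where a: "a \<in> A" "x = g \<otimes> a \<otimes> inv g" by (auto simp: conjugate_def)
  then have "a \<in> carrier G" using assms by auto
  then have "inv g \<otimes> x \<otimes> g = a"
    using a assms by (simp add: m_assoc) (simp add: m_assoc[symmetric])
  then show "x \<in> carrier G \<and> inv g \<otimes> x \<otimes> g \<in> A" using a assms \<open>a \<in> carrier G\<close> by simp
next
  assume *: "x \<in> carrier G \<and> inv g \<otimes> x \<otimes> g \<in> A"
  then have "x = g \<otimes> (inv g \<otimes> x \<otimes> g) \<otimes> inv g"
    using assms by (simp add: m_assoc) (simp add: m_assoc[symmetric])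
  then show "x \<in> conjugate G g A" using * unfolding conjugate_def by blast
qed

end

locale dehn_filling = cusped_space +
  fixes N :: "'a set \<Rightarrow> 'a set"
  assumes filling: "is_filling G Ps N"
begin

lemma N_facts:
  assumes "P \<in> Ps"
  shows "N P \<subseteq> P" "\<one> \<in> N P" "n \<in> N P \<Longrightarrow> n' \<in> N P \<Longrightarrow> n \<otimes> n' \<in> N P"
    "n \<in> N P \<Longrightarrow> inv n \<in> N P" "h \<in> P \<Longrightarrow> n \<in> N P \<Longrightarrow> inv h \<otimes> n \<otimes> h \<in> N P"
proof -
  interpret n: normal "N P" "G\<lparr>carrier := P\<rparr>" using filling assms by (auto simp: is_filling_def)
  have inv: "inv\<^bsub>G\<lparr>carrier := P\<rparr>\<^esub> h = inv h" if "h \<in> P" for h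
    using m_inv_consistent[OF subgroup_Ps[OF assms] that] .
  have sg: "subgroup (N P) (G\<lparr>carrier := P\<rparr>)" by (rule n.subgroup_axioms)
  show sub: "N P \<subseteq> P" using subgroup.subset[OF sg] by simp
  show "\<one> \<in> N P" using subgroup.one_closed[OF sg] by simp
  show "n \<in> N P \<Longrightarrow> n' \<in> N P \<Longrightarrow> n \<otimes> n' \<in> N P" using subgroup.m_closed[OF sg] by simp
  show "n \<in> N P \<Longrightarrow> inv n \<in> N P" by (metis inv sg sub subgroup.m_inv_closed subsetD)
  show "h \<in> P \<Longrightarrow> n \<in> N P \<Longrightarrow> inv h \<otimes> n \<otimes> h \<in> N P" using n.inv_op_closed1[of h n] inv by simp
qed

lemma N_carrier: "P \<in> Ps \<Longrightarrow> N P \<subseteq> carrier G"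
  using N_facts(1) Ps_carrier by blast

section \<open>Conjugates of the filling kernels as groups of rotations about horoballs\<close>

definition rot :: "'a set \<Rightarrow> 'a \<Rightarrow> 'a set" where
  "rot P g = conjugate G g (N P)"

lemma rot_iff: "P \<in> Ps \<Longrightarrow> g \<in> carrier G \<Longrightarrow> n \<in> rot P g \<longleftrightarrow> n \<in> carrier G \<and> inv g \<otimes> n \<otimes> g \<in> N P"
  unfolding rot_def using N_carrier by (intro conjugate_iff)

lemma rot_carrier: "P \<in> Ps \<Longrightarrow> g \<in> carrier G \<Longrightarrow> n \<in> rot P g \<Longrightarrow> n \<in> carrier G"
  by (simp add: rot_iff)

lemma rot_mult:
  assumes "P \<in> Ps" "g \<in> carrier G" "n \<in> rot P g" "n' \<in> rot P g"
  shows "n \<otimes> n' \<in> rot P g"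
proof -
  have n: "n \<in> carrier G" "n' \<in> carrier G" using assms rot_carrier by auto
  have "(inv g \<otimes> n \<otimes> g) \<otimes> (inv g \<otimes> n' \<otimes> g) \<in> N P"
    by (rule N_facts(3)) (use assms in \<open>auto simp: rot_iff\<close>)
  moreover have "(inv g \<otimes> n \<otimes> g) \<otimes> (inv g \<otimes> n' \<otimes> g) = inv g \<otimes> (n \<otimes> n') \<otimes> g"
    using n assms by (simp add: m_assoc) (simp add: m_assoc[symmetric])
  ultimately show ?thesis using n assms by (simp add: rot_iff)
qed

lemma rot_inv:
  assumes "P \<in> Ps" "g \<in> carrier G" "n \<in> rot P g"
  shows "inv n \<in> rot P g"
proof -
  have n: "n \<in> carrier G" using assms rot_carrier by auto
  have "inv (inv g \<otimes> n \<otimes> g) \<in> N P"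
    by (rule N_facts(4)) (use assms in \<open>auto simp: rot_iff\<close>)
  moreover have "inv (inv g \<otimes> n \<otimes> g) = inv g \<otimes> inv n \<otimes> g"
    using n assms by (simp add: m_assoc inv_mult_group)
  ultimately show ?thesis using n assms by (simp add: rot_iff)
qed

lemma rot_conjugate:
  assumes "P \<in> Ps" "g \<in> carrier G" "n \<in> rot P g" "u \<in> carrier G"
  shows "u \<otimes> n \<otimes> inv u \<in> rot P (u \<otimes> g)"
proof -
  have n: "n \<in> carrier G" using assms rot_carrier by auto
  have "inv (u \<otimes> g) \<otimes> (u \<otimes> n \<otimes> inv u) \<otimes> (u \<otimes> g) = inv g \<otimes> n \<otimes> g"
    using n assms by (simp add: inv_mult_group m_assoc) (simp add: m_assoc[symmetric])
  then show ?thesis using n assms by (simp add: rot_iff)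
qed

lemma rot_same_coset:
  assumes "P \<in> Ps" "g \<in> carrier G" "g' \<in> carrier G" "inv g' \<otimes> g \<in> P" "n \<in> rot P g'"
  shows "n \<in> rot P g"
proof -
  have n: "n \<in> carrier G" "inv g' \<otimes> n \<otimes> g' \<in> N P" using assms rot_iff by auto
  have "inv (inv g' \<otimes> g) \<otimes> (inv g' \<otimes> n \<otimes> g') \<otimes> (inv g' \<otimes> g) \<in> N P"
    by (rule N_facts(5)) (use n assms in auto)
  moreover have "inv (inv g' \<otimes> g) \<otimes> (inv g' \<otimes> n \<otimes> g') \<otimes> (inv g' \<otimes> g) = inv g \<otimes> n \<otimes> g"
    using n assms by (simp add: inv_mult_group m_assoc) (simp add: m_assoc[symmetric])
  ultimately show ?thesis using n assms by (simp add: rot_iff)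
qed

lemma rot_fixes_coset:
  assumes "P \<in> Ps" "g \<in> carrier G" "n \<in> rot P g"
  obtains h where "h \<in> P" "n \<otimes> g = g \<otimes> h"
proof
  show "inv g \<otimes> n \<otimes> g \<in> P" using assms rot_iff N_facts(1) by blast
  show "n \<otimes> g = g \<otimes> (inv g \<otimes> n \<otimes> g)"
    using assms rot_carrier by (simp add: m_assoc) (simp add: m_assoc[symmetric])
qed

lemma coset_dist_rot:
  assumes "P \<in> Ps" "g \<in> carrier G" "n \<in> rot P g" "x \<in> carrier G"
  shows "coset_dist P g (Base (n \<otimes> x)) = coset_dist P g (Base x)"
proof -
  obtain h where h: "h \<in> P" "n \<otimes> g = g \<otimes> h" using rot_fixes_coset[OF assms(1-3)] .
  have "coset_dist P (n \<otimes> g) (Base (n \<otimes> x)) = coset_dist P g (Base x)"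
    using coset_dist_translate[of P g n "Base x"] assms rot_carrier by simp
  then show ?thesis using h coset_dist_same_coset[of P g h] assms by simp
qed

section \<open>Letters with a chosen coset, and words of minimal complexity\<close>

definition letter :: "'a set \<times> 'a \<times> 'a \<Rightarrow> bool" where
  "letter = (\<lambda>(P, g, n). P \<in> Ps \<and> g \<in> carrier G \<and> n \<in> rot P g)"

definition val :: "('a set \<times> 'a \<times> 'a) list \<Rightarrow> 'a" where
  "val ws = lprod (map (snd \<circ> snd) ws)"

definition word_for :: "'a \<Rightarrow> ('a set \<times> 'a \<times> 'a) list \<Rightarrow> bool" where
  "word_for k ws \<longleftrightarrow> list_all letter ws \<and> val ws = k"

definition height :: "'a set \<times> 'a \<times> 'a \<Rightarrow> nat" where
  "height = (\<lambda>(P, g, n). coset_dist P g (Base \<one>))"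

lemma letter_carrier: "list_all letter ws \<Longrightarrow> set (map (snd \<circ> snd) ws) \<subseteq> carrier G"
  by (auto simp: list_all_iff letter_def rot_carrier)

lemma val_closed: "list_all letter ws \<Longrightarrow> val ws \<in> carrier G"
  unfolding val_def by (intro lprod_closed letter_carrier)

lemma val_append: "list_all letter ws \<Longrightarrow> list_all letter vs \<Longrightarrow> val (ws @ vs) = val ws \<otimes> val vs"
  unfolding val_def map_append by (intro lprod_append letter_carrier)

lemma val_Cons: "val ((P, g, n) # ws) = n \<otimes> val ws"
  by (simp add: val_def)

lemma kernel_word:
  assumes "k \<in> filling_kernel G Ps N"
  shows "\<exists>ws. word_for k ws"
proof -
  let ?A = "\<Union>g\<in>carrier G. conjugate G g (\<Union>P\<in>Ps. N P)"
  have A: "a \<in> ?A \<longleftrightarrow> (\<exists>P g. letter (P, g, a))" for a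
    by (auto simp: letter_def rot_def conjugate_def)
  have "?A \<subseteq> carrier G" using A rot_carrier by (auto simp: letter_def)
  moreover have "inv a \<in> ?A" if "a \<in> ?A" for a
    using that rot_inv unfolding A letter_def by fast
  ultimately obtain as where as: "set as \<subseteq> ?A" "lprod as = k"
    using generate_lprod[of ?A k] assms by (auto simp: filling_kernel_def)
  have "\<exists>f. \<forall>a\<in>?A. letter (fst (f a), snd (f a), a)"
    using A by (intro bchoice) auto
  then obtain f where f: "\<And>a. a \<in> ?A \<Longrightarrow> letter (fst (f a), snd (f a), a)" by blast
  have "word_for k (map (\<lambda>a. (fst (f a), snd (f a), a)) as)"
    using as f unfolding word_for_def val_def list_all_iff by (force simp: comp_def)
  then show ?thesis by blast
qed

lemma rot_subset_kernel:
  assumes "P \<in> Ps" "g \<in> carrier G" "n \<in> rot P g"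
  shows "n \<in> filling_kernel G Ps N"
  using assms unfolding filling_kernel_def rot_def conjugate_def by (intro generate.incl) auto

text \<open>Minimal length forbids trivial letters and merging two letters. The minimal sum of
  heights, which is compared second, forbids lowering a letter by conjugating it past its
  neighbours.\<close>

definition tight_word :: "('a set \<times> 'a \<times> 'a) list \<Rightarrow> bool" where
  "tight_word ws \<longleftrightarrow> list_all letter ws \<and>
     (\<forall>vs. word_for (val ws) vs \<longrightarrow> length ws < length vs \<or>
        length ws = length vs \<and> sum_list (map height ws) \<le> sum_list (map height vs))"

lemma tight_word_exists:
  assumes "word_for k ws"
  obtains vs where "word_for k vs" "tight_word vs" "length vs \<le> length ws"
proof -
  obtain m where m: "\<exists>vs. word_for k vs \<and> length vs = m"
    "\<And>vs. word_for k vs \<Longrightarrow> m \<le> length vs"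
    using ex_has_least_nat[of "word_for k" ws length] assms by metis
  then obtain vs where vs: "word_for k vs" "length vs = m"
    "\<And>us. word_for k us \<Longrightarrow> length us = m \<Longrightarrow> sum_list (map height vs) \<le> sum_list (map height us)"
    using ex_has_least_nat[of "\<lambda>vs. word_for k vs \<and> length vs = m" _ "\<lambda>vs. sum_list (map height vs)"] by metis
  show ?thesis
  proof (rule that[OF vs(1)])
    show "tight_word vs"
      unfolding tight_word_def
    proof (intro conjI allI impI)
      show "list_all letter vs" using vs(1) by (simp add: word_for_def)
      fix us assume "word_for (val vs) us"
      then have us: "word_for k us" using vs(1) by (simp add: word_for_def)
      then show "length vs < length us \<or> length vs = length us \<and> sum_list (map height vs) \<le> sum_list (map height us)"
        using m(2)[OF us] vs(2) vs(3)[OF us] by (cases "length us = m") auto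
    qed
  qed (use m(2)[OF assms] vs in simp)
qed

lemma tight_word_cases:
  assumes "tight_word ws" "list_all letter vs" "val vs = val ws"
  shows "length ws \<le> length vs"
    "length ws = length vs \<Longrightarrow> sum_list (map height ws) \<le> sum_list (map height vs)"
  using assms unfolding tight_word_def word_for_def by fastforce+

text \<open>A letter is moved past a subword by conjugation, which preserves the length of the word, so
  minimality bounds the height of the conjugated letter from below.\<close>

lemma move_left:
  assumes "tight_word (As @ Bs @ (P, g, n) # Ds)"
  shows "coset_dist P g (Base \<one>) \<le> coset_dist P (val (As @ Bs) \<otimes> g) (Base (val As))"
proof -
  let ?l = "(P, g, n)"
  have let_all: "list_all letter As" "list_all letter Bs" "letter ?l" "list_all letter Ds"
    using assms by (auto simp: tight_word_def)
  then have l: "P \<in> Ps" "g \<in> carrier G" "n \<in> rot P g" "n \<in> carrier G"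
    by (auto simp: letter_def rot_carrier)
  define u where "u = val Bs"
  have V: "val As \<in> carrier G" "u \<in> carrier G" "val Ds \<in> carrier G"
    using let_all val_closed by (auto simp: u_def)
  let ?l' = "(P, u \<otimes> g, u \<otimes> n \<otimes> inv u)"
  have "letter ?l'" using l V rot_conjugate by (auto simp: letter_def)
  moreover have "val (As @ ?l' # Bs @ Ds) = val (As @ Bs @ ?l # Ds)"
  proof -
    have "(u \<otimes> n \<otimes> inv u) \<otimes> (u \<otimes> val Ds) = u \<otimes> (n \<otimes> val Ds)"
      using V l by (simp add: m_assoc) (simp add: m_assoc[symmetric])
    then show ?thesis using let_all \<open>letter ?l'\<close> by (simp add: val_append val_Cons u_def)
  qed
  ultimately have "sum_list (map height (As @ Bs @ ?l # Ds)) \<le> sum_list (map height (As @ ?l' # Bs @ Ds))"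
    using let_all by (intro tight_word_cases(2)[OF assms]) auto
  then have "coset_dist P g (Base \<one>) \<le> coset_dist P (u \<otimes> g) (Base \<one>)"
    by (simp add: height_def)
  also have "\<dots> = coset_dist P (val As \<otimes> (u \<otimes> g)) (Base (val As))"
    using coset_dist_translate[of P "u \<otimes> g" "val As" "Base \<one>"] l V by simp
  finally show ?thesis using let_all V l by (simp add: val_append u_def m_assoc)
qed

text \<open>Moving the letter to the right conjugates it by the inverse of \<open>u\<close>. Since
  \<open>n\<close> preserves the coset of \<open>g\<close>, the vertices \<open>u\<close> and
  \<open>n \<otimes> u\<close> are equally far from it, so the estimate holds for the partial
  product that already contains the letter.\<close>

lemma move_right:
  assumes "tight_word (As @ (P, g, n) # Bs @ Ds)"
  shows "coset_dist P g (Base \<one>) \<le> coset_dist P (val As \<otimes> g) (Base (val (As @ (P, g, n) # Bs)))"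
proof -
  let ?l = "(P, g, n)"
  have let_all: "list_all letter As" "list_all letter Bs" "letter ?l" "list_all letter Ds"
    using assms by (auto simp: tight_word_def)
  then have l: "P \<in> Ps" "g \<in> carrier G" "n \<in> rot P g" "n \<in> carrier G"
    by (auto simp: letter_def rot_carrier)
  define u where "u = val Bs"
  have V: "val As \<in> carrier G" "u \<in> carrier G" "val Ds \<in> carrier G"
    using let_all val_closed by (auto simp: u_def)
  let ?l' = "(P, inv u \<otimes> g, inv u \<otimes> n \<otimes> u)"
  have "letter ?l'" using l V rot_conjugate[of P g n "inv u"] by (auto simp: letter_def)
  moreover have "val (As @ Bs @ ?l' # Ds) = val (As @ ?l # Bs @ Ds)"
  proof -
    have "u \<otimes> ((inv u \<otimes> n \<otimes> u) \<otimes> val Ds) = n \<otimes> (u \<otimes> val Ds)"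
      using V l by (simp add: m_assoc) (simp add: m_assoc[symmetric])
    then show ?thesis using let_all \<open>letter ?l'\<close> by (simp add: val_append val_Cons u_def)
  qed
  ultimately have "sum_list (map height (As @ ?l # Bs @ Ds)) \<le> sum_list (map height (As @ Bs @ ?l' # Ds))"
    using let_all by (intro tight_word_cases(2)[OF assms]) auto
  then have "coset_dist P g (Base \<one>) \<le> coset_dist P (inv u \<otimes> g) (Base \<one>)"
    by (simp add: height_def)
  also have "\<dots> = coset_dist P (u \<otimes> (inv u \<otimes> g)) (Base u)"
    using coset_dist_translate[of P "inv u \<otimes> g" "u" "Base \<one>"] l V by simp
  also have "u \<otimes> (inv u \<otimes> g) = g" using V l by (simp add: m_assoc[symmetric])
  also have "coset_dist P g (Base u) = coset_dist P g (Base (n \<otimes> u))"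
    using coset_dist_rot l V by simp
  also have "\<dots> = coset_dist P (val As \<otimes> g) (Base (val As \<otimes> (n \<otimes> u)))"
    using coset_dist_translate[of P g "val As" "Base (n \<otimes> u)"] l V by simp
  finally show ?thesis using let_all by (simp add: val_append val_Cons u_def)
qed

text \<open>If the two translated cosets agreed, the second letter, conjugated past
  \<open>Bs\<close>, would rotate about the same coset as the first, and the two could be merged
  into one letter.\<close>

lemma distinct_cosets:
  assumes "tight_word (As @ (P, g, n) # Bs @ (P, g', n') # Ds)"
  shows "inv (val As \<otimes> g) \<otimes> (val (As @ (P, g, n) # Bs) \<otimes> g') \<notin> P"
proof
  assume *: "inv (val As \<otimes> g) \<otimes> (val (As @ (P, g, n) # Bs) \<otimes> g') \<in> P"
  let ?l = "(P, g, n)" and ?l' = "(P, g', n')"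
  have let_all: "list_all letter As" "list_all letter Bs" "letter ?l" "letter ?l'" "list_all letter Ds"
    using assms by (auto simp: tight_word_def)
  then have l: "P \<in> Ps" "g \<in> carrier G" "n \<in> rot P g" "n \<in> carrier G"
    "g' \<in> carrier G" "n' \<in> rot P g'" "n' \<in> carrier G"
    by (auto simp: letter_def rot_carrier)
  define u where "u = val Bs"
  have V: "val As \<in> carrier G" "u \<in> carrier G" "val Ds \<in> carrier G"
    using let_all val_closed by (auto simp: u_def)
  have "val (As @ ?l # Bs) = val As \<otimes> (n \<otimes> u)" using let_all by (simp add: val_append val_Cons u_def)
  then have "inv (val As \<otimes> g) \<otimes> (val (As @ ?l # Bs) \<otimes> g') = inv g \<otimes> (n \<otimes> u \<otimes> g')"
    using V l inv_mult_cancel[of "val As" g "n \<otimes> u \<otimes> g'"] by (simp add: m_assoc)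
  then have 1: "inv g \<otimes> (n \<otimes> (u \<otimes> g')) \<in> P" using * V l by (simp add: m_assoc)
  \<comment> \<open>As \<open>n\<close> preserves the coset of \<open>g\<close>, it can be cancelled
    from the coset relation \<open>1\<close>, at the cost of the factor \<open>h\<close>.\<close>
  obtain h where h: "h \<in> P" "inv n \<otimes> g = g \<otimes> h" using rot_fixes_coset[OF l(1,2) rot_inv[OF l(1-3)]] .
  have hG: "h \<in> carrier G" using h l Ps_carrier by auto
  have "h \<otimes> (inv g \<otimes> (n \<otimes> (u \<otimes> g'))) \<in> P" using h 1 l Ps_m by blast
  moreover have "h = inv g \<otimes> (inv n \<otimes> g)" using h(2) l hG by (simp add: m_assoc[symmetric])
  then have "h \<otimes> (inv g \<otimes> (n \<otimes> (u \<otimes> g'))) = inv g \<otimes> (u \<otimes> g')"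
    using l V by (simp add: m_assoc) (simp add: m_assoc[symmetric])
  ultimately have "inv g \<otimes> (u \<otimes> g') \<in> P" by simp
  then have "inv (inv g \<otimes> (u \<otimes> g')) \<in> P" using l Ps_inv by blast
  moreover have "inv (inv g \<otimes> (u \<otimes> g')) = inv (u \<otimes> g') \<otimes> g" using l V by (simp add: inv_mult_group)
  ultimately have "inv (u \<otimes> g') \<otimes> g \<in> P" by simp
  then have "u \<otimes> n' \<otimes> inv u \<in> rot P g"
    using l V rot_conjugate[of P g' n' u] by (intro rot_same_coset[of P g "u \<otimes> g'"]) auto
  then have l'': "letter (P, g, n \<otimes> (u \<otimes> n' \<otimes> inv u))" using l rot_mult by (auto simp: letter_def)
  have "val (As @ (P, g, n \<otimes> (u \<otimes> n' \<otimes> inv u)) # Bs @ Ds) = val (As @ ?l # Bs @ ?l' # Ds)"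
  proof -
    have "(n \<otimes> (u \<otimes> n' \<otimes> inv u)) \<otimes> (u \<otimes> val Ds) = n \<otimes> (u \<otimes> (n' \<otimes> val Ds))"
      using V l by (simp add: m_assoc) (simp add: m_assoc[symmetric])
    then show ?thesis using let_all l'' by (simp add: val_append val_Cons u_def)
  qed
  then have "length (As @ ?l # Bs @ ?l' # Ds) \<le> length (As @ (P, g, n \<otimes> (u \<otimes> n' \<otimes> inv u)) # Bs @ Ds)"
    using let_all l'' by (intro tight_word_cases(1)[OF assms]) auto
  then show False by simp
qed

end

section \<open>Tight words pass through horoballs\<close>

lemma take_Suc_decomp:
  assumes "i < j" "j \<le> length ws"
  shows "take j ws = take i ws @ ws ! i # drop (Suc i) (take j ws)"
  using id_take_nth_drop[of i "take j ws"] assms by (simp add: min_def)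

locale hyperbolic_filling = dehn_filling +
  hyperbolic "cusp_verts G Ps" "cusp_adj G Ps S" \<delta> for \<delta>
begin

lemma eventually_dist_deep_Base_le:
  assumes "P \<in> Ps" "g \<in> carrier G" "x \<in> carrier G"
  shows "eventually (\<lambda>k. dist (Horo P g k) (Base x) \<le> coset_dist P g (Base x) + k + 1) sequentially"
  using dist_deep_Base_le[OF assms] unfolding eventually_sequentially by blast

text \<open>Let \<open>y\<close> be a point of the coset nearest to \<open>x\<close>. From a deep
  vertex, geodesics to \<open>x\<close> and \<open>r \<otimes> x\<close> pass near \<open>y\<close>
  and \<open>r \<otimes> y\<close>. These are more than \<open>2 * R0\<close> apart, because
  \<open>inv y \<otimes> (r \<otimes> y)\<close> is a nontrivial element of \<open>N P\<close>; so
  the two geodesics separate roughly \<open>R0\<close> before they reach depth zero.\<close>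

lemma eventually_rot_turn:
  assumes "P \<in> Ps" "g \<in> carrier G" "x \<in> carrier G" "r \<in> rot P g" "r \<noteq> \<one>"
    and long: "\<And>P h. P \<in> Ps \<Longrightarrow> h \<in> N P \<Longrightarrow> h \<noteq> \<one> \<Longrightarrow> 2 * R0 < real (dist (Base \<one>) (Base h))"
    and R0: "1 + 2 * \<delta> < R0"
  shows "eventually (\<lambda>k. gp (Horo P g k) (Base x) (Base (r \<otimes> x)) \<le> real k + 1 + 2 * \<delta> - R0) sequentially"
proof -
  note A = assms(1-5)
  obtain h where h: "h \<in> P" "coset_dist P g (Base x) = dist (Base x) (Base (g \<otimes> h))"
    using coset_dist_attained[OF A(1)] .
  define y where "y = g \<otimes> h"
  have G: "h \<in> carrier G" "y \<in> carrier G" "r \<in> carrier G" "r \<otimes> x \<in> carrier G" "r \<otimes> y \<in> carrier G"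
    using Ps_carrier[OF A(1) h(1)] rot_carrier[OF A(1,2,4)] A(2,3) by (auto simp: y_def)
  have "y \<in> carrier G \<and> inv g \<otimes> y \<in> P" using h A G by (simp add: y_def m_assoc[symmetric])
  then have y0: "coset_dist P g (Base y) = 0" using coset_dist_eq_0[of P g y] A by simp
  have ry0: "coset_dist P g (Base (r \<otimes> y)) = 0" and rx: "coset_dist P g (Base (r \<otimes> x)) = coset_dist P g (Base x)"
    using coset_dist_rot A G y0 by auto
  have dxy: "dist (Base x) (Base y) = coset_dist P g (Base x)"
    "dist (Base (r \<otimes> x)) (Base (r \<otimes> y)) = coset_dist P g (Base x)"
    using h dist_Base_translate[of r x y] A G by (auto simp: y_def)
  define n where "n = inv y \<otimes> (r \<otimes> y)"
  have n: "n = inv h \<otimes> (inv g \<otimes> r \<otimes> g) \<otimes> h"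
    using G A by (simp add: n_def y_def inv_mult_group m_assoc)
  have "n \<in> N P" unfolding n by (rule N_facts(5)) (use h A in \<open>auto simp: rot_iff\<close>)
  moreover have "n \<noteq> \<one>"
  proof
    assume "n = \<one>"
    then have "y \<otimes> n = y" using G by simp
    moreover have "y \<otimes> n = r \<otimes> y" using G by (simp add: n_def m_assoc[symmetric])
    ultimately have "r \<otimes> y = y" by simp
    then show False using G A(5) r_cancel_one by blast
  qed
  moreover have "dist (Base y) (Base (r \<otimes> y)) = dist (Base \<one>) (Base n)"
  proof -
    have "y \<otimes> n = r \<otimes> y" using G by (simp add: n_def m_assoc[symmetric])
    then show ?thesis using dist_Base_translate[of y \<one> n] G \<open>n \<in> N P\<close> A N_carrier by auto
  qed
  ultimately have far: "2 * R0 < real (dist (Base y) (Base (r \<otimes> y)))" using long[OF A(1), of n] by simp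
  have "eventually (\<lambda>k. dist (Horo P g k) (Base y) \<le> 0 + k + 1) sequentially"
    "eventually (\<lambda>k. dist (Horo P g k) (Base (r \<otimes> y)) \<le> 0 + k + 1) sequentially"
    using eventually_dist_deep_Base_le[of P g y] eventually_dist_deep_Base_le[of P g "r \<otimes> y"] A G y0 ry0 by auto
  then show ?thesis using eventually_ge_at_top[of 1]
  proof eventually_elim
    case (elim k)
    let ?z = "Horo P g k"
    have V: "?z \<in> verts" "Base x \<in> verts" "Base y \<in> verts" "Base (r \<otimes> x) \<in> verts" "Base (r \<otimes> y) \<in> verts"
      using A G elim by auto
    have ge: "coset_dist P g (Base w) + k \<le> dist ?z (Base w)" if "w \<in> carrier G" for w
      using dist_deep_Base_ge[of P g w k] A elim that by simp
    have "real k \<le> gp ?z (Base y) (Base x)"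
      using ge[of x] ge[of y] G A y0 dxy V dist_commute[of "Base x" "Base y"] unfolding gp_def by simp
    moreover have "real k \<le> gp ?z (Base (r \<otimes> x)) (Base (r \<otimes> y))"
      using ge[of "r \<otimes> x"] ge[of "r \<otimes> y"] G A rx ry0 dxy unfolding gp_def by simp
    moreover have "gp ?z (Base y) (Base (r \<otimes> y)) < real k + 1 - R0"
      using elim far unfolding gp_def by (simp add: field_simps)
    moreover have "gp ?z (Base y) (Base (r \<otimes> y)) \<ge> min (gp ?z (Base y) (Base x))
        (min (gp ?z (Base x) (Base (r \<otimes> x))) (gp ?z (Base (r \<otimes> x)) (Base (r \<otimes> y)))) - 2 * \<delta>"
      using V by (intro gp_hyp3)
    ultimately show ?case using R0 by linarith
  qed
qed

text \<open>A counterpart of the Greendlinger lemma: the numerical conclusion says that the geodesic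
  to \<open>val ws\<close> goes deep into the horoball over \<open>a\<close>, and a rotation about
  this very horoball shortens the word.\<close>

lemma tight_word_shortening:
  assumes tight: "tight_word ws" and ne: "ws \<noteq> []"
    and long: "\<And>P h. P \<in> Ps \<Longrightarrow> h \<in> N P \<Longrightarrow> h \<noteq> \<one> \<Longrightarrow> 2 * R0 < real (dist (Base \<one>) (Base h))"
    and R0: "30 * \<delta> \<le> R0"
  obtains P a r vs where "P \<in> Ps" "a \<in> carrier G" "r \<in> rot P a" "word_for (r \<otimes> val ws) vs"
    "length vs < length ws"
    "real (coset_dist P a (Base \<one>)) + real (coset_dist P a (Base (val ws))) + 2 * R0 - 2 - 8 * \<delta>
       \<le> real (dist (Base \<one>) (Base (val ws)))"
proof -
  define m where "m = length ws"
  define p where "p = (\<lambda>i. fst (ws ! i))"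
  define g where "g = (\<lambda>i. fst (snd (ws ! i)))"
  define n where "n = (\<lambda>i. snd (snd (ws ! i)))"
  define x where "x = (\<lambda>i. val (take i ws))"
  define a where "a = (\<lambda>i. x i \<otimes> g i)"
  have ws_i: "ws ! i = (p i, g i, n i)" for i by (simp add: p_def g_def n_def)
  have all: "list_all letter ws" using tight by (simp add: tight_word_def)
  have let_i: "p i \<in> Ps" "g i \<in> carrier G" "n i \<in> rot (p i) (g i)" "n i \<in> carrier G" if "i < m" for i
    using all ws_i[of i] that rot_carrier by (auto simp: list_all_iff letter_def m_def dest!: nth_mem)
  have sub: "list_all letter (take i ws)" "list_all letter (drop i ws)" for i
    using all by (auto simp: list_all_iff dest: in_set_takeD in_set_dropD)
  have xG: "x i \<in> carrier G" for i unfolding x_def by (rule val_closed[OF sub(1)])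
  have aG: "a i \<in> carrier G" if "i < m" for i using xG let_i[OF that] by (simp add: a_def)
  have x_Suc: "x (Suc i) = x i \<otimes> n i" if "i < m" for i
  proof -
    have "list_all letter [ws ! i]" using let_i[OF that] ws_i by (simp add: letter_def)
    then have "val (take i ws @ [ws ! i]) = val (take i ws) \<otimes> val [ws ! i]" using sub by (intro val_append)
    moreover have "val [ws ! i] = n i" using let_i[OF that] by (simp add: ws_i val_Cons) (simp add: val_def)
    ultimately show ?thesis using that by (simp add: x_def take_Suc_conv_app_nth m_def)
  qed
  define L where "L = (\<lambda>i. coset_dist (p i) (g i) (Base \<one>))"
  have L_near: "coset_dist (p i) (a i) (Base (x i)) = L i" if "i < m" for i
    using coset_dist_translate[of "p i" "g i" "x i" "Base \<one>"] let_i[OF that] xG by (simp add: L_def a_def)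
  \<comment> \<open>\<open>r i\<close> is the \<open>i\<close>-th letter seen from the origin: it
    rotates about the coset of \<open>a i\<close> and carries the partial product \<open>x i\<close>
    to \<open>x (Suc i)\<close>. Multiplying by its inverse deletes the letter.\<close>
  define r where "r = (\<lambda>i. x i \<otimes> n i \<otimes> inv (x i))"
  have r: "r i \<in> rot (p i) (a i)" "r i \<otimes> x i = x (Suc i)" "r i \<in> carrier G" if "i < m" for i
    using rot_conjugate[of "p i" "g i" "n i" "x i"] let_i[OF that] xG x_Suc[OF that]
    by (auto simp: r_def a_def m_assoc)
  have L_near_Suc: "coset_dist (p i) (a i) (Base (x (Suc i))) = L i" if "i < m" for i
    using coset_dist_rot[of "p i" "a i" "r i" "x i"] r[OF that] let_i[OF that] aG[OF that] xG L_near[OF that] by simp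
  have split_i: "ws = take i ws @ (p i, g i, n i) # drop (Suc i) ws" if "i < m" for i
    using id_take_nth_drop[of i ws] that by (simp add: m_def ws_i)
  have L_far: "L i \<le> coset_dist (p i) (a i) (Base (x j))" if ij: "i < m" "j \<le> m" for i j
  proof (cases "j \<le> i")
    case True
    let ?B = "drop j (take i ws)"
    have t: "take i ws = take j ws @ ?B" using True by (metis append_take_drop_id min.absorb1 take_take)
    then have "tight_word (take j ws @ ?B @ (p i, g i, n i) # drop (Suc i) ws)"
      using tight split_i[OF ij(1)] by (metis append.assoc)
    from move_left[OF this] show ?thesis unfolding t[symmetric] by (simp add: L_def a_def x_def)
  next
    case False
    let ?B = "drop (Suc i) (take j ws)"
    have t: "take j ws = take i ws @ (p i, g i, n i) # ?B"
      using take_Suc_decomp[of i j ws] False ij by (simp add: m_def ws_i)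
    have "ws = (take i ws @ (p i, g i, n i) # ?B) @ drop j ws"
      using t by (metis append_take_drop_id)
    then have "tight_word (take i ws @ (p i, g i, n i) # ?B @ drop j ws)"
      using tight by (metis append.assoc append_Cons)
    from move_right[OF this] show ?thesis unfolding t[symmetric] by (simp add: L_def a_def x_def)
  qed
  have L_sep: "p i \<noteq> p j \<or> inv (a i) \<otimes> a j \<notin> p i" if ij: "i < j" "j < m" for i j
  proof (rule ccontr)
    assume "\<not> ?thesis"
    then have eq: "p j = p i" "inv (a i) \<otimes> a j \<in> p i" by auto
    let ?B = "drop (Suc i) (take j ws)"
    have t: "take j ws = take i ws @ (p i, g i, n i) # ?B"
      using take_Suc_decomp[of i j ws] ij by (simp add: m_def ws_i)
    have "ws = (take i ws @ (p i, g i, n i) # ?B) @ (p i, g j, n j) # drop (Suc j) ws"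
      using t split_i[OF ij(2)] eq by metis
    then have "tight_word (take i ws @ (p i, g i, n i) # ?B @ (p i, g j, n j) # drop (Suc j) ws)"
      using tight by (metis append.assoc append_Cons)
    from distinct_cosets[OF this] show False unfolding t[symmetric] using eq by (simp add: a_def x_def)
  qed
  have removed: "word_for (inv (r i) \<otimes> val ws) (take i ws @ drop (Suc i) ws)"
    "length (take i ws @ drop (Suc i) ws) < length ws" if "i < m" for i
  proof -
    let ?D = "drop (Suc i) ws"
    have D: "val ?D \<in> carrier G" by (rule val_closed[OF sub(2)])
    have "list_all letter ((p i, g i, n i) # ?D)" using let_i[OF that] sub by (simp add: letter_def)
    then have "val ws = x i \<otimes> (n i \<otimes> val ?D)"
      using split_i[OF that] val_append[OF sub(1)[of i]] by (metis val_Cons x_def)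
    then have "inv (r i) \<otimes> val ws = x i \<otimes> val ?D"
      using xG let_i[OF that] D by (simp add: r_def inv_mult_group m_assoc) (simp add: m_assoc[symmetric])
    then show "word_for (inv (r i) \<otimes> val ws) (take i ws @ ?D)"
      unfolding word_for_def using sub by (simp add: val_append x_def)
    show "length (take i ws @ ?D) < length ws" using that by (simp add: m_def)
  qed
  have r_ne: "r i \<noteq> \<one>" if "i < m" for i
  proof
    assume "r i = \<one>"
    then have "word_for (val ws) (take i ws @ drop (Suc i) ws)"
      using removed[OF that] val_closed[OF all] by simp
    then have "length ws \<le> length (take i ws @ drop (Suc i) ws)"
      unfolding word_for_def by (intro tight_word_cases(1)[OF tight]) blast+
    then show False using removed(2)[OF that] by simp
  qed
  \<comment> \<open>The depth required of an apex depends on the letter. As there are finitely many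
    letters, one depth \<open>k\<close> serves them all.\<close>
  have "eventually (\<lambda>k. \<forall>i\<in>{..<m}. dist (Horo (p i) (a i) k) (Base (x i)) \<le> L i + k + 1) sequentially"
  proof (intro eventually_ball_finite ballI)
    fix i assume "i \<in> {..<m}"
    then show "eventually (\<lambda>k. dist (Horo (p i) (a i) k) (Base (x i)) \<le> L i + k + 1) sequentially"
      using eventually_dist_deep_Base_le[of "p i" "a i" "x i"] let_i[of i] aG[of i] xG L_near[of i] by simp
  qed simp
  moreover have "eventually (\<lambda>k. \<forall>i\<in>{..<m}. dist (Horo (p i) (a i) k) (Base (x (Suc i))) \<le> L i + k + 1) sequentially"
  proof (intro eventually_ball_finite ballI)
    fix i assume "i \<in> {..<m}"
    then show "eventually (\<lambda>k. dist (Horo (p i) (a i) k) (Base (x (Suc i))) \<le> L i + k + 1) sequentially"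
      using eventually_dist_deep_Base_le[of "p i" "a i" "x (Suc i)"] let_i[of i] aG[of i] xG L_near_Suc[of i] by simp
  qed simp
  moreover have "eventually (\<lambda>k. \<forall>i\<in>{..<m}. gp (Horo (p i) (a i) k) (Base (x i)) (Base (x (Suc i))) \<le> real k + 1 + 2 * \<delta> - R0) sequentially"
  proof (intro eventually_ball_finite ballI)
    fix i assume "i \<in> {..<m}"
    then show "eventually (\<lambda>k. gp (Horo (p i) (a i) k) (Base (x i)) (Base (x (Suc i))) \<le> real k + 1 + 2 * \<delta> - R0) sequentially"
      using eventually_rot_turn[of "p i" "a i" "x i" "r i" R0] let_i[of i] aG[of i] xG[of i] r[of i] r_ne[of i] long R0 delta_ge_1
      by simp
  qed simp
  ultimately have "eventually (\<lambda>k. 1 \<le> k \<and> 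
     (\<forall>i\<in>{..<m}. dist (Horo (p i) (a i) k) (Base (x i)) \<le> L i + k + 1) \<and>
     (\<forall>i\<in>{..<m}. dist (Horo (p i) (a i) k) (Base (x (Suc i))) \<le> L i + k + 1) \<and>
     (\<forall>i\<in>{..<m}. gp (Horo (p i) (a i) k) (Base (x i)) (Base (x (Suc i))) \<le> real k + 1 + 2 * \<delta> - R0)) sequentially"
    using eventually_ge_at_top[of 1] by eventually_elim auto
  from eventually_happens'[OF sequentially_bot this] obtain k where kQ: "1 \<le> k \<and>
     (\<forall>i\<in>{..<m}. dist (Horo (p i) (a i) k) (Base (x i)) \<le> L i + k + 1) \<and>
     (\<forall>i\<in>{..<m}. dist (Horo (p i) (a i) k) (Base (x (Suc i))) \<le> L i + k + 1) \<and>
     (\<forall>i\<in>{..<m}. gp (Horo (p i) (a i) k) (Base (x i)) (Base (x (Suc i))) \<le> real k + 1 + 2 * \<delta> - R0)"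
    by (elim exE)
  then have k: "1 \<le> k"
     "\<And>i. i < m \<Longrightarrow> dist (Horo (p i) (a i) k) (Base (x i)) \<le> L i + k + 1"
     "\<And>i. i < m \<Longrightarrow> dist (Horo (p i) (a i) k) (Base (x (Suc i))) \<le> L i + k + 1"
     "\<And>i. i < m \<Longrightarrow> gp (Horo (p i) (a i) k) (Base (x i)) (Base (x (Suc i))) \<le> real k + 1 + 2 * \<delta> - R0"
    by (meson lessThan_iff)+
  \<comment> \<open>Cutting the horoballs off at level \<open>k - s\<close> instead of
    \<open>k\<close> adds \<open>s\<close> to every height and \<open>2 * s\<close> to the
    separation. Heights may be zero, so this shift supplies the lower bound
    \<open>12 * \<delta>\<close> and the surplus \<open>\<rho>\<close>; the turn shrinks
    accordingly.\<close>
  define s where "s = 12 * \<delta> + 1"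
  have ge: "coset_dist (p i) (a i) (Base w) + k \<le> dist (Horo (p i) (a i) k) (Base w)"
    if "i < m" "w \<in> carrier G" for i w
    using dist_deep_Base_ge[of "p i" "a i" w k] let_i[OF that(1)] aG[OF that(1)] that k(1) by simp
  interpret tc: tight_chain verts "\<lambda>u v. real (dist u v)" \<delta> "\<lambda>i. Base (x i)" "\<lambda>i. Horo (p i) (a i) k" m
    "real k - s" "R0 - s - 1 - 2 * \<delta>" "2 * s" "\<lambda>i. real (L i) + s"
  proof
    show "Horo (p i) (a i) k \<in> verts" if "i < m" for i using let_i[OF that] aG[OF that] k(1) by simp
    show "real (dist (Horo (p i) (a i) k) (Base (x i))) \<le> real k - s + (real (L i) + s) + 1" if "i < m" for i
      using k(2)[OF that] by simp
    show "real (dist (Horo (p i) (a i) k) (Base (x (Suc i)))) \<le> real k - s + (real (L i) + s) + 1" if "i < m" for i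
      using k(3)[OF that] by simp
    show "real k - s + (real (L i) + s) \<le> real (dist (Horo (p i) (a i) k) (Base (x j)))" if "i < m" "j \<le> m" for i j
      using ge[OF that(1) xG, of j] L_far[OF that] by simp
    show "2 * (real k - s) + 2 * s \<le> real (dist (Horo (p i) (a i) k) (Horo (p j) (a j) k))"
      if "i < m" "j < m" "i \<noteq> j" for i j
    proof -
      have "2 * k \<le> dist (Horo (p i) (a i) k) (Horo (p j) (a j) k)" if "i < j" "j < m" for i j
        using dist_deep_deep_ge[of "p i" "p j" "a i" "a j" k] let_i[of i] let_i[of j] aG[of i] aG[of j] L_sep[OF that] that k(1) by simp
      note H = this[of i j] this[of j i]
      have "dist (Horo (p i) (a i) k) (Horo (p j) (a j) k) = dist (Horo (p j) (a j) k) (Horo (p i) (a i) k)"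
        using let_i[of i] let_i[of j] aG[of i] aG[of j] that k(1) by (intro dist_commute) auto
      then have "2 * k \<le> dist (Horo (p i) (a i) k) (Horo (p j) (a j) k)"
        using H that by linarith
      then show ?thesis by simp
    qed
    show "gp (Horo (p i) (a i) k) (Base (x i)) (Base (x (Suc i))) \<le> real k - s - (R0 - s - 1 - 2 * \<delta>)"
      if "i < m" for i using k(4)[OF that] by simp
  qed (use xG R0 delta_ge_1 in \<open>auto simp: s_def\<close>)
  have "Max (L ` {..<m}) \<in> L ` {..<m}" using ne by (intro Max_in) (auto simp: m_def)
  then obtain i where i: "i < m" "L i = Max (L ` {..<m})" by auto
  have "L j \<le> L i" if "j < m" for j unfolding i(2) using that by (intro Max_ge) auto
  then have "gp (Horo (p i) (a i) k) (Base (x 0)) (Base (x m)) \<le> real k - s - (R0 - s - 1 - 2 * \<delta>) + 2 * \<delta>"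
    using i by (intro tc.highest_point_near_geodesic) auto
  moreover have x0m: "x 0 = \<one>" "x m = val ws" by (auto simp: x_def m_def val_def)
  ultimately have "real (coset_dist (p i) (a i) (Base \<one>)) + real (coset_dist (p i) (a i) (Base (val ws))) + 2 * R0 - 2 - 8 * \<delta>
       \<le> real (dist (Base \<one>) (Base (val ws)))"
    using ge[OF i(1), of \<one>] ge[OF i(1), of "val ws"] val_closed[OF all] unfolding gp_def x0m by (simp add: field_simps)
  then show ?thesis
    using that[of "p i" "a i" "inv (r i)"] removed[OF i(1)] rot_inv[of "p i" "a i" "r i"] let_i[OF i(1)] aG[OF i(1)] r[OF i(1)]
    by blast
qed

end

section \<open>Quasiconvex subgroups and deep horoballs\<close>

context group
begin

lemma mult_inv_cancel_left:
  assumes "x \<in> carrier G" "y \<in> carrier G"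
  shows "x \<otimes> (inv x \<otimes> y) = y" "inv x \<otimes> (x \<otimes> y) = y"
  using assms by (simp_all add: m_assoc[symmetric])

lemma conjugate_quotient:
  assumes "q \<in> carrier G" "q' \<in> carrier G" "e \<in> carrier G" "u \<in> carrier G" "v \<in> carrier G"
  shows "(e \<otimes> u) \<otimes> ((inv u \<otimes> q \<otimes> v) \<otimes> inv (inv u \<otimes> q' \<otimes> v)) \<otimes> inv (e \<otimes> u) = e \<otimes> (q \<otimes> inv q') \<otimes> inv e"
  using assms by (simp add: inv_mult_group m_assoc mult_inv_cancel_left)

end

section \<open>Comparison of generating sets\<close>

context cusped_space
begin

lemma word_length_mult:
  assumes "P \<in> Ps" "a \<in> P" "b \<in> P"
  shows "word_length G (S \<inter> P) (a \<otimes> b) \<le> word_length G (S \<inter> P) a + word_length G (S \<inter> P) b"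
proof -
  obtain ws where ws: "set ws \<subseteq> S \<inter> P" "lprod ws = a" "length ws = word_length G (S \<inter> P) a"
    using word_length_attained[OF assms(1,2)] .
  obtain vs where vs: "set vs \<subseteq> S \<inter> P" "lprod vs = b" "length vs = word_length G (S \<inter> P) b"
    using word_length_attained[OF assms(1,3)] .
  have "lprod (ws @ vs) = a \<otimes> b"
    using ws vs S_facts(2) lprod_append[of ws vs] by (auto simp del: foldr_append)
  then show ?thesis using word_length_le[of "ws @ vs" "S \<inter> P"] ws vs by (simp del: foldr_append)
qed

lemma lprod_in_P:
  assumes "P \<in> Ps" "set ws \<subseteq> P"
  shows "lprod ws \<in> P"
  using assms(2) by (induction ws) (auto intro: Ps_m Ps_one assms(1))

text \<open>A word of length at most \<open>c * 2 ^ k\<close> is cut into blocks of length at most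
  \<open>2 ^ k\<close>, each of which is bridged by one horizontal edge.\<close>

lemma dist_Horo_le:
  assumes "P \<in> Ps" "x \<in> carrier G" "h \<in> P" "word_length G (S \<inter> P) h \<le> c * 2 ^ k" "1 \<le> k"
  shows "dist (Horo P x k) (Horo P (x \<otimes> h) k) \<le> c"
  using assms(2-4)
proof (induction c arbitrary: x h)
  case 0
  then have "h = \<one>"
    using word_length_attained[OF assms(1) 0(2)] by (metis foldr.simps(1) id_apply le_zero_eq length_0_conv mult_0)
  then show ?case using 0 by simp
next
  case (Suc c)
  obtain ws where ws: "set ws \<subseteq> S \<inter> P" "lprod ws = h" "length ws = word_length G (S \<inter> P) h"
    using word_length_attained[OF assms(1) Suc.prems(2)] .
  define h1 where "h1 = lprod (take (2 ^ k) ws)"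
  define h2 where "h2 = lprod (drop (2 ^ k) ws)"
  have sub: "set (take (2 ^ k) ws) \<subseteq> S \<inter> P" "set (drop (2 ^ k) ws) \<subseteq> S \<inter> P"
    using ws(1) set_take_subset set_drop_subset by (metis subset_trans)+
  then have hP: "h1 \<in> P" "h2 \<in> P"
    using lprod_in_P[OF assms(1)] by (auto simp: h1_def h2_def)
  then have hG: "h1 \<in> carrier G" "h2 \<in> carrier G" using Ps_carrier[OF assms(1)] by auto
  have h: "h = h1 \<otimes> h2"
    unfolding h1_def h2_def using sub S_facts(2) ws(2)
    by (subst lprod_append[symmetric]) auto
  have "word_length G (S \<inter> P) h1 \<le> 2 ^ k"
    unfolding h1_def using word_length_le[OF sub(1)] by simp
  then have 1: "dist (Horo P x k) (Horo P (x \<otimes> h1) k) \<le> 1"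
    using assms hP Suc.prems by (intro dist_Horo_le_1) auto
  have "word_length G (S \<inter> P) h2 \<le> c * 2 ^ k"
    unfolding h2_def using word_length_le[OF sub(2)] ws(3) Suc.prems(3) by simp
  then have 2: "dist (Horo P (x \<otimes> h1) k) (Horo P (x \<otimes> h1 \<otimes> h2) k) \<le> c"
    using Suc.prems hP hG by (intro Suc.IH) auto
  have "dist (Horo P x k) (Horo P (x \<otimes> h1 \<otimes> h2) k) \<le>
      dist (Horo P x k) (Horo P (x \<otimes> h1) k) + dist (Horo P (x \<otimes> h1) k) (Horo P (x \<otimes> h1 \<otimes> h2) k)"
    using assms Suc.prems hG by (intro dist_triangle) auto
  then show ?case using 1 2 h hG Suc.prems by (simp add: m_assoc)
qed

text \<open>Changing generators multiplies peripheral word lengths by at most a constant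
  \<open>c\<close>. At depth \<open>k\<close> this turns \<open>2 ^ k\<close> into
  \<open>c * 2 ^ k\<close>, so a horizontal edge is replaced by at most \<open>c\<close> edges,
  whatever the depth.\<close>

lemma change_generating_set:
  assumes "compatible_gen_set G Ps T"
  shows "\<exists>C. \<forall>u v. cusp_adj G Ps T u v \<longrightarrow> dist u v \<le> C"
proof -
  interpret T: cusped_space G Ps T
    by (intro cusped_space.intro cusped_space_axioms.intro) (use assms finite_Ps subgroup_Ps group_axioms in blast)+
  define C1 where "C1 = Max (insert 0 ((\<lambda>s. dist (Base \<one>) (Base s)) ` T))"
  have C1: "dist (Base \<one>) (Base s) \<le> C1" if "s \<in> T" for s
    unfolding C1_def using that T.S_facts(1) by (intro Max_ge) auto
  define c where "c = Max (insert 0 ((\<lambda>(P, s). word_length G (S \<inter> P) s) ` (Ps \<times> T)))"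
  have c: "word_length G (S \<inter> P) s \<le> c" if "P \<in> Ps" "s \<in> T" for P s
    unfolding c_def using that T.S_facts(1) finite_Ps by (intro Max_ge) force+
  have wl: "word_length G (S \<inter> P) (lprod ws) \<le> c * length ws" if "P \<in> Ps" "set ws \<subseteq> T \<inter> P" for P ws
    using that(2)
  proof (induction ws)
    case Nil
    then show ?case using word_length_le[of "[]" "S \<inter> P"] by simp
  next
    case (Cons s ws)
    then have "s \<in> P" "lprod ws \<in> P" "s \<in> T" using lprod_in_P[OF that(1)] by auto
    then show ?case
      using Cons word_length_mult[of P s "lprod ws"] c[of P s] that(1) by fastforce
  qed
  have e0: "dist u v \<le> C1 + 1 + c" if "cusp_edge0 G Ps T u v" for u v
    using that unfolding cusp_edge0_def
  proof (elim disjE exE conjE, goal_cases)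
    case (1 x s)
    then have "dist u v = dist (Base \<one>) (Base s)"
      using dist_Base_translate[of x \<one> s] T.S_facts(2) by auto
    then show ?case using C1[OF 1(2)] by simp
  next
    case (2 P x)
    then show ?case using dist_adj[OF adj_Base_Horo[of x P]] by simp
  next
    case (3 P x k)
    then show ?case using dist_adj[OF adj_Horo_Suc[of x P k]] by simp
  next
    case (4 P x y k)
    let ?h = "inv x \<otimes> y"
    obtain ws where ws: "set ws \<subseteq> T \<inter> P" "lprod ws = ?h" "length ws = word_length G (T \<inter> P) ?h"
      using T.word_length_attained[OF 4(1) 4(5)] .
    have "word_length G (S \<inter> P) ?h \<le> c * length ws" using wl[OF 4(1) ws(1)] ws(2) by simp
    also have "\<dots> \<le> c * 2 ^ k" using 4(7) ws(3) by simp
    finally have "dist (Horo P x k) (Horo P (x \<otimes> ?h) k) \<le> c"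
      using 4 by (intro dist_Horo_le) auto
    then show ?case using 4 by (simp add: m_assoc[symmetric])
  qed
  have "dist u v \<le> C1 + 1 + c" if "cusp_adj G Ps T u v" for u v
    using that e0[of u v] e0[of v u] T.edge0_verts[of v u] dist_commute[of u v]
    by (auto simp: cusp_adj_def)
  then show ?thesis by blast
qed

section \<open>Excursions into horoballs and infinite parabolic intersections\<close>

lemma horoball_boundary:
  assumes "P \<in> Ps" "g \<in> carrier G" "adj u v" "in_horoball P g v" "\<not> in_horoball P g u"
  obtains e where "e \<in> carrier G" "u = Base e" "inv g \<otimes> e \<in> P"
proof -
  consider "edge0 u v" | "edge0 v u" using assms(3) by (auto simp: cusp_adj_def)
  then have "\<exists>e. e \<in> carrier G \<and> u = Base e \<and> inv g \<otimes> e \<in> P"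
  proof cases
    case 1
    then show ?thesis
      using assms coset_trans[of P g] unfolding cusp_edge0_def by auto
  next
    case 2
    then show ?thesis
      using assms coset_trans[of P g] unfolding cusp_edge0_def by auto
  qed
  then show ?thesis using that by blast
qed

text \<open>A horoball is entered and left only through base vertices of its coset. The proof takes
  the last outside vertex before \<open>i\<close> and the first one after it.\<close>

lemma horoball_excursion:
  assumes "P \<in> Ps" "g \<in> carrier G" "\<And>i. i < n \<Longrightarrow> adj (f i) (f (Suc i))"
    and "\<not> in_horoball P g (f 0)" "\<not> in_horoball P g (f n)" "i \<le> n" "in_horoball P g (f i)"
  shows "\<exists>j e. j \<le> i \<and> e \<in> carrier G \<and> f j = Base e \<and> inv g \<otimes> e \<in> P"
    "\<exists>j e. i \<le> j \<and> j \<le> n \<and> e \<in> carrier G \<and> f j = Base e \<and> inv g \<otimes> e \<in> P"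
proof -
  let ?I = "in_horoball P g"
  obtain j where j: "\<not> ?I (f j)" "\<forall>l. j < l \<and> l \<le> i \<longrightarrow> ?I (f l)" "j < i"
  proof -
    define j where "j = Max {l. l \<le> i \<and> \<not> ?I (f l)}"
    have fin: "finite {l. l \<le> i \<and> \<not> ?I (f l)}" by simp
    have "0 \<in> {l. l \<le> i \<and> \<not> ?I (f l)}" using assms(4) by simp
    then have "j \<in> {l. l \<le> i \<and> \<not> ?I (f l)}" unfolding j_def using fin by (intro Max_in) auto
    moreover have "?I (f l)" if "j < l" "l \<le> i" for l
    proof (rule ccontr)
      assume "\<not> ?I (f l)"
      then have "l \<le> j" unfolding j_def using that fin by (intro Max_ge) auto
      then show False using that by simp
    qed
    ultimately show ?thesis using assms(7) by (intro that[of j]) (auto simp: le_less)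
  qed
  then have "?I (f (Suc j))" "adj (f j) (f (Suc j))" using assms by auto
  then obtain e where "e \<in> carrier G" "f j = Base e" "inv g \<otimes> e \<in> P"
    using horoball_boundary[OF assms(1,2) _ _ j(1)] by metis
  then show "\<exists>j e. j \<le> i \<and> e \<in> carrier G \<and> f j = Base e \<and> inv g \<otimes> e \<in> P"
    using j(3) by (intro exI[of _ j] exI[of _ e]) auto
  define j' where "j' = (LEAST l. i \<le> l \<and> \<not> ?I (f l))"
  have "i \<le> n \<and> \<not> ?I (f n)" using assms by simp
  then have j': "i \<le> j' \<and> \<not> ?I (f j')" "j' \<le> n"
    unfolding j'_def by (rule LeastI, rule Least_le)
  have "j' \<noteq> i" using j' assms(7) by auto
  then obtain l where l: "j' = Suc l" "i \<le> l" using j' by (cases j') auto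
  have "?I (f l)" using not_less_Least[of l "\<lambda>l. i \<le> l \<and> \<not> ?I (f l)"] l unfolding j'_def[symmetric] by auto
  moreover have "adj (f j') (f l)" using assms(3)[of l] l j' adj_sym by simp
  ultimately obtain e where "e \<in> carrier G" "f j' = Base e" "inv g \<otimes> e \<in> P"
    using horoball_boundary[OF assms(1,2)] j'(1) by metis
  then show "\<exists>j e. i \<le> j \<and> j \<le> n \<and> e \<in> carrier G \<and> f j = Base e \<and> inv g \<otimes> e \<in> P"
    using j' by (intro exI[of _ j'] exI[of _ e]) auto
qed

text \<open>Fixing one element \<open>q0\<close> of the infinite set, the elements
  \<open>e \<otimes> (q \<otimes> inv q0) \<otimes> inv e\<close> lie in the conjugate of
  \<open>P\<close> because \<open>e\<close> lies in the coset of \<open>g\<close>. They lie in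
  \<open>H\<close> because conjugation by \<open>e \<otimes> u\<close> produces them from quotients
  of elements \<open>inv u \<otimes> q \<otimes> v\<close> of \<open>H\<close>.\<close>

lemma infinite_parabolic_intersection:
  assumes H: "subgroup H G" and P: "P \<in> Ps" and g: "g \<in> carrier G" and e: "e \<in> carrier G" "inv g \<otimes> e \<in> P"
    and uv: "u \<in> carrier G" "v \<in> carrier G" "e \<otimes> u \<in> H"
    and inf: "infinite {q \<in> P. inv u \<otimes> q \<otimes> v \<in> H}"
  shows "infinite (H \<inter> conjugate G g P)"
proof -
  let ?A = "{q \<in> P. inv u \<otimes> q \<otimes> v \<in> H}"
  obtain q0 where q0: "q0 \<in> ?A" using inf by (metis finite.emptyI ex_in_conv)
  have q0G: "q0 \<in> carrier G" using q0 P Ps_carrier by blast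
  define \<phi> where "\<phi> = (\<lambda>q. e \<otimes> (q \<otimes> inv q0) \<otimes> inv e)"
  have inj: "inj_on \<phi> ?A"
  proof (rule inj_onI)
    fix q q' assume q: "q \<in> ?A" "q' \<in> ?A" "\<phi> q = \<phi> q'"
    then have "q \<in> carrier G" "q' \<in> carrier G" using Ps_carrier[OF P] by auto
    then show "q = q'"
      using q(3) e q0G unfolding \<phi>_def by (metis inv_closed l_cancel m_closed r_cancel)
  qed
  have "\<phi> q \<in> H \<inter> conjugate G g P" if q: "q \<in> ?A" for q
  proof
    have qG: "q \<in> carrier G" using q Ps_carrier[OF P] by auto
    let ?w = "inv u \<otimes> q \<otimes> v" and ?w' = "inv u \<otimes> q0 \<otimes> v"
    have "(e \<otimes> u) \<otimes> (?w \<otimes> inv ?w') \<otimes> inv (e \<otimes> u) \<in> H"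
      using H q q0 uv by (auto intro!: subgroup.m_closed[OF H] subgroup.m_inv_closed[OF H])
    moreover have "(e \<otimes> u) \<otimes> (?w \<otimes> inv ?w') \<otimes> inv (e \<otimes> u) = \<phi> q"
      unfolding \<phi>_def using qG q0G e(1) uv(1,2) by (rule conjugate_quotient)
    ultimately show "\<phi> q \<in> H" by simp
    have "(inv g \<otimes> e) \<otimes> (q \<otimes> inv q0) \<otimes> inv (inv g \<otimes> e) \<in> P"
      using q q0 e by (auto intro!: Ps_m[OF P] Ps_inv[OF P])
    moreover have "(inv g \<otimes> e) \<otimes> (q \<otimes> inv q0) \<otimes> inv (inv g \<otimes> e) = inv g \<otimes> \<phi> q \<otimes> g"
      unfolding \<phi>_def using qG q0G e g by (simp add: inv_mult_group m_assoc)
    ultimately show "\<phi> q \<in> conjugate G g P"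
      using conjugate_iff[of g P "\<phi> q"] g Ps_carrier[OF P] qG q0G e(1) by (simp add: \<phi>_def subset_iff)
  qed
  then have sub: "\<phi> ` ?A \<subseteq> H \<inter> conjugate G g P" by blast
  show ?thesis
  proof
    assume "finite (H \<inter> conjugate G g P)"
    then have "finite (\<phi> ` ?A)" by (rule finite_subset[OF sub])
    then have "finite ?A" by (rule finite_imageD[OF _ inj])
    with inf show False by contradiction
  qed
qed

end

section \<open>Elements of a quasiconvex subgroup with deep geodesics\<close>

locale hyperbolic_cusped_space = cusped_space +
  hyperbolic "cusp_verts G Ps" "cusp_adj G Ps S" \<delta> for \<delta>
begin

text \<open>As \<open>v\<close> lies on a geodesic from \<open>s\<close> to \<open>t\<close>, its
  Gromov product with these ends is zero. By the four-point inequality, \<open>v\<close> therefore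
  has a product of at most \<open>\<delta>\<close> with an apex and one of the two ends; the
  distances to the apex translate this into a bound for the Busemann function.\<close>

lemma geodesic_deep:
  assumes "P \<in> Ps" "g \<in> carrier G" "s \<in> carrier G" "t \<in> carrier G" "v \<in> verts"
    and "dist (Base s) v + dist v (Base t) = dist (Base s) (Base t)"
    and "coset_dist P g (Base s) + A \<le> dist (Base s) v" "coset_dist P g (Base t) + A \<le> dist v (Base t)"
  shows "real_of_int (horofun P g v) \<le> 2 * \<delta> + 1 - real A"
proof -
  obtain k1 where k1: "k1 \<ge> 1" "\<And>k. k \<ge> k1 \<Longrightarrow> dist (Horo P g k) (Base s) \<le> coset_dist P g (Base s) + k + 1"
    using dist_deep_Base_le[OF assms(1-3)] by blast
  obtain k2 where k2: "k2 \<ge> 1" "\<And>k. k \<ge> k2 \<Longrightarrow> dist (Horo P g k) (Base t) \<le> coset_dist P g (Base t) + k + 1"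
    using dist_deep_Base_le[OF assms(1,2,4)] by blast
  define k where "k = max k1 k2"
  let ?z = "Horo P g k"
  have V: "?z \<in> verts" "Base s \<in> verts" "Base t \<in> verts" using assms k1(1) by (auto simp: k_def)
  have "gp v (Base s) (Base t) \<ge> min (gp v (Base s) ?z) (gp v ?z (Base t)) - \<delta>"
    using V assms by (intro gp_hyp) auto
  moreover have "gp v (Base s) (Base t) = 0"
    unfolding gp_def using assms V dist_commute[of v "Base s"] by simp
  moreover have "horofun P g v + int k \<le> int (dist ?z v)"
    using assms k1(1) by (intro dist_deep_ge) (auto simp: k_def)
  moreover have "dist ?z (Base s) \<le> coset_dist P g (Base s) + k + 1"
     "dist ?z (Base t) \<le> coset_dist P g (Base t) + k + 1"
    using k1(2)[of k] k2(2)[of k] by (auto simp: k_def)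
  ultimately show ?thesis
    unfolding gp_def using assms(7,8) V dist_commute[of v "Base s"] dist_commute[of ?z "Base s"]
      dist_commute[of v ?z] assms(5)
    by (simp add: min_def split: if_splits)
qed

text \<open>A geodesic of the quasiconvexity generating set from \<open>\<one>\<close> to
  \<open>t\<close> has a long excursion into the horoball. Its entry and exit points are close to
  \<open>H\<close>, so a long element of \<open>P\<close> lies in \<open>H\<close> up to two bounded
  corrections \<open>u\<close> and \<open>v\<close>. Only finitely many elements arise from those
  pairs of corrections that admit finitely many, so a long one comes from a pair admitting
  infinitely many.\<close>

lemma quasiconvex_deep_infinite:
  assumes "rel_quasiconvex G Ps H"
  shows "\<exists>R. \<forall>t\<in>H. \<forall>P\<in>Ps. \<forall>g\<in>carrier G.
    coset_dist P g (Base \<one>) + coset_dist P g (Base t) + R \<le> dist (Base \<one>) (Base t) \<longrightarrow>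
    infinite (H \<inter> conjugate G g P)"
proof -
  obtain T \<mu> where H: "subgroup H G" and T: "compatible_gen_set G Ps T" and
    qc: "\<And>ws b. is_geodesic (cusp_adj G Ps T) ws \<Longrightarrow> hd ws \<in> Base ` H \<Longrightarrow> last ws \<in> Base ` H \<Longrightarrow>
       b \<in> carrier G \<Longrightarrow> Base b \<in> set ws \<Longrightarrow> \<exists>h\<in>H. graph_dist (cusp_adj G Ps T) (Base b) (Base h) \<le> \<mu>"
    using assms unfolding rel_quasiconvex_def by blast
  interpret T: cusped_space G Ps T
    by (intro cusped_space.intro cusped_space_axioms.intro) (use T finite_Ps subgroup_Ps group_axioms in blast)+
  obtain C1 where C1: "\<And>u v. T.adj u v \<Longrightarrow> dist u v \<le> C1" using change_generating_set[OF T] by blast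
  obtain C2 where C2: "\<And>u v. adj u v \<Longrightarrow> T.dist u v \<le> C2" using T.change_generating_set[OF gen_set] by blast
  define C where "C = max C1 C2"
  have lip1: "dist u v \<le> C * T.dist u v" if "u \<in> verts" "v \<in> verts" for u v
    using T.lipschitz_map[OF connected_graph_axioms, of "\<lambda>v. v" C u v] that C1 by (force simp: C_def)
  have lip2: "T.dist u v \<le> C * dist u v" if "u \<in> verts" "v \<in> verts" for u v
    using lipschitz_map[OF T.connected_graph_axioms, of "\<lambda>v. v" C u v] that C2 by (force simp: C_def)
  obtain D0 where D0: "\<And>N c f l. quasigeodesic C N c \<and> geodesic (dist (c 0) (c N)) f \<and>
     f 0 = c 0 \<and> f (dist (c 0) (c N)) = c N \<and> l \<le> dist (c 0) (c N) \<Longrightarrow>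
     \<exists>i\<le>N. dist (f l) (c i) \<le> D0"
    using geodesic_near_quasigeodesic[of C] by blast
  define U where "U = {u \<in> carrier G. T.dist (Base \<one>) (Base u) \<le> \<mu>}"
  have finU: "finite U" unfolding U_def by (rule T.finite_Base_ball)
  define A where "A = (\<lambda>P u v. {q \<in> P. inv u \<otimes> q \<otimes> v \<in> H})"
  \<comment> \<open>\<open>F\<close> collects all elements that belong to finite sets
    \<open>A P u v\<close>; membership of any \<open>q\<close> outside \<open>F\<close> proves the
    corresponding set infinite.\<close>
  define F where "F = (\<Union>(P, u, v) \<in> {(P, u, v) \<in> Ps \<times> U \<times> U. finite (A P u v)}. A P u v)"
  have "finite F" unfolding F_def
  proof (rule finite_UN_I)
    show "finite {(P, u, v) \<in> Ps \<times> U \<times> U. finite (A P u v)}"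
      using finite_Ps finU by (intro finite_subset[OF _ finite_cartesian_product[of Ps "U \<times> U"]]) auto
  qed auto
  define \<Lambda> where "\<Lambda> = Max (insert 0 ((\<lambda>q. T.dist (Base \<one>) (Base q)) ` F))"
  have \<Lambda>: "T.dist (Base \<one>) (Base q) \<le> \<Lambda>" if "q \<in> F" for q
    unfolding \<Lambda>_def using that \<open>finite F\<close> by (intro Max_ge) auto
  \<comment> \<open>At distance \<open>B\<close> beyond the coset distance from both ends, the
    Busemann function on the geodesic is below \<open>- D0\<close>. A point of the quasigeodesic
    within \<open>D0\<close> then still has a negative value, and negative values occur only inside
    the horoball.\<close>
  define B where "B = nat \<lceil>2 * \<delta>\<rceil> + 2 + D0"
  have B: "2 * \<delta> + 1 - real B < - real D0" unfolding B_def by linarith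
  \<comment> \<open>The summands pay for the margins at both ends, for two passages from the
    geodesic to the quasigeodesic, and for turning an excursion longer than \<open>\<Lambda>\<close>
    into a distance of the other cusped space.\<close>
  define R where "R = 2 * B + 2 * D0 + C * \<Lambda> + 1"
  show ?thesis
  proof (intro exI[of _ R] ballI impI)
    fix t P g
    assume t: "t \<in> H" and P: "P \<in> Ps" and g: "g \<in> carrier G"
      and deep: "coset_dist P g (Base \<one>) + coset_dist P g (Base t) + R \<le> dist (Base \<one>) (Base t)"
    define E where "E = dist (Base \<one>) (Base t)"
    have tG: "t \<in> carrier G" using t H subgroup.mem_carrier by metis
    have V: "Base \<one> \<in> verts" "Base t \<in> verts" using tG by auto
    obtain f where f: "f 0 = Base \<one>" "f E = Base t" "\<And>i. i \<le> E \<Longrightarrow> f i \<in> verts"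
      "\<And>i j. i \<le> j \<Longrightarrow> j \<le> E \<Longrightarrow> dist (f i) (f j) = j - i"
      using geodesic_exists[OF V] unfolding E_def by metis
    define N where "N = T.dist (Base \<one>) (Base t)"
    obtain c where c: "c 0 = Base \<one>" "c N = Base t" "\<And>i. i < N \<Longrightarrow> T.adj (c i) (c (Suc i))"
      "\<And>i. i \<le> N \<Longrightarrow> c i \<in> verts" "\<And>i j. i \<le> j \<Longrightarrow> j \<le> N \<Longrightarrow> T.dist (c i) (c j) = j - i"
      using T.geodesic_exists[OF V] unfolding N_def by metis
    have near: "\<exists>i\<le>N. dist (f l) (c i) \<le> D0" if "l \<le> E" for l
    proof -
      have "j - i \<le> C * dist (c i) (c j)" if "i \<le> j" "j \<le> N" for i j
        using lip2[of "c i" "c j"] c(4)[of i] c(4)[of j] c(5)[OF that] that by simp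
      moreover have "dist (c i) (c (Suc i)) \<le> C" if "i < N" for i
        using C1[OF c(3)[OF that]] by (simp add: C_def)
      ultimately have "quasigeodesic C N c" unfolding quasigeodesic_def using c(4) by blast
      moreover have "geodesic E f" unfolding geodesic_def using f(3,4) by blast
      ultimately show ?thesis using D0[of N c f l] c(1,2) f(1,2) that by (simp add: E_def)
    qed
    have in_horo: "\<exists>i\<le>N. dist (f l) (c i) \<le> D0 \<and> in_horoball P g (c i)"
      if l: "coset_dist P g (Base \<one>) + B \<le> l" "coset_dist P g (Base t) + B + l \<le> E" for l
    proof -
      have lE: "l \<le> E" using l by simp
      have d: "dist (Base \<one>) (f l) = l" "dist (f l) (Base t) = E - l"
        using f(4)[of 0 l] f(4)[of l E] f(1,2) lE by auto
      have "real_of_int (horofun P g (f l)) \<le> 2 * \<delta> + 1 - real B"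
        using P g tG f(3)[OF lE] d l lE by (intro geodesic_deep[of P g \<one> t]) (auto simp: E_def)
      then have "horofun P g (f l) < - int D0" using B by linarith
      moreover obtain i where i: "i \<le> N" "dist (f l) (c i) \<le> D0" using near[OF lE] by blast
      moreover have "horofun P g (c i) \<le> horofun P g (f l) + int (dist (f l) (c i))"
        using P g f(3)[OF lE] c(4)[OF i(1)] by (intro horofun_lipschitz)
      ultimately have "horofun P g (c i) < 0" by linarith
      then show ?thesis using i by (auto simp: horofun_def split: if_splits)
    qed
    define l1 where "l1 = coset_dist P g (Base \<one>) + B"
    define l2 where "l2 = E - (coset_dist P g (Base t) + B)"
    have l12: "l1 \<le> l2" "l2 \<le> E" "R - 2 * B \<le> l2 - l1" 
      using deep unfolding l1_def l2_def R_def E_def by linarith+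
    obtain i1 where i1: "i1 \<le> N" "dist (f l1) (c i1) \<le> D0" "in_horoball P g (c i1)"
      using in_horo[of l1] l12 deep by (auto simp: l1_def R_def E_def)
    obtain i2 where i2: "i2 \<le> N" "dist (f l2) (c i2) \<le> D0" "in_horoball P g (c i2)"
    proof -
      have "coset_dist P g (Base \<one>) + B \<le> l2" using l12(1) by (simp add: l1_def)
      moreover have "coset_dist P g (Base t) + B + l2 \<le> E"
        using deep unfolding l2_def R_def E_def by linarith
      ultimately show ?thesis using in_horo[of l2] that by blast
    qed
    have Vi: "f l1 \<in> verts" "f l2 \<in> verts" "c i1 \<in> verts" "c i2 \<in> verts" using f(3) c(4) i1 i2 l12 by auto
    have "l2 - l1 \<le> D0 + dist (c i1) (c i2) + D0"
      using dist_triangle[of "f l1" "c i1" "f l2"] dist_triangle[of "c i1" "c i2" "f l2"] dist_commute[of "c i2" "f l2"]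
        Vi i1 i2 f(4)[OF l12(1,2)] by linarith
    then have "C * \<Lambda> < dist (c i1) (c i2)" using l12 by (simp add: R_def)
    also have "\<dots> \<le> C * T.dist (c i1) (c i2)" using lip1 Vi by blast
    finally have far: "\<Lambda> < T.dist (c i1) (c i2)" by (simp add: mult_less_cancel1)
    \<comment> \<open>The two indices may occur in either order along \<open>c\<close>. Between them
      the path may even leave the horoball: only a coset point before \<open>a\<close> and one after
      \<open>b\<close> are used.\<close>
    define a where "a = min i1 i2"
    define b where "b = max i1 i2"
    have ab: "a \<le> b" "b \<le> N" "in_horoball P g (c a)" "in_horoball P g (c b)"
      using i1 i2 by (auto simp: a_def b_def min_def max_def)
    have "b - a = T.dist (c i1) (c i2)"
      using c(5)[of i1 i2] c(5)[of i2 i1] T.dist_commute[of "c i1" "c i2"] i1 i2 Vi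
      by (auto simp: a_def b_def min_def max_def)
    then have ab_far: "\<Lambda> < b - a" using far by simp
    have ends: "\<not> in_horoball P g (c 0)" "\<not> in_horoball P g (c N)" using c(1,2) by auto
    have "a \<le> N" using ab by simp
    obtain j1 e where j1: "j1 \<le> a" "e \<in> carrier G" "c j1 = Base e" "inv g \<otimes> e \<in> P"
      using T.horoball_excursion(1)[of P g N c a] P g c(3) ends ab(3) \<open>a \<le> N\<close> by blast
    obtain j2 e' where j2: "b \<le> j2" "j2 \<le> N" "e' \<in> carrier G" "c j2 = Base e'" "inv g \<otimes> e' \<in> P"
      using T.horoball_excursion(2)[of P g N c b] P g c(3) ends ab(2,4) by blast
    let ?ws = "map c [0..<Suc N]"
    have hd_last: "hd ?ws = Base \<one>" "last ?ws = Base t"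
      using c(1,2) by (auto simp: hd_map simp del: upt_Suc) simp
    have geo: "is_geodesic T.adj ?ws"
      unfolding is_geodesic_def is_walk_def hd_last using c(3) by (auto simp: N_def simp del: upt_Suc)
    have ends': "hd ?ws \<in> Base ` H" "last ?ws \<in> Base ` H"
      unfolding hd_last using t subgroup.one_closed[OF H] by auto
    have "j1 \<in> set [0..<Suc N]" "j2 \<in> set [0..<Suc N]" using j1(1) j2(2) ab(1,2) by auto
    then have "c j1 \<in> set ?ws" "c j2 \<in> set ?ws" unfolding set_map by blast+
    then obtain h1 h2 where h: "h1 \<in> H" "T.dist (Base e) (Base h1) \<le> \<mu>" "h2 \<in> H" "T.dist (Base e') (Base h2) \<le> \<mu>"
      using qc[OF geo ends', of e] qc[OF geo ends', of e'] j1 j2 by metis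
    have hG: "h1 \<in> carrier G" "h2 \<in> carrier G" using h H subgroup.mem_carrier by metis+
    define u where "u = inv e \<otimes> h1"
    define v where "v = inv e' \<otimes> h2"
    define q where "q = inv e \<otimes> e'"
    have mul: "e \<otimes> u = h1" "e' \<otimes> v = h2" "e \<otimes> q = e'" "u \<in> carrier G" "v \<in> carrier G" "q \<in> carrier G"
      using j1 j2 hG by (auto simp: u_def v_def q_def m_assoc[symmetric])
    have uvU: "u \<in> U" "v \<in> U"
      using T.dist_Base_translate[of e \<one> u] T.dist_Base_translate[of e' \<one> v] mul h j1 j2 by (auto simp: U_def)
    \<comment> \<open>Both boundary points lie in the coset of \<open>g\<close>, so their quotient
      \<open>q\<close> is peripheral.\<close>
    have "inv (inv g \<otimes> e) \<otimes> (inv g \<otimes> e') \<in> P" using Ps_m[OF P] Ps_inv[OF P] j1 j2 by auto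
    moreover have "inv (inv g \<otimes> e) \<otimes> (inv g \<otimes> e') = q"
      using inv_mult_cancel[of "inv g" e e'] g j1 j2 by (simp add: q_def)
    ultimately have "q \<in> P" by simp
    moreover have "inv u \<otimes> q \<otimes> v = inv h1 \<otimes> h2"
      using j1 j2 hG unfolding u_def v_def q_def by (simp add: inv_mult_group m_assoc mult_inv_cancel_left)
    ultimately have qA: "q \<in> A P u v"
      using h subgroup.m_closed[OF H] subgroup.m_inv_closed[OF H] by (auto simp: A_def)
    have "T.dist (Base \<one>) (Base q) = T.dist (Base e) (Base e')"
      using T.dist_Base_translate[of e \<one> q] mul j1 by simp
    also have "\<dots> = j2 - j1" using c(5)[of j1 j2] j1 j2 ab by simp
    finally have "\<Lambda> < T.dist (Base \<one>) (Base q)" using ab_far j1 j2 ab by linarith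
    then have "q \<notin> F" using \<Lambda> by force
    then have "infinite (A P u v)" using qA uvU P by (auto simp: F_def)
    then show "infinite (H \<inter> conjugate G g P)"
      using H P g j1 mul h by (intro infinite_parabolic_intersection[of H P g e u v]) (auto simp: A_def)
  qed
qed

end

section \<open>Products in the kernel\<close>

context group
begin

lemma foldr_alt_prod:
  assumes "\<And>i. i \<in> set xs \<Longrightarrow> p i \<in> carrier G \<and> t i \<in> carrier G" "c \<in> carrier G"
  shows "foldr (\<lambda>i acc. p i \<otimes> t i \<otimes> acc) xs c \<in> carrier G"
    "foldr (\<lambda>i acc. p i \<otimes> t i \<otimes> acc) xs c = foldr (\<lambda>i acc. p i \<otimes> t i \<otimes> acc) xs \<one> \<otimes> c"
proof -
  have cl: "foldr (\<lambda>i acc. p i \<otimes> t i \<otimes> acc) xs c \<in> carrier G" if "c \<in> carrier G" for c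
    using assms(1) that by (induction xs) auto
  then show "foldr (\<lambda>i acc. p i \<otimes> t i \<otimes> acc) xs c \<in> carrier G" using assms(2) .
  show "foldr (\<lambda>i acc. p i \<otimes> t i \<otimes> acc) xs c = foldr (\<lambda>i acc. p i \<otimes> t i \<otimes> acc) xs \<one> \<otimes> c"
    using assms
  proof (induction xs)
    case (Cons i xs)
    have "foldr (\<lambda>i acc. p i \<otimes> t i \<otimes> acc) xs \<one> \<in> carrier G"
      using Cons.prems by (induction xs) auto
    then show ?case using Cons by (simp add: m_assoc)
  qed simp
qed

lemma alt_prod_0 [simp]: "alt_prod G p t 0 = \<one>"
  by (simp add: alt_prod_def)

lemma alt_prod_closed:
  "(\<And>i. i < n \<Longrightarrow> p i \<in> carrier G \<and> t i \<in> carrier G) \<Longrightarrow> alt_prod G p t n \<in> carrier G"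
  unfolding alt_prod_def by (rule foldr_alt_prod(1)) auto

lemma alt_prod_Suc:
  assumes "\<And>i. i \<le> n \<Longrightarrow> p i \<in> carrier G \<and> t i \<in> carrier G"
  shows "alt_prod G p t (Suc n) = alt_prod G p t n \<otimes> p n \<otimes> t n"
proof -
  have "alt_prod G p t (Suc n) = alt_prod G p t n \<otimes> (p n \<otimes> t n \<otimes> \<one>)"
    unfolding alt_prod_def using assms foldr_alt_prod(2)[of "[0..<n]" p t "p n \<otimes> t n \<otimes> \<one>"] by simp
  moreover have "alt_prod G p t n \<in> carrier G" using assms by (intro alt_prod_closed) auto
  ultimately show ?thesis using assms[of n] by (simp add: m_assoc)
qed

lemma alt_prod_cong:
  "(\<And>i. i < n \<Longrightarrow> t i = t' i) \<Longrightarrow> alt_prod G p t n = alt_prod G p t' n"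
  unfolding alt_prod_def by (rule foldr_cong) auto

text \<open>A left multiplication of the whole product by \<open>r\<close> is moved to position
  \<open>j\<close> by conjugating \<open>r\<close> with the prefix \<open>w\<close> in front of
  \<open>t j\<close>.\<close>

lemma alt_prod_update:
  assumes "\<And>i. i < n \<Longrightarrow> p i \<in> carrier G \<and> t i \<in> carrier G" "j < n" "r \<in> carrier G"
  defines "w \<equiv> alt_prod G p t j \<otimes> p j"
  shows "alt_prod G p (t(j := (inv w \<otimes> r \<otimes> w) \<otimes> t j)) n = r \<otimes> alt_prod G p t n"
proof -
  let ?t = "t(j := (inv w \<otimes> r \<otimes> w) \<otimes> t j)"
  have a: "alt_prod G p t j \<in> carrier G" using assms by (intro alt_prod_closed) auto
  have w: "w \<in> carrier G" using a assms by (auto simp: w_def)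
  have t': "p i \<in> carrier G \<and> ?t i \<in> carrier G" if "i < n" for i using assms that w by auto
  have "alt_prod G p ?t m = r \<otimes> alt_prod G p t m" if "Suc j \<le> m" "m \<le> n" for m
    using that
  proof (induction m rule: dec_induct)
    case base
    have "alt_prod G p ?t j = alt_prod G p t j" by (rule alt_prod_cong) auto
    then have "alt_prod G p ?t (Suc j) = w \<otimes> ((inv w \<otimes> r \<otimes> w) \<otimes> t j)"
      using alt_prod_Suc[of j p ?t] t' base assms(2) unfolding w_def by simp
    also have "\<dots> = r \<otimes> (w \<otimes> t j)"
      using w assms by (simp add: m_assoc mult_inv_cancel_left)
    also have "w \<otimes> t j = alt_prod G p t (Suc j)"
      using alt_prod_Suc[of j p t] assms unfolding w_def by simp
    finally show ?case .
  next
    case (step m)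
    have c: "alt_prod G p t m \<in> carrier G" "p m \<in> carrier G" "t m \<in> carrier G"
      using assms step by (auto intro: alt_prod_closed)
    have "alt_prod G p ?t (Suc m) = alt_prod G p ?t m \<otimes> p m \<otimes> ?t m"
      using t' step by (intro alt_prod_Suc) auto
    moreover have "alt_prod G p t (Suc m) = alt_prod G p t m \<otimes> p m \<otimes> t m"
      using assms step by (intro alt_prod_Suc) auto
    moreover have "?t m = t m" using step by simp
    moreover have "alt_prod G p ?t m = r \<otimes> alt_prod G p t m" using step.prems by (intro step.IH) simp
    ultimately show ?case using assms(3) c by (simp only: m_assoc m_closed)
  qed
  then show ?thesis using assms(2) by simp
qed

end

section \<open>Deep sides of polygons and the induction on word length\<close>

context hyperbolic_cusped_space
begin

text \<open>Depth of a side corresponds to a small Gromov product of its ends at an apex. If no side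
  were deep, all these products would be large, and so would be the product for the long side, up to
  the loss along the chain.\<close>

lemma deep_side_of_polygon:
  assumes "P \<in> Ps" "g \<in> carrier G" "1 \<le> n" "\<And>j. j \<le> n \<Longrightarrow> w j \<in> carrier G"
    and deep: "real (coset_dist P g (Base (w 0))) + real (coset_dist P g (Base (w n))) + B
        \<le> real (dist (Base (w 0)) (Base (w n)))"
  shows "\<exists>j<n. real (coset_dist P g (Base (w j))) + real (coset_dist P g (Base (w (Suc j)))) + (B - 2 - 2 * real n * \<delta>)
        \<le> real (dist (Base (w j)) (Base (w (Suc j))))"
proof (rule ccontr)
  assume neg: "\<not> ?thesis"
  obtain k1 where k1: "k1 \<ge> 1" "\<And>k. k \<ge> k1 \<Longrightarrow> dist (Horo P g k) (Base (w 0)) \<le> coset_dist P g (Base (w 0)) + k + 1"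
    using dist_deep_Base_le[of P g "w 0"] assms by blast
  obtain k2 where k2: "k2 \<ge> 1" "\<And>k. k \<ge> k2 \<Longrightarrow> dist (Horo P g k) (Base (w n)) \<le> coset_dist P g (Base (w n)) + k + 1"
    using dist_deep_Base_le[of P g "w n"] assms by blast
  define k where "k = max k1 k2"
  define c where "c = real k + 1 - B / 2 + real n * \<delta>"
  let ?z = "Horo P g k"
  have k: "1 \<le> k" "dist ?z (Base (w 0)) \<le> coset_dist P g (Base (w 0)) + k + 1"
     "dist ?z (Base (w n)) \<le> coset_dist P g (Base (w n)) + k + 1"
    using k1 k2(2)[of k] by (auto simp: k_def)
  have step: "c < gp ?z (Base (w j)) (Base (w (Suc j)))" if "j < n" for j
  proof -
    have "coset_dist P g (Base (w i)) + k \<le> dist ?z (Base (w i))" if "i \<le> n" for i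
      using assms that k(1) by (intro dist_deep_Base_ge) auto
    from this[of j] this[of "Suc j"] show ?thesis
      using neg that unfolding gp_def c_def by (force simp: field_simps)
  qed
  \<comment> \<open>All products exceed \<open>c\<close> strictly; passing to their minimum keeps
    the strict inequality, since the chain lemma takes only a weak bound.\<close>
  define c' where "c' = Min ((\<lambda>j. gp ?z (Base (w j)) (Base (w (Suc j)))) ` {..<n})"
  have ne: "{..<n} \<noteq> {}" using assms(3) by (simp add: lessThan_empty_iff)
  have c': "c < c'" unfolding c'_def using ne step by simp
  have "c' - real n * \<delta> \<le> gp ?z (Base (w 0)) (Base (w n))"
  proof (rule gp_chain[of ?z n n "\<lambda>j. Base (w j)" c'])
    show "n \<le> 2 ^ n" by (simp add: less_imp_le)
    show "c' \<le> gp ?z (Base (w j)) (Base (w (Suc j)))" if "j < n" for j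
      unfolding c'_def using that by (intro Min_le) auto
  qed (use assms k(1) in auto)
  moreover have "gp ?z (Base (w 0)) (Base (w n)) \<le> real k + 1 - B / 2"
    unfolding gp_def using k deep by (simp add: field_simps)
  ultimately show False using c' by (simp add: c_def)
qed

lemma kernel_avoids_products:
  fixes p :: "nat \<Rightarrow> 'a" and Q Z :: "nat \<Rightarrow> 'a set" and n :: nat
  assumes "\<forall>H\<in>\<Q>. rel_quasiconvex G Ps H"
    and "\<forall>i<n. p i \<in> carrier G \<and> Q i \<in> \<Q> \<and> Z i \<subseteq> Q i"
    and "\<forall>t. (\<forall>i<n. t i \<in> Q i - Z i) \<longrightarrow> alt_prod G p t n \<noteq> \<one>"
  shows "\<exists>F. finite F \<and> F \<subseteq> \<Union>Ps - {\<one>} \<and>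
     (\<forall>N. is_filling G Ps N \<and> (\<forall>H\<in>\<Q>. H_filling G Ps N H) \<and> (\<Union>P\<in>Ps. N P) \<inter> F = {} \<longrightarrow>
        (\<forall>t. (\<forall>i<n. t i \<in> Q i - ((filling_kernel G Ps N \<inter> Q i) <#> Z i)) \<longrightarrow>
             alt_prod G p t n \<notin> filling_kernel G Ps N))"
proof -
  \<comment> \<open>For \<open>n = 0\<close> the assumption about the products would claim that
    \<open>\<one>\<close> differs from itself.\<close>
  have n: "1 \<le> n" using assms(3) by (cases n) auto
  have Qsub: "subgroup (Q i) G" "p i \<in> carrier G" "Q i \<subseteq> carrier G" if "i < n" for i
    using assms(1,2) that subgroup.subset by (fastforce simp: rel_quasiconvex_def)+
  have "\<exists>R. \<forall>t\<in>Q i. \<forall>P\<in>Ps. \<forall>g\<in>carrier G.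
      coset_dist P g (Base \<one>) + coset_dist P g (Base t) + R \<le> dist (Base \<one>) (Base t) \<longrightarrow>
      infinite (Q i \<inter> conjugate G g P)" if "i < n" for i
    using assms(1,2) that by (intro quasiconvex_deep_infinite) auto
  then obtain R where R: "\<And>i t P g. i < n \<Longrightarrow> t \<in> Q i \<Longrightarrow> P \<in> Ps \<Longrightarrow> g \<in> carrier G \<Longrightarrow>
      coset_dist P g (Base \<one>) + coset_dist P g (Base t) + R i \<le> dist (Base \<one>) (Base t) \<Longrightarrow>
      infinite (Q i \<inter> conjugate G g P)"
    by metis
  \<comment> \<open>A side that is deeper than \<open>M\<close> cannot be labelled by some
    \<open>p i\<close>, being too long, and if it is labelled by \<open>t i\<close>, it is deep
    enough for the quasiconvexity constant of \<open>Q i\<close>.\<close>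
  define M where "M = (\<Sum>i<n. R i + dist (Base \<one>) (Base (p i)))"
  have M: "R i \<le> M" "dist (Base \<one>) (Base (p i)) \<le> M" if "i < n" for i
    using member_le_sum[of i "{..<n}" "\<lambda>i. R i + dist (Base \<one>) (Base (p i))"] that by (auto simp: M_def)
  \<comment> \<open>The term \<open>2 * real n * \<delta>\<close> pays for the polygon with
    \<open>2 * n\<close> sides and \<open>30 * \<delta>\<close> for the shortening of tight words;
    the rest leaves a depth greater than \<open>M\<close>.\<close>
  define R0 where "R0 = 30 * \<delta> + 4 + 2 * real n * \<delta> + real M"
  define F where "F = {h \<in> \<Union>Ps. h \<noteq> \<one> \<and> real (dist (Base \<one>) (Base h)) \<le> 2 * R0}"
  have "F \<subseteq> {x \<in> carrier G. dist (Base \<one>) (Base x) \<le> nat \<lfloor>2 * R0\<rfloor>}"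
    using Ps_carrier by (auto simp: F_def le_nat_floor)
  then have finF: "finite F" using finite_Base_ball finite_subset by blast
  show ?thesis
  proof (intro exI[of _ F] conjI allI impI)
    show "finite F" by (rule finF)
    show "F \<subseteq> \<Union>Ps - {\<one>}" by (auto simp: F_def)
    fix N t
    let ?K = "filling_kernel G Ps N"
    assume N: "is_filling G Ps N \<and> (\<forall>H\<in>\<Q>. H_filling G Ps N H) \<and> (\<Union>P\<in>Ps. N P) \<inter> F = {}"
      and t: "\<forall>i<n. t i \<in> Q i - ((?K \<inter> Q i) <#> Z i)"
    interpret dehn_filling G Ps S N by unfold_locales (use N in blast)
    interpret hyperbolic_filling G Ps S N \<delta> ..
    have long: "2 * R0 < real (dist (Base \<one>) (Base h))" if "P \<in> Ps" "h \<in> N P" "h \<noteq> \<one>" for P h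
      using N that N_facts(1)[OF that(1)] unfolding F_def by force
    have K: "subgroup ?K G"
      unfolding filling_kernel_def
      by (rule generate_is_subgroup) (use rot_carrier in \<open>auto simp: rot_def conjugate_def\<close>)
    \<comment> \<open>The tuple \<open>t\<close> has to vary in the induction on the length of a
      word for the product.\<close>
    have "False" if "word_for (alt_prod G p t n) ws" "\<forall>i<n. t i \<in> Q i - ((?K \<inter> Q i) <#> Z i)" for t ws
      using that
    proof (induction "length ws" arbitrary: t ws rule: less_induct)
      case less
      note t = less.prems(2)
      have tQ: "t i \<in> Q i" "t i \<in> carrier G" if "i < n" for i
        using t subsetD[OF Qsub(3)[OF that], of "t i"] that by auto
      let ?k = "alt_prod G p t n"
      \<comment> \<open>This makes the hypothesis on products applicable to the current
        \<open>t\<close>, so that the product is nontrivial and its tight word nonempty.\<close>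
      have "t i \<notin> Z i" if "i < n" for i
      proof
        assume "t i \<in> Z i"
        moreover have "\<one> \<in> ?K \<inter> Q i" using subgroup.one_closed K Qsub(1)[OF that] by auto
        ultimately have "\<one> \<otimes> t i \<in> (?K \<inter> Q i) <#> Z i" unfolding set_mult_def by blast
        then show False using t tQ(2)[OF that] that by simp
      qed
      then have k_ne: "?k \<noteq> \<one>" using assms(3) tQ by auto
      obtain vs where vs: "word_for ?k vs" "tight_word vs" "length vs \<le> length ws"
        using tight_word_exists[OF less.prems(1)] .
      have vs_k: "val vs = ?k" using vs(1) by (simp add: word_for_def)
      have "vs \<noteq> []" using k_ne vs_k by (auto simp: val_def)
      then obtain P a r us where r: "P \<in> Ps" "a \<in> carrier G" "r \<in> rot P a" "word_for (r \<otimes> ?k) us"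
        "length us < length vs"
        "real (coset_dist P a (Base \<one>)) + real (coset_dist P a (Base ?k)) + 2 * R0 - 2 - 8 * \<delta>
          \<le> real (dist (Base \<one>) (Base ?k))"
      proof (rule tight_word_shortening[OF vs(2)])
        show "30 * \<delta> \<le> R0" using delta_ge_1 by (simp add: R0_def)
        show "2 * R0 < real (dist (Base \<one>) (Base h))" if "P \<in> Ps" "h \<in> N P" "h \<noteq> \<one>" for P h
          using long that .
      qed (rule that, simp_all add: vs_k)
      \<comment> \<open>These are the corners of the polygon: the side starting at corner
        \<open>2 * i\<close> is labelled by \<open>p i\<close>, the one starting at corner
        \<open>2 * i + 1\<close> by \<open>t i\<close>.\<close>
      define w where "w = (\<lambda>j. if even j then alt_prod G p t (j div 2) else alt_prod G p t (j div 2) \<otimes> p (j div 2))"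
      have apG: "alt_prod G p t j \<in> carrier G" if "j \<le> n" for j
        using that tQ Qsub by (intro alt_prod_closed) auto
      have wG: "w j \<in> carrier G" if "j \<le> 2 * n" for j
        using that apG[of "j div 2"] Qsub(2)[of "j div 2"] by (auto simp: w_def elim!: oddE)
      have w_ends: "w 0 = \<one>" "w (2 * n) = ?k" by (auto simp: w_def)
      obtain j where j: "j < 2 * n" "real (coset_dist P a (Base (w j))) + real (coset_dist P a (Base (w (Suc j))))
          + (2 * R0 - 2 - 8 * \<delta> - 2 - 2 * real (2 * n) * \<delta>) \<le> real (dist (Base (w j)) (Base (w (Suc j))))"
        using deep_side_of_polygon[OF r(1,2), of "2 * n" w "2 * R0 - 2 - 8 * \<delta>"] wG r(6) n
        unfolding w_ends by (auto simp: algebra_simps)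
      have "real M < 2 * R0 - 2 - 8 * \<delta> - 2 - 2 * real (2 * n) * \<delta>"
        using delta_ge_1 by (simp add: R0_def algebra_simps)
      then have j': "coset_dist P a (Base (w j)) + coset_dist P a (Base (w (Suc j))) + M < dist (Base (w j)) (Base (w (Suc j)))"
        using j(2) by linarith
      define i where "i = j div 2"
      have i: "i < n" using j by (simp add: i_def)
      define b where "b = alt_prod G p t i \<otimes> p i"
      have bG: "b \<in> carrier G" using apG[of i] Qsub(2)[OF i] i by (simp add: b_def)
      have "odd j"
      proof
        assume "even j"
        then have "w j = alt_prod G p t i \<otimes> \<one>" "w (Suc j) = alt_prod G p t i \<otimes> p i"
          using apG[of i] i by (auto simp: w_def i_def elim!: evenE)
        then have "dist (Base (w j)) (Base (w (Suc j))) = dist (Base \<one>) (Base (p i))"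
          using dist_Base_translate[of "alt_prod G p t i" \<one> "p i"] apG[of i] Qsub(2)[OF i] i by simp
        then show False using j' M(2)[OF i] by linarith
      qed
      then have w_j: "w j = b \<otimes> \<one>" "w (Suc j) = b \<otimes> t i"
        using bG alt_prod_Suc[of i p t] tQ Qsub(2) i by (auto simp: w_def b_def i_def elim!: oddE)
      \<comment> \<open>Translation by the inverse of \<open>b\<close> moves the deep side to the
        one from \<open>\<one>\<close> to \<open>t i\<close>, where the quasiconvexity of
        \<open>Q i\<close> can be applied.\<close>
      define c where "c = inv b \<otimes> a"
      have cG: "c \<in> carrier G" and bc: "b \<otimes> c = a" using bG r(2) by (auto simp: c_def mult_inv_cancel_left)
      have "coset_dist P a (Base (b \<otimes> y)) = coset_dist P c (Base y)" if "y \<in> carrier G" for y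
        using coset_dist_translate[OF r(1) cG bG, of "Base y"] that bc by simp
      moreover have "dist (Base (b \<otimes> \<one>)) (Base (b \<otimes> t i)) = dist (Base \<one>) (Base (t i))"
        using dist_Base_translate[of b \<one> "t i"] bG tQ(2)[OF i] by simp
      ultimately have "coset_dist P c (Base \<one>) + coset_dist P c (Base (t i)) + R i \<le> dist (Base \<one>) (Base (t i))"
        using j' M(1)[OF i] tQ(2)[OF i] unfolding w_j by simp
      then have "infinite (Q i \<inter> conjugate G c P)" using R[OF i tQ(1)[OF i] r(1) cG] by blast
      \<comment> \<open>The filling condition for \<open>Q i\<close> enters here: one infinite
        intersection puts the whole rotation group inside \<open>Q i\<close>.\<close>
      then have rot_Q: "rot P c \<subseteq> Q i"
        using N assms(2) i r(1) cG unfolding H_filling_def rot_def by blast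
      define s where "s = inv b \<otimes> r \<otimes> b"
      have rG: "r \<in> carrier G" using r rot_carrier by blast
      have s: "s \<in> rot P c" using rot_conjugate[OF r(1-3), of "inv b"] bG by (simp add: s_def c_def)
      then have sKQ: "s \<in> ?K" "s \<in> Q i" "s \<in> carrier G"
        using rot_subset_kernel[OF r(1) cG s] rot_Q rot_carrier[OF r(1) cG s] by auto
      let ?t = "t(i := s \<otimes> t i)"
      \<comment> \<open>The new entry differs from \<open>t i\<close> by the left factor
        \<open>s\<close>, which lies in both \<open>?K\<close> and \<open>Q i\<close>; the condition
        on \<open>t i\<close> depends only on its coset with respect to this intersection.\<close>
      have "?t j \<in> Q j - ((?K \<inter> Q j) <#> Z j)" if "j < n" for j
      proof (cases "j = i")
        case True
        have "s \<otimes> t i \<in> Q i" using subgroup.m_closed[OF Qsub(1)[OF i] sKQ(2) tQ(1)[OF i]] .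
        moreover have "s \<otimes> t i \<notin> (?K \<inter> Q i) <#> Z i"
        proof
          assume "s \<otimes> t i \<in> (?K \<inter> Q i) <#> Z i"
          then obtain y z where y: "y \<in> ?K" "y \<in> Q i" and z: "z \<in> Z i" and eq: "s \<otimes> t i = y \<otimes> z"
            by (auto simp: set_mult_def)
          have G: "y \<in> carrier G" "z \<in> carrier G" using y z assms(2) i Qsub(3)[OF i] by auto
          have "t i = inv s \<otimes> (s \<otimes> t i)" using sKQ(3) tQ(2)[OF i] by (simp add: mult_inv_cancel_left)
          also have "\<dots> = (inv s \<otimes> y) \<otimes> z" using eq G sKQ(3) by (simp add: m_assoc)
          finally have "t i = (inv s \<otimes> y) \<otimes> z" .
          moreover have "inv s \<otimes> y \<in> ?K \<inter> Q i"
            using subgroup.m_closed subgroup.m_inv_closed K Qsub(1)[OF i] y sKQ by (metis IntI)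
          ultimately have "t i \<in> (?K \<inter> Q i) <#> Z i" using z unfolding set_mult_def by blast
          then show False using t i by blast
        qed
        ultimately show ?thesis using True by simp
      qed (use t that in auto)
      moreover have "alt_prod G p ?t n = r \<otimes> ?k"
        using alt_prod_update[of n p t i r] tQ(2) Qsub(2) i rG unfolding s_def b_def by blast
      ultimately show False using less.hyps[of us ?t] r(4,5) vs(3) by simp
    qed
    then show "alt_prod G p t n \<notin> ?K" using kernel_word t by blast
  qed
qed

end

theorem theorem6p4:
  fixes G :: "('g,'b) monoid_scheme" and \<P> \<Q> :: "'g set set" and n :: nat
    and p :: "nat \<Rightarrow> 'g" and Q S :: "nat \<Rightarrow> 'g set"
  assumes "rel_hyperbolic G \<P>"
    and "\<forall>H\<in>\<Q>. full_rel_quasiconvex G \<P> H"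
    and "\<forall>i<n. p i \<in> carrier G \<and> Q i \<in> \<Q> \<and> S i \<subseteq> Q i"
    and "\<forall>t. (\<forall>i<n. t i \<in> Q i - S i) \<longrightarrow> alt_prod G p t n \<noteq> \<one>\<^bsub>G\<^esub>"
  shows "\<exists>F. finite F \<and> F \<subseteq> (\<Union>\<P>) - {\<one>\<^bsub>G\<^esub>} \<and>
     (\<forall>N. is_filling G \<P> N \<and> (\<forall>H\<in>\<Q>. H_filling G \<P> N H) \<and> (\<Union>P\<in>\<P>. N P) \<inter> F = {} \<longrightarrow>
        (\<forall>t. (\<forall>i<n. t i \<in> Q i - ((filling_kernel G \<P> N \<inter> Q i) <#>\<^bsub>G\<^esub> S i)) \<longrightarrow>
             alt_prod G p t n \<notin> filling_kernel G \<P> N))"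
proof -
  obtain T \<delta>' where grp: "group G" and P: "finite \<P>" "\<forall>P\<in>\<P>. subgroup P G" and T: "compatible_gen_set G \<P> T"
    and hyp: "\<forall>w\<in>cusp_verts G \<P>. \<forall>x\<in>cusp_verts G \<P>. \<forall>y\<in>cusp_verts G \<P>. \<forall>z\<in>cusp_verts G \<P>.
      gromov_product (cusp_adj G \<P> T) w x z \<ge>
        min (gromov_product (cusp_adj G \<P> T) w x y) (gromov_product (cusp_adj G \<P> T) w y z) - \<delta>'"
    using assms(1) unfolding rel_hyperbolic_def hyperbolic_graph_def by blast
  \<comment> \<open>The hyperbolicity constant provided by the definition may be smaller than one or
    even negative.\<close>
  define \<delta> where "\<delta> = max 1 \<delta>'"
  interpret cusped_space G \<P> T
    by (intro cusped_space.intro cusped_space_axioms.intro) (use grp P T in blast)+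
  interpret hyperbolic_cusped_space G \<P> T \<delta>
  proof
    show "min ((real (dist w x) + real (dist w y) - real (dist x y)) / 2)
        ((real (dist w y) + real (dist w z) - real (dist y z)) / 2) - \<delta>
      \<le> (real (dist w x) + real (dist w z) - real (dist x z)) / 2"
      if "w \<in> verts" "x \<in> verts" "y \<in> verts" "z \<in> verts" for w x y z
      using hyp[rule_format, OF that] by (simp add: gromov_product_def \<delta>_def)
    show "real (dist x z) \<le> real (dist x y) + real (dist y z)"
      if "x \<in> verts" "y \<in> verts" "z \<in> verts" for x y z
      using dist_triangle[OF that] by linarith
  qed (auto simp: \<delta>_def dist_commute)
  have "\<forall>H\<in>\<Q>. rel_quasiconvex G \<P> H" using assms(2) by (simp add: full_rel_quasiconvex_def)
  then show ?thesis using assms(3,4) by (rule kernel_avoids_products)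
qed

end
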